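(* Let $\mathcal{I}$ be an invariant locus, i.e. a closed $\mathrm{SL}(2,\mathbb{R})$-invariant subset of a stratum of translation surfaces. If $\mathcal{I}$ contains a square-tiled surface, then its Lagrange spectrum $\mathcal{L}(\mathcal{I})=\{1/a(X): X\in\mathcal{I}\}$ contains a Hall's ray, i.e. there exists $r>0$ such that $[r,+\infty)\subset\mathcal{L}(\mathcal{I})$.
   Context: A translation surface $X=(S,w)$ is a compact Riemann surface $S$ of genus $g$ with a nonzero holomorphic 1-form $w$; its conical singularities are the zeros of $w$, of orders $k_1,\dots,k_r$ with $\sum k_i=2g-2$ (marked points, of order $0$, are allowed for tori). The stratum $\mathcal{H}(k_1,\dots,k_r)$ is the moduli space of translation surfaces with these orders of zeros; $\mathrm{SL}(2,\mathbb{R})$ acts on it by post-composing charts with linear maps. A saddle connection is a flat geodesic segment joining two conical singularities with none in its interior; $\mathrm{Hol}(X)\subset\mathbb{C}$ is the set of periods $v=\int_\gamma w$ of saddle connections. For $v\in\mathrm{Hol}(X)$ put $\mathrm{Area}(v)=|\Re v|\cdot|\Im v|$ and $$a(X)=\liminf_{|\Im v|\to\infty,\ v\in\mathrm{Hol}(X)}\frac{\mathrm{Area}(v)}{\mathrm{Area}(X)},$$ with $a(X)=0$ (so $1/a(X)=+\infty$) if $X$ has a vertical saddle connection. A square-tiled surface is a translation surface which is a translation cover of $\mathbb{R}^2/\mathbb{Z}^2$ ramified only over $0$, with conical singularities lying over $0$. *)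

theory Defs
  imports "HOL-Complex_Analysis.Complex_Analysis" "HOL-Library.Multiset"
begin

section \<open>Compact Riemann surfaces with a holomorphic 1-form\<close>

text \<open>A chart is a domain together with its coordinate function (relevant on the domain only).\<close>

type_synonym 'a chart = "'a set \<times> ('a \<Rightarrow> complex)"

definition riemann_surface :: "'a topology \<Rightarrow> 'a chart set \<Rightarrow> bool" where
  "riemann_surface S \<A> \<longleftrightarrow>
     Hausdorff_space S \<and> connected_space S \<and> topspace S \<noteq> {} \<and>
     (\<Union>(U, \<phi>)\<in>\<A>. U) = topspace S \<and>
     (\<forall>(U, \<phi>)\<in>\<A>. openin S U \<and> open (\<phi> ` U) \<and>
        homeomorphic_map (subtopology S U) (top_of_set (\<phi> ` U)) \<phi>) \<and>
     (\<forall>(U, \<phi>)\<in>\<A>. \<forall>(V, \<psi>)\<in>\<A>. (\<psi> \<circ> inv_into U \<phi>) holomorphic_on \<phi> ` (U \<inter> V))"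

text \<open>A holomorphic 1-form is given by its coefficient function in every chart:
  \<open>\<omega> (U, \<phi>)\<close> is the function \<open>h\<close> such that the form reads \<open>h(z) dz\<close> in the coordinate \<open>z = \<phi>\<close>.\<close>

definition holomorphic_form ::
    "'a chart set \<Rightarrow> ('a chart \<Rightarrow> complex \<Rightarrow> complex) \<Rightarrow> bool" where
  "holomorphic_form \<A> \<omega> \<longleftrightarrow>
     (\<forall>(U, \<phi>)\<in>\<A>. \<omega> (U, \<phi>) holomorphic_on \<phi> ` U) \<and>
     (\<forall>(U, \<phi>)\<in>\<A>. \<forall>(V, \<psi>)\<in>\<A>. \<forall>x\<in>U \<inter> V.
        \<omega> (U, \<phi>) (\<phi> x) = \<omega> (V, \<psi>) (\<psi> x) * deriv (\<psi> \<circ> inv_into U \<phi>) (\<phi> x))"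

text \<open>The component \<open>sing\<close> is the set of conical singularities, marked points included.\<close>

record 'a surface =
  top_of :: "'a topology"
  atlas :: "'a chart set"
  form :: "'a chart \<Rightarrow> complex \<Rightarrow> complex"
  sing :: "'a set"

definition zeros :: "'a surface \<Rightarrow> 'a set" where
  "zeros X = {x. \<exists>(U, \<phi>)\<in>atlas X. x \<in> U \<and> form X (U, \<phi>) (\<phi> x) = 0}"

text \<open>Since the orders of the zeros add up to \<open>2g - 2\<close>, the form has no zeros exactly when the
  surface is a torus. In that case the singularities are marked points, at least one of them
  (a torus in \<open>\<H>(0,\<dots>,0)\<close>); otherwise they are the zeros of the form.\<close>

definition translation_surface :: "'a surface \<Rightarrow> bool" where
  "translation_surface X \<longleftrightarrow>
     riemann_surface (top_of X) (atlas X) \<and> compact_space (top_of X) \<and>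
     holomorphic_form (atlas X) (form X) \<and>
     (\<exists>(U, \<phi>)\<in>atlas X. \<exists>x\<in>U. form X (U, \<phi>) (\<phi> x) \<noteq> 0) \<and>
     (if zeros X \<noteq> {} then sing X = zeros X
      else finite (sing X) \<and> sing X \<noteq> {} \<and> sing X \<subseteq> topspace (top_of X))"

definition chart_at :: "'a surface \<Rightarrow> 'a \<Rightarrow> 'a chart" where
  "chart_at X x = (SOME c. c \<in> atlas X \<and> x \<in> fst c)"

definition zero_order :: "'a surface \<Rightarrow> 'a \<Rightarrow> nat" where
  "zero_order X x = nat (zorder (form X (chart_at X x)) (snd (chart_at X x) x))"

text \<open>The stratum \<open>\<H>(k\<^sub>1,\<dots>,k\<^sub>r)\<close>, for the multiset of the orders \<open>k\<^sub>i\<close> (the singularities are not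
  labelled). It is modelled by the set of all translation surfaces with these orders which are
  carried by the type \<open>'a\<close>, that is, before isomorphic surfaces are identified.\<close>

definition stratum :: "nat multiset \<Rightarrow> 'a surface set" where
  "stratum \<kappa> = {X. translation_surface X \<and> image_mset (zero_order X) (mset_set (sing X)) = \<kappa>}"


section \<open>Translation charts, area and the action of SL(2,R)\<close>

text \<open>\<open>d\<zeta> = w\<close> on \<open>U\<close>.\<close>

definition local_primitive :: "'a surface \<Rightarrow> 'a set \<Rightarrow> ('a \<Rightarrow> complex) \<Rightarrow> bool" where
  "local_primitive X U \<zeta> \<longleftrightarrow> openin (top_of X) U \<and>
     (\<forall>(V, \<psi>)\<in>atlas X. \<forall>x\<in>U \<inter> V.
        ((\<zeta> \<circ> inv_into V \<psi>) has_field_derivative form X (V, \<psi>) (\<psi> x)) (at (\<psi> x)))"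

definition translation_charts :: "'a surface \<Rightarrow> 'a chart set" where
  "translation_charts X = {(U, \<zeta>). local_primitive X U \<zeta> \<and> inj_on \<zeta> U}"

text \<open>Translation charts cover the complement of finitely many points, and finitely many disjoint
  ones (e.g. the open triangles of a geodesic triangulation) exhaust the area.\<close>

definition area :: "'a surface \<Rightarrow> real" where
  "area X = enn2real
     (SUP F \<in> {F. finite F \<and> F \<subseteq> translation_charts X \<and>
                  pairwise (\<lambda>c d. disjnt (fst c) (fst d)) F}.
        \<Sum>(U, \<zeta>)\<in>F. emeasure lborel (\<zeta> ` U))"

definition mat_act :: "real^2^2 \<Rightarrow> complex \<Rightarrow> complex" where
  "mat_act A z = Complex (A$1$1 * Re z + A$1$2 * Im z) (A$2$1 * Re z + A$2$2 * Im z)"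

text \<open>\<open>Y\<close> is isomorphic to \<open>A \<cdot> X\<close>: up to a homeomorphism, the translation charts of \<open>Y\<close> are
  those of \<open>X\<close> post-composed with \<open>A\<close>. For \<open>A = 1\<close> this says that \<open>X\<close> and \<open>Y\<close> are isomorphic.\<close>

definition is_image_under :: "real^2^2 \<Rightarrow> 'a surface \<Rightarrow> 'a surface \<Rightarrow> bool" where
  "is_image_under A X Y \<longleftrightarrow>
     (\<exists>f. homeomorphic_map (top_of X) (top_of Y) f \<and> f ` sing X = sing Y \<and>
        (\<forall>(U, \<zeta>)\<in>translation_charts X.
           (f ` U, mat_act A \<circ> \<zeta> \<circ> inv_into (topspace (top_of X)) f) \<in> translation_charts Y))"

definition SL2_invariant :: "'a surface set \<Rightarrow> bool" where
  "SL2_invariant I \<longleftrightarrow>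
     (\<forall>X\<in>I. \<forall>A Y. det A = 1 \<and> translation_surface Y \<and> is_image_under A X Y \<longrightarrow> Y \<in> I)"


section \<open>The topology of a stratum\<close>

text \<open>The topology is the one of period coordinates: two surfaces are close if they have the same
  geodesic triangulation combinatorially, with close periods of the edges.

  A flat triangle with sides \<open>u\<close>, \<open>v\<close>, \<open>v - u\<close> in \<open>X\<close>: the map \<open>\<tau>\<close> pulls \<open>w\<close> back to \<open>dz\<close>,
  and precisely the three vertices are mapped to singularities, so that the sides become saddle
  connections with periods \<open>u\<close>, \<open>v\<close>, \<open>v - u\<close>.\<close>

definition flat_triangle ::
    "'a surface \<Rightarrow> complex \<Rightarrow> complex \<Rightarrow> (complex \<Rightarrow> 'a) \<Rightarrow> bool" where
  "flat_triangle X u v \<tau> \<longleftrightarrow> \<not> collinear {0, u, v} \<and>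
     continuous_map (top_of_set (convex hull {0, u, v})) (top_of X) \<tau> \<and>
     \<tau> ` {0, u, v} \<subseteq> sing X \<and>
     (\<forall>z \<in> convex hull {0, u, v} - {0, u, v}. \<tau> z \<notin> sing X \<and>
        (\<forall>(U, \<phi>)\<in>atlas X. \<tau> z \<in> U \<longrightarrow>
           (\<exists>d. ((\<phi> \<circ> \<tau>) has_field_derivative d) (at z within convex hull {0, u, v}) \<and>
                form X (U, \<phi>) (\<phi> (\<tau> z)) * d = 1)))"

text \<open>A triangulation into the \<open>n\<close> flat triangles \<open>\<tau> i\<close> with sides \<open>u i\<close>, \<open>v i\<close>. The triangles
  meet edge to edge automatically, as their open sides contain no singularity.\<close>

definition geodesic_triangulation ::
    "'a surface \<Rightarrow> nat \<Rightarrow> (nat \<Rightarrow> complex) \<Rightarrow> (nat \<Rightarrow> complex) \<Rightarrow> (nat \<Rightarrow> complex \<Rightarrow> 'a) \<Rightarrow> bool" where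
  "geodesic_triangulation X n u v \<tau> \<longleftrightarrow>
     (\<forall>i<n. flat_triangle X (u i) (v i) (\<tau> i)) \<and>
     (\<Union>i<n. \<tau> i ` (convex hull {0, u i, v i})) = topspace (top_of X) \<and>
     (\<forall>i<n. \<forall>j<n. \<forall>z \<in> interior (convex hull {0, u i, v i}). \<forall>z' \<in> convex hull {0, u j, v j}.
        \<tau> i z = \<tau> j z' \<longrightarrow> i = j \<and> z = z')"

definition period_ball ::
    "'a surface \<Rightarrow> nat \<Rightarrow> (nat \<Rightarrow> complex) \<Rightarrow> (nat \<Rightarrow> complex) \<Rightarrow> (nat \<Rightarrow> complex \<Rightarrow> 'a) \<Rightarrow> real
      \<Rightarrow> 'a surface set" where
  "period_ball X n u v \<tau> \<epsilon> = {Y. \<exists>f u' v' \<tau>'.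
     homeomorphic_map (top_of X) (top_of Y) f \<and> f ` sing X = sing Y \<and>
     geodesic_triangulation Y n u' v' \<tau>' \<and>
     (\<forall>i<n. dist (u' i) (u i) < \<epsilon> \<and> dist (v' i) (v i) < \<epsilon> \<and>
        (\<forall>s t. 0 \<le> s \<and> 0 \<le> t \<and> s + t \<le> 1 \<longrightarrow>
           f (\<tau> i (s *\<^sub>R u i + t *\<^sub>R v i)) = \<tau>' i (s *\<^sub>R u' i + t *\<^sub>R v' i)))}"

text \<open>Isomorphic surfaces belong to the same open sets, so this is the pullback of the topology of
  the moduli space, and its closed sets are the preimages of the closed subsets of that space.\<close>

definition stratum_open :: "nat multiset \<Rightarrow> 'a surface set \<Rightarrow> bool" where
  "stratum_open \<kappa> W \<longleftrightarrow> W \<subseteq> stratum \<kappa> \<and>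
     (\<forall>X\<in>W. \<forall>n u v \<tau>. geodesic_triangulation X n u v \<tau> \<longrightarrow>
        (\<exists>\<epsilon>>0. period_ball X n u v \<tau> \<epsilon> \<inter> stratum \<kappa> \<subseteq> W))"

definition stratum_topology :: "nat multiset \<Rightarrow> 'a surface topology" where
  "stratum_topology \<kappa> = topology (stratum_open \<kappa>)"

lemma period_ball_mono:
  assumes "\<epsilon> \<le> \<delta>"
  shows "period_ball X n u v \<tau> \<epsilon> \<subseteq> period_ball X n u v \<tau> \<delta>"
proof
  fix Y assume "Y \<in> period_ball X n u v \<tau> \<epsilon>"
  then obtain f u' v' \<tau>' where
    h: "homeomorphic_map (top_of X) (top_of Y) f" "f ` sing X = sing Y"
       "geodesic_triangulation Y n u' v' \<tau>'"
    and c: "\<forall>i<n. dist (u' i) (u i) < \<epsilon> \<and> dist (v' i) (v i) < \<epsilon> \<and>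
        (\<forall>s t. 0 \<le> s \<and> 0 \<le> t \<and> s + t \<le> 1 \<longrightarrow>
           f (\<tau> i (s *\<^sub>R u i + t *\<^sub>R v i)) = \<tau>' i (s *\<^sub>R u' i + t *\<^sub>R v' i))"
    unfolding period_ball_def by blast
  have "\<forall>i<n. dist (u' i) (u i) < \<delta> \<and> dist (v' i) (v i) < \<delta> \<and>
        (\<forall>s t. 0 \<le> s \<and> 0 \<le> t \<and> s + t \<le> 1 \<longrightarrow>
           f (\<tau> i (s *\<^sub>R u i + t *\<^sub>R v i)) = \<tau>' i (s *\<^sub>R u' i + t *\<^sub>R v' i))"
    using c less_le_trans[OF _ assms] by simp
  with h show "Y \<in> period_ball X n u v \<tau> \<delta>"
    unfolding period_ball_def mem_Collect_eq by (intro exI conjI)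
qed

lemma stratum_openD:
  assumes "stratum_open \<kappa> W" "X \<in> W" "geodesic_triangulation X n u v \<tau>"
  obtains \<epsilon> where "\<epsilon> > 0" "period_ball X n u v \<tau> \<epsilon> \<inter> stratum \<kappa> \<subseteq> W"
proof -
  have "\<exists>\<epsilon>>0. period_ball X n u v \<tau> \<epsilon> \<inter> stratum \<kappa> \<subseteq> W"
    using assms(1)[unfolded stratum_open_def, THEN conjunct2, rule_format, OF assms(2,3)] .
  then show thesis using that by (elim exE conjE)
qed

lemma stratum_open_subset: "stratum_open \<kappa> W \<Longrightarrow> W \<subseteq> stratum \<kappa>"
  unfolding stratum_open_def by (elim conjE)

lemma istopology_stratum_open: "istopology (stratum_open \<kappa>)"
  unfolding istopology_def
proof (intro conjI allI impI)
  fix V W :: "'a surface set"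
  assume V: "stratum_open \<kappa> V" and W: "stratum_open \<kappa> W"
  show "stratum_open \<kappa> (V \<inter> W)"
    unfolding stratum_open_def
  proof (intro conjI ballI allI impI)
    show "V \<inter> W \<subseteq> stratum \<kappa>" using stratum_open_subset[OF V] by (rule le_infI1)
  next
    fix X n u v and \<tau> :: "nat \<Rightarrow> complex \<Rightarrow> 'a"
    assume X: "X \<in> V \<inter> W" and T: "geodesic_triangulation X n u v \<tau>"
    obtain e where e: "e > 0" "period_ball X n u v \<tau> e \<inter> stratum \<kappa> \<subseteq> V"
      by (rule stratum_openD[OF V IntD1[OF X] T])
    obtain d where d: "d > 0" "period_ball X n u v \<tau> d \<inter> stratum \<kappa> \<subseteq> W"
      by (rule stratum_openD[OF W IntD2[OF X] T])
    have "period_ball X n u v \<tau> (min e d) \<inter> stratum \<kappa> \<subseteq> V \<inter> W"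
    proof (rule Int_greatest)
      show "period_ball X n u v \<tau> (min e d) \<inter> stratum \<kappa> \<subseteq> V"
        by (rule order_trans[OF Int_mono[OF period_ball_mono subset_refl] e(2)]) simp
      show "period_ball X n u v \<tau> (min e d) \<inter> stratum \<kappa> \<subseteq> W"
        by (rule order_trans[OF Int_mono[OF period_ball_mono subset_refl] d(2)]) simp
    qed
    moreover have "min e d > 0" using e(1) d(1) by simp
    ultimately show "\<exists>\<epsilon>>0. period_ball X n u v \<tau> \<epsilon> \<inter> stratum \<kappa> \<subseteq> V \<inter> W"
      by (intro exI conjI)
  qed
next
  fix \<W> :: "'a surface set set"
  assume W: "\<forall>W\<in>\<W>. stratum_open \<kappa> W"
  show "stratum_open \<kappa> (\<Union>\<W>)"
    unfolding stratum_open_def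
  proof (intro conjI ballI allI impI)
    show "\<Union>\<W> \<subseteq> stratum \<kappa>" by (rule Union_least) (rule stratum_open_subset[OF W[rule_format]])
  next
    fix X n u v and \<tau> :: "nat \<Rightarrow> complex \<Rightarrow> 'a"
    assume "X \<in> \<Union>\<W>" and T: "geodesic_triangulation X n u v \<tau>"
    then obtain W' where W': "W' \<in> \<W>" "X \<in> W'" by (elim UnionE)
    obtain e where e: "e > 0" "period_ball X n u v \<tau> e \<inter> stratum \<kappa> \<subseteq> W'"
      by (rule stratum_openD[OF W[rule_format, OF W'(1)] W'(2) T])
    have "period_ball X n u v \<tau> e \<inter> stratum \<kappa> \<subseteq> \<Union>\<W>"
      by (rule order_trans[OF e(2) Union_upper[OF W'(1)]])
    with e(1) show "\<exists>\<epsilon>>0. period_ball X n u v \<tau> \<epsilon> \<inter> stratum \<kappa> \<subseteq> \<Union>\<W>"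
      by (intro exI conjI)
  qed
qed

lemma openin_stratum_topology: "openin (stratum_topology \<kappa>) W \<longleftrightarrow> stratum_open \<kappa> W"
  by (simp add: stratum_topology_def topology_inverse' istopology_stratum_open)

lemma topspace_stratum_topology: "topspace (stratum_topology \<kappa>) = stratum \<kappa>"
proof -
  have *: "stratum_open \<kappa> (stratum \<kappa>)"
    unfolding stratum_open_def
    by (intro conjI ballI allI impI exI[of _ "1::real"] subset_refl Int_lower2) simp
  show ?thesis
  proof (rule equalityI)
    show "topspace (stratum_topology \<kappa>) \<subseteq> stratum \<kappa>"
      by (rule stratum_open_subset) (simp flip: openin_stratum_topology)
    show "stratum \<kappa> \<subseteq> topspace (stratum_topology \<kappa>)"
      by (rule openin_subset) (use * in \<open>simp add: openin_stratum_topology\<close>)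
  qed
qed

definition invariant_locus :: "nat multiset \<Rightarrow> 'a surface set \<Rightarrow> bool" where
  "invariant_locus \<kappa> I \<longleftrightarrow> closedin (stratum_topology \<kappa>) I \<and> SL2_invariant I"


section \<open>Saddle connections and the Lagrange spectrum\<close>

text \<open>\<open>w(\<gamma>'(t)) = a\<close>, computed in charts.\<close>

definition has_velocity :: "'a surface \<Rightarrow> (real \<Rightarrow> 'a) \<Rightarrow> real \<Rightarrow> complex \<Rightarrow> bool" where
  "has_velocity X \<gamma> t a \<longleftrightarrow>
     (\<forall>(U, \<phi>)\<in>atlas X. \<gamma> t \<in> U \<longrightarrow>
        (\<exists>d. ((\<phi> \<circ> \<gamma>) has_vector_derivative d) (at t) \<and> form X (U, \<phi>) (\<phi> (\<gamma> t)) * d = a))"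

text \<open>Flat geodesics are the paths along which \<open>w(\<gamma>')\<close> is a nonzero constant, i.e. which are
  straight in translation charts; they are parametrised here on \<open>{0..1}\<close> with constant speed.\<close>

definition saddle_connection :: "'a surface \<Rightarrow> (real \<Rightarrow> 'a) \<Rightarrow> bool" where
  "saddle_connection X \<gamma> \<longleftrightarrow> pathin (top_of X) \<gamma> \<and>
     \<gamma> 0 \<in> sing X \<and> \<gamma> 1 \<in> sing X \<and> (\<forall>t\<in>{0<..<1}. \<gamma> t \<notin> sing X) \<and>
     (\<exists>a. a \<noteq> 0 \<and> (\<forall>t\<in>{0<..<1}. has_velocity X \<gamma> t a))"

definition period :: "'a surface \<Rightarrow> (real \<Rightarrow> 'a) \<Rightarrow> complex" where
  "period X \<gamma> = integral {0..1} (\<lambda>t. THE a. has_velocity X \<gamma> t a)"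

definition Hol :: "'a surface \<Rightarrow> complex set" where
  "Hol X = {period X \<gamma> | \<gamma>. saddle_connection X \<gamma>}"

definition hol_area :: "complex \<Rightarrow> real" where
  "hol_area v = \<bar>Re v\<bar> * \<bar>Im v\<bar>"

definition lagrange_a :: "'a surface \<Rightarrow> ereal" where
  "lagrange_a X =
     (if \<exists>v\<in>Hol X. Re v = 0 then 0
      else Liminf (inf (filtercomap (\<lambda>v. \<bar>Im v\<bar>) at_top) (principal (Hol X)))
             (\<lambda>v. ereal (hol_area v / area X)))"

text \<open>In \<open>ereal\<close> we have \<open>1 / 0 = \<infinity>\<close>.\<close>

definition lagrange_spectrum :: "'a surface set \<Rightarrow> ereal set" where
  "lagrange_spectrum I = {1 / lagrange_a X | X. X \<in> I}"


section \<open>Square-tiled surfaces\<close>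

text \<open>The torus \<open>\<real>\<^sup>2/\<int>\<^sup>2\<close> as a product of two unit circles, with its projection from the plane.\<close>

definition torus :: "(complex \<times> complex) topology" where
  "torus = top_of_set (sphere 0 1 \<times> sphere 0 1)"

definition torus_proj :: "complex \<Rightarrow> complex \<times> complex" where
  "torus_proj z = (cis (2 * pi * Re z), cis (2 * pi * Im z))"

text \<open>A covering over the complement of \<open>0\<close> in the torus (cf. \<^term>\<open>covering_space\<close>).\<close>

definition covering_off_origin :: "'a topology \<Rightarrow> ('a \<Rightarrow> complex \<times> complex) \<Rightarrow> bool" where
  "covering_off_origin S p \<longleftrightarrow>
     continuous_map S torus p \<and> p ` topspace S = topspace torus \<and>
     (\<forall>y \<in> topspace torus - {torus_proj 0}. \<exists>V \<U>. openin torus V \<and> y \<in> V \<and>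
        \<Union>\<U> = {x \<in> topspace S. p x \<in> V} \<and> (\<forall>U\<in>\<U>. openin S U) \<and> pairwise disjnt \<U> \<and>
        (\<forall>U\<in>\<U>. homeomorphic_map (subtopology S U) (subtopology torus V) p))"

text \<open>The third condition says that \<open>w\<close> is the pullback under \<open>p\<close> of the form \<open>dz\<close> on the
  torus.\<close>

definition square_tiled :: "'a surface \<Rightarrow> bool" where
  "square_tiled X \<longleftrightarrow> translation_surface X \<and>
     (\<exists>p. covering_off_origin (top_of X) p \<and>
        (\<forall>x\<in>topspace (top_of X). \<exists>U \<zeta>. x \<in> U \<and> local_primitive X U \<zeta> \<and>
           (\<forall>y\<in>U. p y = torus_proj (\<zeta> y))) \<and>
        (\<forall>x\<in>sing X. p x = torus_proj 0))"

end

theory Submission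
  imports Defs
begin

text \<open>Only rotations \<open>rot c X\<close> of a square-tiled surface \<open>X\<close> are needed. All periods of \<open>X\<close> lie in
  \<open>\<int>[\<i>]\<close>, and if \<open>(\<alpha>, 1)\<close> becomes vertical, then \<open>a\<close> is the lower limit of \<open>\<bar>y\<bar> \<bar>x - \<alpha> y\<bar>\<close> over the
  periods \<open>x + \<i> y\<close>, divided by the area.

  In a rational direction the cylinders of \<open>X\<close> have a common period \<open>k\<close> depending on the number of
  squares only, so multitwists show that the set of periods is invariant under the normal closure
  \<open>N\<close> of the \<open>k\<close>-th power of the unipotent generator of \<open>SL(2,\<int>)\<close>. There is a horizontal period; let
  \<open>m0\<close> be the smallest one. Modulo \<open>N\<close> every matrix has an inverse that is a positive word with
  exponents \<open>\<le> k\<close>. Hence blocks \<open>L B C A\<close> can be concatenated to a continued fraction of \<open>\<alpha>\<close> where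
  \<open>C\<close> makes the matrix of the block lie in \<open>N\<close>: the convergents \<open>p / q\<close> before the large digits \<open>L\<close> then
  have the shortest period \<open>m0 (p, q)\<close>. By Hall's theorem on sums of continued fractions with
  bounded digits, \<open>A\<close> and \<open>B\<close> can be chosen such that \<open>L + [0; B] + [0; rev A]\<close> tends to any
  prescribed large number \<open>t\<close>, which gives the lower limit \<open>m0\<^sup>2 / t\<close>.\<close>

section \<open>Sums of continued fractions with bounded digits\<close>

text \<open>Only twists are known to preserve the periods, and for k >= 6 the normal closure of the
  k-th powers has infinite index in SL(2,Z), so returning to \<open>N\<close> cannot rest on
  finiteness of a quotient. What helps is that the generators have finite order modulo
  \<open>N\<close>: the exponent -a, which no continued fraction may contain, can be replaced by a
  positive number of size at most k. The correcting digits are then bounded independently of the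
  words that they correct.

  If a convergent p / q is followed by the digit a and g (p, q) is a period, it contributes g^2 / D
  with D between a and a + 2. Before the large digits g is at least m0, while before the others only
  g >= 1 is known; the ray therefore starts where t reaches m0^2 times the bound of the other digits
  plus 2.

  No cylinder of the surface is ever constructed. A multitwist acts on paths: their lifts over
  strips of the plane are slid along the strips. Digits up to 8, where Hall uses 4, leave ample room
  when gaps are compared with intervals.\<close>

fun ev :: "nat list \<Rightarrow> real \<Rightarrow> real" where
  "ev [] z = z"
| "ev (a # w) z = 1 / (real a + ev w z)"

lemma ev_append: "ev (u @ v) z = ev u (ev v z)"
  by (induction u) auto

lemma ev_bounds:
  assumes "\<forall>a\<in>set w. 1 \<le> a" "0 \<le> z" "z \<le> 1"
  shows "0 \<le> ev w z \<and> ev w z \<le> 1"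
  using assms by (induction w) (auto simp: divide_le_eq_1)

lemma ev_nonneg:
  assumes "0 \<le> z"
  shows "0 \<le> ev w z"
  using assms by (induction w) auto

text \<open>The denominators (q', q) of the last two convergents of the continued fraction
  \<open>[0; w]\<close>; the start (0, 1) belongs to the empty word.\<close>

definition dens :: "nat list \<Rightarrow> real \<times> real" where
  "dens w = foldl (\<lambda>(q', q) a. (q, real a * q + q')) (0, 1) w"

lemma dens_Nil [simp]: "dens [] = (0, 1)"
  by (simp add: dens_def)

lemma dens_snoc: "dens (w @ [a]) = (snd (dens w), real a * snd (dens w) + fst (dens w))"
  by (simp add: dens_def split: prod.split)

lemma dens_bounds:
  assumes "\<forall>a\<in>set w. 1 \<le> a"
  shows "0 \<le> fst (dens w) \<and> fst (dens w) \<le> snd (dens w) \<and> 1 \<le> snd (dens w) \<and> real (length w) \<le> snd (dens w)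
     \<and> (w \<noteq> [] \<longrightarrow> 1 \<le> fst (dens w))"
  using assms
proof (induction w rule: rev_induct)
  case Nil
  then show ?case by simp
next
  case (snoc a w)
  define q' q where "q' = fst (dens w)" and "q = snd (dens w)"
  have IH: "0 \<le> q'" "q' \<le> q" "1 \<le> q" "real (length w) \<le> q" "w \<noteq> [] \<longrightarrow> 1 \<le> q'" and a: "1 \<le> real a"
    using snoc by (auto simp: q'_def q_def)
  have m: "q \<le> real a * q" using a IH(3) by (simp add: mult_le_cancel_right1)
  have "real (length w) + 1 \<le> real a * q + q'"
  proof (cases "w = []")
    case True
    then have "real (length w) = 0" by simp
    with m IH show ?thesis by linarith
  next
    case False
    with m IH show ?thesis by linarith
  qed
  moreover have "q \<le> real a * q + q'" "1 \<le> real a * q + q'" using m IH by linarith+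
  ultimately show ?case
    using IH by (simp add: dens_snoc flip: q'_def q_def)
qed

text \<open>\<open>ev w\<close> is a Moebius map of determinant 1 or -1 whose denominator at z is q
  + q' z, where (q', q) = \<open>dens w\<close>. Such a map divides the distance of two points by
  the product of their denominators.\<close>

lemma ev_diff:
  assumes "\<forall>a\<in>set w. 1 \<le> a" "0 \<le> y" "0 \<le> z"
  shows "\<bar>ev w y - ev w z\<bar> =
    \<bar>y - z\<bar> / ((snd (dens w) + fst (dens w) * y) * (snd (dens w) + fst (dens w) * z))"
  using assms
proof (induction w arbitrary: y z rule: rev_induct)
  case Nil
  then show ?case by simp
next
  case (snoc a w)
  define q' q where "q' = fst (dens w)" and "q = snd (dens w)"
  have a: "1 \<le> real a" and w: "\<forall>a\<in>set w. 1 \<le> a" using snoc.prems by auto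
  have qb: "0 \<le> q'" "1 \<le> q" using dens_bounds[OF w] by (auto simp: q'_def q_def)
  define A B where "A = real a + y" and "B = real a + z"
  have A: "A > 0" "B > 0" using a snoc.prems by (auto simp: A_def B_def)
  have "\<bar>ev (w @ [a]) y - ev (w @ [a]) z\<bar> = \<bar>ev w (1 / A) - ev w (1 / B)\<bar>"
    by (simp add: ev_append A_def B_def)
  also have "\<dots> = \<bar>1 / A - 1 / B\<bar> / ((q + q' * (1/A)) * (q + q' * (1/B)))"
    using snoc.IH[OF w, of "1/A" "1/B"] A by (simp add: q'_def q_def)
  also have "\<bar>1 / A - 1 / B\<bar> = \<bar>y - z\<bar> / (A * B)"
  proof -
    have "1 / A - 1 / B = (z - y) / (A * B)" using A by (simp add: A_def B_def field_simps)
    then show ?thesis using A by (simp add: abs_mult abs_minus_commute)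
  qed
  also have "(q + q' * (1/A)) * (q + q' * (1/B)) = (q * A + q') * (q * B + q') / (A * B)"
    using A by (simp add: field_simps)
  also have "\<bar>y - z\<bar> / (A * B) / ((q * A + q') * (q * B + q') / (A * B)) = \<bar>y - z\<bar> / ((q * A + q') * (q * B + q'))"
    using A by simp
  finally show ?case
    by (simp add: dens_snoc A_def B_def algebra_simps flip: q'_def q_def)
qed

lemma ev_contract:
  assumes "\<forall>a\<in>set w. 1 \<le> a" "0 \<le> y" "0 \<le> z" "y \<le> 1" "z \<le> 1" "w \<noteq> []"
  shows "\<bar>ev w y - ev w z\<bar> \<le> 1 / real (length w)"
proof -
  define q' q where "q' = fst (dens w)" and "q = snd (dens w)"
  have qb: "0 \<le> q'" "1 \<le> q" "real (length w) \<le> q"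
    using dens_bounds[OF assms(1)] by (auto simp: q'_def q_def)
  have l: "real (length w) \<ge> 1" using assms(6) by (cases w) auto
  have "real (length w) \<le> q * 1" using qb by simp
  also have "\<dots> \<le> (q + q' * y) * (q + q' * z)"
    using qb assms by (intro mult_mono) (auto simp: add_increasing2 intro!: mult_nonneg_nonneg add_nonneg_nonneg)
  finally have d: "real (length w) \<le> (q + q' * y) * (q + q' * z)" .
  have "\<bar>ev w y - ev w z\<bar> = \<bar>y - z\<bar> / ((q + q' * y) * (q + q' * z))"
    using ev_diff[OF assms(1-3)] by (simp add: q'_def q_def)
  also have "\<dots> \<le> 1 / real (length w)"
    using d l assms by (intro frac_le) auto
  finally show ?thesis .
qed

text \<open>Every digit contributes one order-reversing inversion, so the parity of the length
  decides the direction. Only the alternative is recorded, because the intervals below are treated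
  without orientation.\<close>

lemma ev_mono_or_antimono:
  assumes "\<forall>a\<in>set w. 1 \<le> a"
  shows "(\<forall>y z. 0 \<le> y \<longrightarrow> y \<le> z \<longrightarrow> ev w y \<le> ev w z) \<or> (\<forall>y z. 0 \<le> y \<longrightarrow> y \<le> z \<longrightarrow> ev w z \<le> ev w y)"
  using assms
proof (induction w)
  case Nil
  then show ?case by auto
next
  case (Cons a w)
  have p: "0 < real a + ev w z" if "0 \<le> z" for z
    using Cons.prems ev_nonneg[OF that, of w] by auto
  from Cons consider "\<forall>y z. 0 \<le> y \<longrightarrow> y \<le> z \<longrightarrow> ev w y \<le> ev w z" | "\<forall>y z. 0 \<le> y \<longrightarrow> y \<le> z \<longrightarrow> ev w z \<le> ev w y"
    by auto
  then show ?case
  proof cases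
    case 1
    then have "\<forall>y z. 0 \<le> y \<longrightarrow> y \<le> z \<longrightarrow> ev (a#w) z \<le> ev (a#w) y"
      using p by (auto intro!: frac_le)
    then show ?thesis ..
  next
    case 2
    then have "\<forall>y z. 0 \<le> y \<longrightarrow> y \<le> z \<longrightarrow> ev (a#w) y \<le> ev (a#w) z"
      using p by (auto intro!: frac_le)
    then show ?thesis ..
  qed
qed

text \<open>\<open>hlam\<close> = [0; 8, 1, 8, 1, ...] and \<open>hmu\<close> = [0; 1, 8, 1, 8, ...]
  are the extreme values of infinite continued fractions with digits in {1..8}. The equation x = 1 /
  (8 + 1 / (1 + x)) amounts to 8 x (1 + x) = 1, whose positive root is \<open>hlam\<close>.\<close>

definition hlam :: real where "hlam = (sqrt (3/2) - 1) / 2"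
definition hmu :: real where "hmu = 8 * hlam"

lemma hlam_eq: "8 * hlam * (1 + hlam) = 1"
  by (simp add: hlam_def field_simps)

lemma hlam_bounds: "0.11 < hlam" "hlam < 0.12"
proof -
  have "1.22 < sqrt (3/2)" by (rule real_less_rsqrt) (simp add: power2_eq_square)
  then show "0.11 < hlam" by (simp add: hlam_def)
  have "sqrt (3/2) < 1.24" by (rule real_less_lsqrt) (simp_all add: power2_eq_square)
  then show "hlam < 0.12" by (simp add: hlam_def)
qed

lemma hmu_eq: "hmu = 1 / (1 + hlam)" "hlam = 1 / (8 + hmu)"
  using hlam_eq hlam_bounds by (simp_all add: hmu_def field_simps)

section \<open>Intervals of continued fractions, their gaps and their children\<close>

definition EV :: "nat list \<Rightarrow> real \<Rightarrow> real" where "EV w Z = ev w (1 / Z)"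

lemma EV_snoc: "EV (w @ [a]) Z = EV w (real a + 1 / Z)"
  by (simp add: EV_def ev_append)

lemma EV_diff:
  assumes "\<forall>a\<in>set w. 1 \<le> a" "0 < Y" "0 < Z"
  shows "\<bar>EV w Y - EV w Z\<bar> =
    \<bar>Y - Z\<bar> / ((snd (dens w) * Y + fst (dens w)) * (snd (dens w) * Z + fst (dens w)))"
proof -
  define q' q where "q' = fst (dens w)" and "q = snd (dens w)"
  have "\<bar>EV w Y - EV w Z\<bar> = \<bar>1/Y - 1/Z\<bar> / ((q + q' * (1/Y)) * (q + q' * (1/Z)))"
    unfolding EV_def q_def q'_def by (rule ev_diff) (use assms in auto)
  also have "\<bar>1 / Y - 1 / Z\<bar> = \<bar>Y - Z\<bar> / (Y * Z)"
  proof -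
    have "1 / Y - 1 / Z = (Z - Y) / (Y * Z)" using assms by (simp add: field_simps)
    then show ?thesis using assms by (simp add: abs_mult abs_minus_commute)
  qed
  also have "(q + q' * (1/Y)) * (q + q' * (1/Z)) = (q * Y + q') * (q * Z + q') / (Y * Z)"
    using assms by (simp add: field_simps)
  also have "\<bar>Y - Z\<bar> / (Y * Z) / ((q * Y + q') * (q * Z + q') / (Y * Z)) = \<bar>Y - Z\<bar> / ((q * Y + q') * (q * Z + q'))"
    using assms by simp
  finally show ?thesis by (simp add: q_def q'_def)
qed

text \<open>A node \<open>(w, i)\<close> stands for the interval spanned by the continued fractions over \<open>{1..8}\<close>
  that start with \<open>w\<close> and continue with a digit \<open>\<ge> i\<close>.\<close>

type_synonym node = "nat list \<times> nat"

text \<open>The second component stops at 7, so that at least two digits remain possible after the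
  word and there is a gap to remove. When only 8 is left, \<open>nch2\<close> moves it into the
  word.\<close>

definition node_ok :: "node \<Rightarrow> bool" where
  "node_ok I \<longleftrightarrow> set (fst I) \<subseteq> {1..8} \<and> 1 \<le> snd I \<and> snd I \<le> 7"

text \<open>In terms of the complete quotient after the word, an interval runs from i +
  \<open>hlam\<close> to 8 + \<open>hmu\<close>. Quotients with first digit i end at i +
  \<open>hmu\<close>, those with a larger digit begin at i + 1 + \<open>hlam\<close>, and the gap
  lies between. Which end is the left one depends on the parity of the word, whence the minimum and
  maximum in \<open>nint\<close>.\<close>

definition nend1 :: "node \<Rightarrow> real" where "nend1 I = EV (fst I) (real (snd I) + hlam)"
definition nend2 :: "node \<Rightarrow> real" where "nend2 I = EV (fst I) (8 + hmu)"
definition ngap1 :: "node \<Rightarrow> real" where "ngap1 I = EV (fst I) (real (snd I) + hmu)"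
definition ngap2 :: "node \<Rightarrow> real" where "ngap2 I = EV (fst I) (real (snd I) + 1 + hlam)"
definition nlen :: "node \<Rightarrow> real" where "nlen I = \<bar>nend1 I - nend2 I\<bar>"
definition ngap :: "node \<Rightarrow> real" where "ngap I = \<bar>ngap1 I - ngap2 I\<bar>"
definition nint :: "node \<Rightarrow> real set" where "nint I = {min (nend1 I) (nend2 I)..max (nend1 I) (nend2 I)}"
definition nch1 :: "node \<Rightarrow> node" where "nch1 I = (fst I @ [snd I], 1)"
definition nch2 :: "node \<Rightarrow> node" where
  "nch2 I = (if snd I < 7 then (fst I, Suc (snd I)) else (fst I @ [8], 1))"

lemma node_ok_ge1: "node_ok I \<Longrightarrow> \<forall>a\<in>set (fst I). 1 \<le> a"
  by (auto simp: node_ok_def)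

lemma node_ok_children: "node_ok I \<Longrightarrow> node_ok (nch1 I)" "node_ok I \<Longrightarrow> node_ok (nch2 I)"
  by (auto simp: node_ok_def nch1_def nch2_def)

lemma nends_nch1: "nend1 (nch1 I) = ngap1 I" "nend2 (nch1 I) = nend1 I"
  using hmu_eq by (simp_all add: nend1_def nend2_def ngap1_def nch1_def EV_snoc)

text \<open>An equality of unordered pairs, because appending the digit 8 reverses the orientation
  while raising the lower digit keeps it.\<close>

lemma nends_nch2:
  assumes "node_ok I"
  shows "{nend1 (nch2 I), nend2 (nch2 I)} = {ngap2 I, nend2 I}"
proof (cases "snd I < 7")
  case True
  then show ?thesis by (simp add: nend1_def nend2_def ngap2_def nch2_def add.commute add.left_commute)
next
  case False
  then have "snd I = 7" using assms by (simp add: node_ok_def)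
  then have "nend2 (nch2 I) = ngap2 I" "nend1 (nch2 I) = nend2 I"
    using hmu_eq by (simp_all add: nend1_def nend2_def ngap2_def nch2_def EV_snoc)
  then show ?thesis by auto
qed

lemma nint_eq: "{nend1 I, nend2 I} = {a, b} \<Longrightarrow> nint I = {min a b..max a b}"
  "{nend1 I, nend2 I} = {a, b} \<Longrightarrow> nlen I = \<bar>a - b\<bar>"
  by (auto simp: nint_def nlen_def doubleton_eq_iff min.commute max.commute abs_minus_commute)

definition sums_to :: "real \<Rightarrow> real set \<Rightarrow> real set \<Rightarrow> bool" where
  "sums_to s A B \<longleftrightarrow> (\<exists>x\<in>A. \<exists>y\<in>B. s = x + y)"

lemma sums_to_interval:
  fixes a b c d s :: real
  assumes "a \<le> b" "c \<le> d"
  shows "sums_to s {a..b} {c..d} \<longleftrightarrow> a + c \<le> s \<and> s \<le> b + d"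
proof
  assume h: "a + c \<le> s \<and> s \<le> b + d"
  define x where "x = max a (s - d)"
  have "x \<in> {a..b}" "s - x \<in> {c..d}" using h assms by (auto simp: x_def)
  then show "sums_to s {a..b} {c..d}" unfolding sums_to_def by (intro bexI[of _ x] bexI[of _ "s - x"]) auto
qed (auto simp: sums_to_def)

text \<open>Without its gap, the first interval falls into two pieces. Their sums with the second
  interval still overlap or touch as long as the second interval is at least as long as the gap, so
  no sum is lost.\<close>

lemma nint_split:
  assumes I: "node_ok I" and gap: "ngap I \<le> nlen J" and s: "sums_to s (nint I) (nint J)"
  shows "sums_to s (nint (nch1 I)) (nint J) \<or> sums_to s (nint (nch2 I)) (nint J)"
proof -
  define a b c d where "a = nend1 I" and "b = ngap1 I" and "c = ngap2 I" and "d = nend2 I"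
  define l r where "l = min (nend1 J) (nend2 J)" and "r = max (nend1 J) (nend2 J)"
  have i: "1 \<le> real (snd I)" "real (snd I) \<le> 7" using I by (auto simp: node_ok_def)
  define z1 z2 z3 z4 where "z1 = 1 / (real (snd I) + hlam)" and "z2 = 1 / (real (snd I) + hmu)"
    and "z3 = 1 / (real (snd I) + 1 + hlam)" and "z4 = 1 / (8 + hmu)"
  have z: "0 \<le> z4" "z4 \<le> z3" "z3 \<le> z2" "z2 \<le> z1"
    using i hlam_bounds by (auto simp: z1_def z2_def z3_def z4_def hmu_def intro!: frac_le)
  have abcd: "a = ev (fst I) z1" "b = ev (fst I) z2" "c = ev (fst I) z3" "d = ev (fst I) z4"
    by (simp_all add: a_def b_def c_def d_def z1_def z2_def z3_def z4_def nend1_def nend2_def ngap1_def ngap2_def EV_def)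
  have mono: "(a \<le> b \<and> b \<le> c \<and> c \<le> d) \<or> (d \<le> c \<and> c \<le> b \<and> b \<le> a)"
    using ev_mono_or_antimono[OF node_ok_ge1[OF I]] z unfolding abcd
    by (meson order_trans)
  have lr: "l \<le> r" "nint J = {l..r}" "nlen J = r - l" by (auto simp: l_def r_def nint_def nlen_def)
  have n1: "nint (nch1 I) = {min a b..max a b}"
    by (rule nint_eq) (simp add: nends_nch1 a_def b_def insert_commute)
  have n2: "nint (nch2 I) = {min c d..max c d}"
    by (rule nint_eq) (simp add: nends_nch2[OF I] c_def d_def)
  have n0: "nint I = {min a d..max a d}" by (simp add: nint_def a_def d_def)
  have g: "\<bar>b - c\<bar> \<le> r - l" using gap lr by (simp add: ngap_def b_def c_def)
  show ?thesis
    using mono s g lr(1) unfolding n0 n1 n2 lr(2)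
    by (auto simp: sums_to_interval min_def max_def split: if_splits)
qed

lemma ngap_formula:
  assumes "node_ok I"
  defines "q' \<equiv> fst (dens (fst I))" and "q \<equiv> snd (dens (fst I))" and "i \<equiv> real (snd I)"
  shows "ngap I = (1 + hlam - hmu) / ((q * (i + hmu) + q') * (q * (i + 1 + hlam) + q'))"
proof -
  have i: "1 \<le> i" using assms by (auto simp: node_ok_def i_def)
  have "ngap I = \<bar>(i + hmu) - (i + 1 + hlam)\<bar> / ((q * (i + hmu) + q') * (q * (i + 1 + hlam) + q'))"
    unfolding ngap_def ngap1_def ngap2_def q'_def q_def i_def
    by (rule EV_diff[OF node_ok_ge1[OF assms(1)]]) (use i hlam_bounds in \<open>auto simp: i_def hmu_def\<close>)
  then show ?thesis using hlam_bounds by (simp add: hmu_def)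
qed

lemma node_bounds:
  assumes "node_ok I"
  shows "0 \<le> fst (dens (fst I))" "fst (dens (fst I)) \<le> snd (dens (fst I))" "1 \<le> snd (dens (fst I))"
    "1 \<le> real (snd I)" "real (snd I) \<le> 7" "real (length (fst I)) \<le> snd (dens (fst I))"
  using dens_bounds[OF node_ok_ge1[OF assms]] assms by (auto simp: node_ok_def)

lemma ngap_pos:
  assumes "node_ok I" shows "0 < ngap I"
  unfolding ngap_formula[OF assms]
  using node_bounds[OF assms] hlam_bounds
  by (intro divide_pos_pos mult_pos_pos add_pos_nonneg) (auto simp: hmu_def)

lemma ngap_le:
  assumes "node_ok I" shows "ngap I \<le> 1 / (1 + real (length (fst I)))"
proof -
  define q' q i where "q' = fst (dens (fst I))" and "q = snd (dens (fst I))" and "i = real (snd I)"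
  have b: "0 \<le> q'" "1 \<le> q" "1 \<le> i" "real (length (fst I)) \<le> q"
    using node_bounds[OF assms] by (auto simp: q'_def q_def i_def)
  have h: "0 < hlam" "0 < hmu" "1 + hlam - hmu \<le> 1" "hmu < 1 + hlam" using hlam_bounds by (auto simp: hmu_def)
  have "1 + real (length (fst I)) \<le> 1 * (q * 2)" using b by auto
  also have "\<dots> \<le> (q * (i + hmu) + q') * (q * (i + 1 + hlam) + q')"
  proof (intro mult_mono)
    have "1 * 1 \<le> q * (i + hmu)" using b h by (intro mult_mono) auto
    then show "1 \<le> q * (i + hmu) + q'" using b by linarith
    have "q * 2 \<le> q * (i + 1 + hlam)" using b h by (intro mult_left_mono) auto
    then show "q * 2 \<le> q * (i + 1 + hlam) + q'" using b by linarith
    show "0 \<le> q * (i + hmu) + q'" using b h by auto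
  qed (use b in auto)
  finally have "1 + real (length (fst I)) \<le> (q * (i + hmu) + q') * (q * (i + 1 + hlam) + q')" .
  then show ?thesis
    unfolding ngap_formula[OF assms] using h by (fold q'_def q_def i_def) (intro frac_le; auto)
qed

lemma ngap_mono:
  assumes I: "node_ok I"
  shows "ngap (nch1 I) \<le> ngap I" "ngap (nch2 I) \<le> ngap I"
proof -
  define q' q where "q' = fst (dens (fst I))" and "q = snd (dens (fst I))"
  have b: "0 \<le> q'" "q' \<le> q" "1 \<le> q" using node_bounds[OF I] by (auto simp: q'_def q_def)
  have h: "0 < hlam" "0 < hmu" "hmu < 1 + hlam" using hlam_bounds by (auto simp: hmu_def)
  define G where "G i = (1 + hlam - hmu) / ((q * (i + hmu) + q') * (q * (i + 1 + hlam) + q'))" for i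
  have G: "ngap I = G (real (snd I))" using ngap_formula[OF I] by (simp add: G_def q_def q'_def)
  have Gmono: "G j \<le> G i" if "1 \<le> i" "i \<le> j" for i j
    unfolding G_def using b h that by (intro divide_left_mono mult_mono add_mono mult_left_mono mult_pos_pos add_pos_nonneg add_nonneg_nonneg) auto
  \<comment> \<open>\<open>G a\<close> is the gap behind the digit a on the same level, and c is the
    denominator after a is appended. Since c >= q, both denominator factors of the longer word
    dominate those of \<open>G a\<close>. The digit 8 is covered too, for the second child of a node
    whose digit is 7.\<close>
  have ch: "ngap (fst I @ [a], 1) \<le> G (real a)" if a: "1 \<le> a" "a \<le> 8" for a
  proof -
    have ok: "node_ok (fst I @ [a], 1)" using I a by (auto simp: node_ok_def)
    define c where "c = q * real a + q'"
    have c: "q \<le> c"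
    proof -
      have "q * 1 \<le> q * real a" using b a by (intro mult_left_mono) auto
      then show ?thesis using b unfolding c_def by linarith
    qed
    have "ngap (fst I @ [a], 1) = (1 + hlam - hmu) / ((c * (1 + hmu) + q) * (c * (1 + 1 + hlam) + q))"
      using ngap_formula[OF ok] by (simp add: dens_snoc c_def q_def q'_def mult.commute)
    also have "\<dots> \<le> (1 + hlam - hmu) / ((c + q * hmu) * (c + q * (1 + hlam)))"
    proof (intro divide_left_mono mult_mono mult_pos_pos)
      have "q * hmu \<le> c * hmu" "q * hlam \<le> c * hlam" using c h by (auto intro: mult_right_mono)
      then show "c + q * hmu \<le> c * (1 + hmu) + q" "c + q * (1 + hlam) \<le> c * (1 + 1 + hlam) + q"
        using c b by (simp_all add: algebra_simps)
    qed (use b c h in \<open>auto intro!: add_nonneg_nonneg add_pos_pos mult_pos_pos\<close>)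
    also have "\<dots> = G (real a)" by (simp add: G_def c_def algebra_simps)
    finally show ?thesis .
  qed
  show "ngap (nch1 I) \<le> ngap I" using ch[of "snd I"] I G by (simp add: nch1_def node_ok_def)
  show "ngap (nch2 I) \<le> ngap I"
  proof (cases "snd I < 7")
    case True
    have ok: "node_ok (nch2 I)" using I by (rule node_ok_children)
    have "ngap (nch2 I) = G (real (snd I) + 1)"
      using ngap_formula[OF ok] True by (simp add: G_def q_def q'_def nch2_def add_ac)
    then show ?thesis using G Gmono[of "real (snd I)" "real (snd I) + 1"] I by (simp add: node_ok_def)
  next
    case False
    then have "snd I = 7" using I by (simp add: node_ok_def)
    then show ?thesis using G ch[of 8] Gmono[of 7 8] by (simp add: nch2_def)
  qed
qed

lemma divide_le_divide_cross:
  fixes a b x y z :: real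
  assumes "0 < x" "0 < y" "0 < z" "a * z \<le> b * y"
  shows "a / (x * y) \<le> b / (x * z)"
proof -
  have "a / y \<le> b / z" using assms by (simp add: field_simps)
  then have "a / y / x \<le> b / z / x" using assms(1) by (intro divide_right_mono) auto
  then show ?thesis by (simp add: mult.commute)
qed

text \<open>Hall's condition: the removed gap is no longer than either remaining piece. By
  \<open>EV_diff\<close> the gap and each piece share one denominator factor, which cancels. Digits
  up to 8 give \<open>hmu\<close> - \<open>hlam\<close> = 7 \<open>hlam\<close> > 3/4, so the
  numerator of the gap is below 1/4 and crude estimates are enough.\<close>

lemma ngap_le_nlen_children:
  assumes I: "node_ok I"
  shows "ngap I \<le> nlen (nch1 I)" "ngap I \<le> nlen (nch2 I)"
proof -
  define q' q i where "q' = fst (dens (fst I))" and "q = snd (dens (fst I))" and "i = real (snd I)"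
  have b: "0 \<le> q'" "q' \<le> q" "1 \<le> q" "1 \<le> i" "i \<le> 7" using node_bounds[OF I] by (auto simp: q'_def q_def i_def)
  have h: "0 < hlam" "0 < hmu" "hmu < 1 + hlam" "0.11 < hlam" "hlam < 0.12" "hmu = 8 * hlam" using hlam_bounds by (auto simp: hmu_def)
  define E where "E Z = q * Z + q'" for Z
  have E: "0 < E Z" if "0 < Z" for Z using b that by (auto simp: E_def intro!: add_pos_nonneg)
  have D: "\<bar>EV (fst I) Y - EV (fst I) Z\<bar> = \<bar>Y - Z\<bar> / (E Y * E Z)" if "0 < Y" "0 < Z" for Y Z
    using EV_diff[OF node_ok_ge1[OF I] that] by (simp add: E_def q_def q'_def)
  have g: "ngap I = (1 + hlam - hmu) / (E (i + hmu) * E (i + 1 + hlam))"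
    using ngap_formula[OF I] by (simp add: E_def q_def q'_def i_def)
  have Em: "E Y \<le> E Z" if "Y \<le> Z" for Y Z using b that by (auto simp: E_def intro: mult_left_mono)
  have pos: "0 < E (i + hmu)" "0 < E (i + 1 + hlam)" "0 < E (i + hlam)" "0 < E (8 + hmu)" using b h by (auto intro!: E)
  have l1: "nlen (nch1 I) = (hmu - hlam) / (E (i + hmu) * E (i + hlam))"
  proof -
    have "nlen (nch1 I) = \<bar>EV (fst I) (i + hmu) - EV (fst I) (i + hlam)\<bar>"
      unfolding nlen_def nends_nch1 by (simp add: nend1_def ngap1_def i_def)
    then show ?thesis using D[of "i + hmu" "i + hlam"] b h by simp
  qed
  have "(1 + hlam - hmu) * E (i + hlam) \<le> (hmu - hlam) * E (i + 1 + hlam)"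
    using h pos by (intro mult_mono Em) auto
  then show "ngap I \<le> nlen (nch1 I)"
    unfolding g l1 using pos by (intro divide_le_divide_cross)
  have l2: "nlen (nch2 I) = (7 - i + (hmu - hlam)) / (E (i + 1 + hlam) * E (8 + hmu))"
  proof -
    have "nlen (nch2 I) = \<bar>ngap2 I - nend2 I\<bar>" by (rule nint_eq(2)[OF nends_nch2[OF I]])
    also have "\<dots> = \<bar>(i + 1 + hlam) - (8 + hmu)\<bar> / (E (i + 1 + hlam) * E (8 + hmu))"
      unfolding ngap2_def nend2_def i_def by (rule D) (use h in auto)
    also have "\<bar>(i + 1 + hlam) - (8 + hmu)\<bar> = 7 - i + (hmu - hlam)" using b h by auto
    finally show ?thesis .
  qed
  define C where "C = E (i + hmu)"
  define j where "j = 7 - i"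
  define d where "d = hmu - hlam"
  have C: "3/2 * q \<le> C"
  proof -
    have "q * (3/2) \<le> q * (i + hmu)" using b h by (intro mult_left_mono) auto
    then show ?thesis using b unfolding C_def E_def by linarith
  qed
  have E8: "E (8 + hmu) = C + q * (j + 1)" by (simp add: E_def C_def j_def algebra_simps)
  \<comment> \<open>This is the claim for the second child after cross-multiplication. By d >= 3/4
    the first factor on the left is at most 1/4, and q <= 2 C / 3 bounds the second factor by a
    multiple of C.\<close>
  have "(1 - d) * (C + q * (j + 1)) \<le> (j + d) * C"
  proof -
    have d: "3/4 \<le> d" "d \<le> 1" using h by (auto simp: d_def)
    have j: "0 \<le> j" using b by (simp add: j_def)
    have "(1 - d) * (C + q * (j + 1)) \<le> (1/4) * (C + q * (j+1))"
      using d j b C by (intro mult_right_mono) (auto intro!: add_nonneg_nonneg)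
    also have "\<dots> \<le> (1/4) * (C + (2/3 * C) * (j + 1))"
      using C j by (intro mult_left_mono add_left_mono mult_right_mono) auto
    also have "\<dots> \<le> (j + 3/4) * C"
    proof -
      have "0 \<le> j * C" using j C b by simp
      moreover have "0 \<le> C" using C b by simp
      ultimately show ?thesis by (simp add: field_simps)
    qed
    also have "\<dots> \<le> (j + d) * C" using d C b by (intro mult_right_mono) auto
    finally show ?thesis .
  qed
  then have "(1 + hlam - hmu) * E (8 + hmu) \<le> (7 - i + (hmu - hlam)) * E (i + hmu)"
    by (simp add: E8 j_def d_def C_def diff_diff_eq2)
  then show "ngap I \<le> nlen (nch2 I)"
    unfolding g l2 using pos by (subst mult.commute, intro divide_le_divide_cross)
qed

text \<open>The two inequalities are symmetric, so either interval may be split. If I has the larger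
  gap, its children are at least as long as that gap, hence as the gap of J, and their own gaps do
  not exceed that of I, hence not the length of J.\<close>

definition valid_pair :: "real \<Rightarrow> node \<Rightarrow> node \<Rightarrow> bool" where
  "valid_pair s I J \<longleftrightarrow> node_ok I \<and> node_ok J \<and> ngap I \<le> nlen J \<and> ngap J \<le> nlen I \<and> sums_to s (nint I) (nint J)"

lemma valid_pair_sym: "valid_pair s I J \<longleftrightarrow> valid_pair s J I"
proof -
  have "sums_to s A B \<longleftrightarrow> sums_to s B A" for A B
    unfolding sums_to_def by (metis add.commute)
  then show ?thesis unfolding valid_pair_def by blast
qed

text \<open>Splitting the interval with the larger gap preserves all the conditions.\<close>

lemma valid_pair_split:
  assumes "valid_pair s I J" "ngap J \<le> ngap I"
  shows "valid_pair s (nch1 I) J \<or> valid_pair s (nch2 I) J"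
  using assms nint_split[of I J s] ngap_mono[of I] ngap_le_nlen_children[of I] node_ok_children[of I]
  unfolding valid_pair_def by fastforce

text \<open>A measure of progress for the refinement: a child either has a larger digit or a longer
  word, and a digit is always smaller than 8.\<close>

definition npos :: "node \<Rightarrow> nat" where "npos I = 8 * length (fst I) + snd I"

lemma npos_children: "node_ok I \<Longrightarrow> npos I < npos (nch1 I)" "node_ok I \<Longrightarrow> npos I < npos (nch2 I)"
  by (auto simp: npos_def nch1_def nch2_def node_ok_def)

lemma length_children: "length (fst I) \<le> length (fst (nch1 I))" "length (fst I) \<le> length (fst (nch2 I))"
  by (auto simp: nch1_def nch2_def)

text \<open>The splitting cannot stay on the side of J for ever. As long as the first word is w, the
  first gap is at least the positive minimum \<epsilon> over the seven nodes with word w. So J is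
  split only while its own gap exceeds \<epsilon>, and by \<open>ngap_le\<close> this bounds its
  word length and \<open>npos J\<close>.\<close>

lemma valid_pair_grow:
  assumes "valid_pair s (w, i) J"
  shows "\<exists>I' J'. valid_pair s I' J' \<and> length w < length (fst I') \<and> length (fst J) \<le> length (fst J')"
proof -
  have w: "set w \<subseteq> {1..8}" using assms by (simp add: valid_pair_def node_ok_def)
  define \<epsilon> where "\<epsilon> = Min ((\<lambda>i. ngap (w, i)) ` {1..7})"
  have \<epsilon>: "0 < \<epsilon>" unfolding \<epsilon>_def using w by (subst Min_gr_iff) (auto intro!: ngap_pos simp: node_ok_def)
  have \<epsilon>_le: "\<epsilon> \<le> ngap (w, i)" if "node_ok (w, i)" for i
    unfolding \<epsilon>_def using that by (intro Min_le) (auto simp: node_ok_def)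
  define M where "M = 8 * nat \<lceil>1/\<epsilon>\<rceil> + 8"
  have M: "npos J < M" if "node_ok J" "\<epsilon> \<le> ngap J" for J
  proof -
    have "\<epsilon> \<le> 1 / (1 + real (length (fst J)))" using that ngap_le[of J] by linarith
    then have "1 + real (length (fst J)) \<le> 1 / \<epsilon>" using \<epsilon> by (simp add: field_simps)
    then have "length (fst J) < nat \<lceil>1/\<epsilon>\<rceil>" by linarith
    then show ?thesis using that by (auto simp: npos_def M_def node_ok_def)
  qed
  show ?thesis using assms
  proof (induction "(8 - i) + (M - npos J)" arbitrary: i J rule: less_induct)
    case less
    have ok: "node_ok (w, i)" "node_ok J" using less.prems by (auto simp: valid_pair_def)
    show ?case
    proof (cases "ngap J \<le> ngap (w, i)")
      case True
      from valid_pair_split[OF less.prems True] obtain I' where I': "I' = nch1 (w,i) \<or> I' = nch2 (w,i)" "valid_pair s I' J"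
        by blast
      show ?thesis
      proof (cases "length w < length (fst I')")
        case True
        then show ?thesis using I' by blast
      next
        case False
        then have e: "I' = (w, Suc i)" "i < 7" using I' by (auto simp: nch1_def nch2_def split: if_splits)
        show ?thesis by (rule less.hyps[of "Suc i" J]) (use e I' in auto)
      qed
    next
      case False
      then have "ngap (w, i) \<le> ngap J" by simp
      from valid_pair_split[OF _ this] obtain J' where J': "J' = nch1 J \<or> J' = nch2 J" "valid_pair s J' (w, i)"
        using less.prems valid_pair_sym by blast
      have p: "npos J < npos J'" using J' npos_children ok by blast
      have "npos J < M" using M[OF ok(2)] \<epsilon>_le[OF ok(1)] False by simp
      then have "\<exists>I'' J''. valid_pair s I'' J'' \<and> length w < length (fst I'') \<and> length (fst J') \<le> length (fst J'')"
        using p J' valid_pair_sym by (intro less.hyps[of i J']) auto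
      then show ?thesis using length_children J' by (meson order_trans)
    qed
  qed
qed

lemma valid_pair_deep:
  assumes "valid_pair s I J"
  shows "\<exists>I' J'. valid_pair s I' J' \<and> n \<le> length (fst I') \<and> n \<le> length (fst J')"
proof (induction n)
  case 0
  then show ?case using assms by blast
next
  case (Suc n)
  then obtain I' J' where "valid_pair s I' J'" "n \<le> length (fst I')" "n \<le> length (fst J')" by blast
  moreover obtain I2 J2 where 2: "valid_pair s I2 J2" "length (fst I') < length (fst I2)" "length (fst J') \<le> length (fst J2)"
    using valid_pair_grow[of s "fst I'" "snd I'" J'] calculation(1) unfolding prod.collapse by blast
  moreover obtain I3 J3 where "valid_pair s J3 I3" "length (fst J2) < length (fst J3)" "length (fst I2) \<le> length (fst I3)"
    using valid_pair_grow[of s "fst J2" "snd J2" I2] 2(1) valid_pair_sym unfolding prod.collapse by blast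
  ultimately show ?case using valid_pair_sym[of s J3 I3]
    by (intro exI[of _ I3] exI[of _ J3]) linarith
qed

text \<open>Both ends of the interval continue the prefix of length n, so \<open>ev_contract\<close>
  applies to each of them, and x lies in between.\<close>

lemma nint_approx:
  assumes I: "node_ok I" and n: "n \<le> length (fst I)" "0 < n" and x: "x \<in> nint I" and z: "0 \<le> z" "z \<le> 1"
  shows "\<bar>ev (take n (fst I)) z - x\<bar> \<le> 1 / real n"
proof -
  define u v where "u = take n (fst I)" and "v = drop n (fst I)"
  have uv: "fst I = u @ v" by (simp add: u_def v_def)
  have ge: "\<forall>a\<in>set u. 1 \<le> a" "\<forall>a\<in>set v. 1 \<le> a" using node_ok_ge1[OF I] unfolding uv by auto
  have u: "u \<noteq> []" "length u = n" using n by (auto simp: u_def)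
  have E: "\<bar>ev u z - EV (fst I) Z\<bar> \<le> 1 / real n" if "1 \<le> Z" for Z
  proof -
    have "EV (fst I) Z = ev u (ev v (1/Z))" by (simp add: EV_def uv ev_append)
    then show ?thesis using ev_contract[OF ge(1), of z "ev v (1/Z)"] ev_bounds[OF ge(2), of "1/Z"] z u that by simp
  qed
  have "\<bar>ev u z - nend1 I\<bar> \<le> 1 / real n" "\<bar>ev u z - nend2 I\<bar> \<le> 1 / real n"
    unfolding nend1_def nend2_def using I hlam_bounds by (auto intro!: E simp: node_ok_def hmu_def)
  then show ?thesis using x by (auto simp: nint_def u_def)
qed

text \<open>A finite form of Hall's theorem: y and z stand for whatever follows the two words in an
  infinite expansion. The lengths differ by one so that, for even n, both u and the word v with one
  more digit in front have even length, as \<open>block_N\<close> demands.\<close>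

theorem hall_words:
  assumes s: "2 * hlam \<le> s" "s \<le> 2 * hmu" and "0 < n"
  shows "\<exists>u v. length u = n \<and> length v = Suc n \<and> set u \<subseteq> {1..8} \<and> set v \<subseteq> {1..8} \<and>
    (\<forall>y z. 0 \<le> y \<longrightarrow> y \<le> 1 \<longrightarrow> 0 \<le> z \<longrightarrow> z \<le> 1 \<longrightarrow> \<bar>ev u y + ev v z - s\<bar> \<le> 2 / real n)"
proof -
  define I where "I = ([] :: nat list, 1 :: nat)"
  have ok: "node_ok I" by (simp add: I_def node_ok_def)
  have e: "nend1 I = hmu" "nend2 I = hlam" using hmu_eq by (simp_all add: nend1_def nend2_def I_def EV_def)
  have lm: "hlam < hmu" using hlam_bounds by (simp add: hmu_def)
  have N: "nint I = {hlam..hmu}" "nlen I = hmu - hlam" using lm by (simp_all add: nint_def nlen_def e)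
  \<comment> \<open>This prepares the starting pair \<open>(I, I)\<close>: the gap of
    \<open>I\<close> is at most the length of its first child, hence at most that of
    \<open>I\<close>.\<close>
  have "nlen (nch1 I) \<le> nlen I"
  proof -
    have "ngap1 I = 1 / (1 + hmu)" by (simp add: ngap1_def I_def EV_def)
    moreover have "1 / (8 + hmu) \<le> 1 / (1 + hmu)" using hlam_bounds by (intro divide_left_mono) (auto simp: hmu_def)
    moreover note hmu_eq(2)
    moreover have "1 / (1 + hmu) \<le> hmu"
    proof -
      have "0 < hlam * hlam" using hlam_bounds by simp
      then have "1 \<le> hmu * (1 + hmu)" using hlam_eq by (simp add: hmu_def algebra_simps)
      then show ?thesis using hlam_bounds by (simp add: hmu_def divide_le_eq)
    qed
    ultimately show ?thesis by (simp add: nlen_def nends_nch1 e)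
  qed
  then have "ngap I \<le> nlen I" using ngap_le_nlen_children(1)[OF ok] by simp
  moreover have "sums_to s (nint I) (nint I)" using s lm by (simp add: N sums_to_interval)
  ultimately have "valid_pair s I I" using ok by (simp add: valid_pair_def)
  from valid_pair_deep[OF this, of "Suc n"] obtain I' J' where V: "valid_pair s I' J'"
    and l: "Suc n \<le> length (fst I')" "Suc n \<le> length (fst J')" by blast
  from V obtain x y where xy: "x \<in> nint I'" "y \<in> nint J'" "s = x + y" and ok': "node_ok I'" "node_ok J'"
    by (auto simp: valid_pair_def sums_to_def)
  let ?u = "take n (fst I')" and ?v = "take (Suc n) (fst J')"
  show ?thesis
  proof (rule exI[of _ ?u], rule exI[of _ ?v], intro conjI allI impI)
    show "set ?u \<subseteq> {1..8}" "set ?v \<subseteq> {1..8}"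
      using ok' set_take_subset unfolding node_ok_def by fast+
    fix y' z' :: real assume yz: "0 \<le> y'" "y' \<le> 1" "0 \<le> z'" "z' \<le> 1"
    have "\<bar>ev ?u y' - x\<bar> \<le> 1 / real n" by (rule nint_approx) (use ok' xy l yz \<open>0 < n\<close> in auto)
    moreover have "\<bar>ev ?v z' - y\<bar> \<le> 1 / real (Suc n)" by (rule nint_approx) (use ok' xy l yz in auto)
    moreover have "1 / real (Suc n) \<le> 1 / real n" using \<open>0 < n\<close> by (intro frac_le) auto
    ultimately show "\<bar>ev ?u y' + ev ?v z' - s\<bar> \<le> 2 / real n" using xy(3) by (simp add: abs_le_iff)
  qed (use l in auto)
qed

section \<open>Convergents\<close>

fun fev :: "(nat \<Rightarrow> nat) \<Rightarrow> nat \<Rightarrow> real" where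
  "fev a 0 = 0"
| "fev a (Suc n) = 1 / (real (a 0) + fev (\<lambda>i. a (Suc i)) n)"

lemma fev_eq_ev: "fev a n = ev (map a [0..<n]) 0"
proof (induction n arbitrary: a)
  case (Suc n)
  have "map a [0..<Suc n] = a 0 # map (\<lambda>i. a (Suc i)) [0..<n]"
    unfolding upt_conv_Cons[OF zero_less_Suc] list.map map_Suc_upt[symmetric] by (simp add: comp_def)
  with Suc show ?case by simp
qed simp

definition cffrac :: "(nat \<Rightarrow> nat) \<Rightarrow> real" where
  "cffrac a = lim (fev a)"

lemma fev_convergent:
  assumes "\<And>i. 1 \<le> a i"
  shows "fev a \<longlonglongrightarrow> cffrac a"
proof -
  have "Cauchy (fev a)"
  proof (rule CauchyI')
    fix e :: real assume "0 < e"
    then obtain M where M: "1 / real (Suc M) < e" using nat_approx_posE by blast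
    show "\<exists>M. \<forall>m\<ge>M. \<forall>n>m. dist (fev a m) (fev a n) < e"
    proof (intro exI[of _ "Suc M"] allI impI)
      fix m n assume mn: "Suc M \<le> m" "m < n"
      define v where "v = map a [m..<n]"
      have "map a [0..<n] = map a [0..<m] @ v"
        using mn upt_add_eq_append[of 0 m "n - m"] by (simp add: v_def)
      then have "fev a n = ev (map a [0..<m]) (ev v 0)" "fev a m = ev (map a [0..<m]) 0"
        by (simp_all add: fev_eq_ev ev_append)
      moreover have "\<bar>ev (map a [0..<m]) 0 - ev (map a [0..<m]) (ev v 0)\<bar> \<le> 1 / real (length (map a [0..<m]))"
        using assms mn ev_bounds[of v 0] by (intro ev_contract) (auto simp: v_def)
      moreover have "1 / real m \<le> 1 / real (Suc M)" using mn by (intro frac_le) auto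
      ultimately show "dist (fev a m) (fev a n) < e" using M by (simp add: dist_real_def)
    qed
  qed
  then show ?thesis by (simp add: cffrac_def Cauchy_convergent_iff convergent_LIMSEQ_iff)
qed

lemma cffrac_bounds:
  assumes "\<And>i. 1 \<le> a i"
  shows "0 \<le> cffrac a" "cffrac a \<le> 1"
proof -
  have b: "0 \<le> fev a n \<and> fev a n \<le> 1" for n
    unfolding fev_eq_ev using assms by (intro ev_bounds) auto
  note L = fev_convergent[of a, OF assms]
  show "0 \<le> cffrac a" using LIMSEQ_le_const[OF L, of 0] b by blast
  show "cffrac a \<le> 1" using LIMSEQ_le_const2[OF L, of 1] b by blast
qed

lemma cffrac_step:
  assumes "\<And>i. 1 \<le> a i"
  shows "cffrac a = 1 / (real (a 0) + cffrac (\<lambda>i. a (Suc i)))"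
proof -
  have "0 \<le> cffrac (\<lambda>i. a (Suc i))" using assms by (rule cffrac_bounds)
  then have "real (a 0) + cffrac (\<lambda>i. a (Suc i)) \<noteq> 0"
    using assms[of 0] by linarith
  then have "(\<lambda>n. fev a (Suc n)) \<longlonglongrightarrow> 1 / (real (a 0) + cffrac (\<lambda>i. a (Suc i)))"
    unfolding fev.simps by (intro tendsto_divide tendsto_add tendsto_const) (auto intro!: fev_convergent assms)
  then show ?thesis
    using fev_convergent[of a, OF assms, THEN LIMSEQ_Suc] by (metis LIMSEQ_unique)
qed

text \<open>The indices of \<open>cfp\<close> and \<open>cfq\<close> are shifted by two against the usual \<open>p\<^sub>n\<close>, \<open>q\<^sub>n\<close>, so that
  the fraction \<open>cfp a (Suc n) / cfq a (Suc n)\<close> is the one followed by the digit \<open>a n\<close>.\<close>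

fun cfp :: "(nat \<Rightarrow> nat) \<Rightarrow> nat \<Rightarrow> int" where
  "cfp a 0 = 0"
| "cfp a (Suc 0) = 1"
| "cfp a (Suc (Suc n)) = int (a n) * cfp a (Suc n) + cfp a n"

fun cfq :: "(nat \<Rightarrow> nat) \<Rightarrow> nat \<Rightarrow> int" where
  "cfq a 0 = 1"
| "cfq a (Suc 0) = 0"
| "cfq a (Suc (Suc n)) = int (a n) * cfq a (Suc n) + cfq a n"

declare cfp.simps(3) [simp del] cfq.simps(3) [simp del]

lemmas cf_rec = cfp.simps(3) cfq.simps(3)

locale cf_digits =
  fixes a :: "nat \<Rightarrow> nat"
  assumes digit_pos: "1 \<le> a i"
begin

definition tail :: "nat \<Rightarrow> real" where "tail n = cffrac (\<lambda>i. a (n + i))"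

definition \<alpha> :: real where "\<alpha> = real (a 0) + tail 1"

abbreviation "p \<equiv> cfp a"
abbreviation "q \<equiv> cfq a"

definition \<delta> :: "nat \<Rightarrow> real" where "\<delta> n = of_int (p n) - \<alpha> * of_int (q n)"

lemma tail_bounds: "0 < tail n" "tail n \<le> 1"
proof -
  have s: "tail n = 1 / (real (a n) + tail (Suc n))" for n
    unfolding tail_def using cffrac_step[of "\<lambda>i. a (n + i)"] digit_pos by simp
  have b: "0 \<le> tail n" "tail n \<le> 1" for n
    unfolding tail_def by (intro cffrac_bounds digit_pos)+
  show "tail n \<le> 1" by (rule b)
  show "0 < tail n" unfolding s[of n] using b(1)[of "Suc n"] digit_pos[of n]
    by (intro divide_pos_pos add_pos_nonneg) auto
qed

lemma tail_step: "tail n = 1 / (real (a n) + tail (Suc n))"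
  unfolding tail_def using cffrac_step[of "\<lambda>i. a (n + i)"] digit_pos by simp

lemma tail_step': "tail n * (real (a n) + tail (Suc n)) = 1"
  using tail_step[of n] tail_bounds[of "Suc n"] digit_pos[of n] by (simp add: add_pos_pos)

lemma tail_ev: "tail n = ev (map a [n..<n+m]) (tail (n + m))"
proof (induction m arbitrary: n)
  case (Suc m)
  have "map a [n..<n + Suc m] = a n # map a [Suc n..<Suc n + m]" 
    using upt_conv_Cons[of n "n + Suc m"] by (simp del: upt_Suc)
  then show ?case using Suc[of "Suc n"] tail_step[of n] by simp
qed simp

lemma q_nonneg: "0 \<le> q n"
  by (induction a n rule: cfq.induct) (auto simp: cf_rec)

lemma q_pos: "1 \<le> q (Suc (Suc n))"
proof (induction n)
  case (Suc n)
  have "1 * 1 \<le> int (a (Suc n)) * q (Suc (Suc n))" using Suc digit_pos by (intro mult_mono) auto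
  then show ?case using q_nonneg[of "Suc n"] by (simp add: cf_rec)
qed (simp add: cf_rec)

lemma q_Suc_le: "1 \<le> n \<Longrightarrow> q n \<le> q (Suc n)"
proof -
  assume "1 \<le> n"
  then obtain m where n: "n = Suc m" by (cases n) auto
  have "1 * q (Suc m) \<le> int (a m) * q (Suc m)" using digit_pos[of m] q_nonneg by (intro mult_right_mono) auto
  then show ?thesis using q_nonneg[of m] n by (simp add: cf_rec)
qed

lemma q_mono:
  assumes "1 \<le> n" "n \<le> m"
  shows "q n \<le> q m"
  using assms(2)
proof (induction m rule: dec_induct)
  case (step m)
  then show ?case using q_Suc_le[of m] assms(1) by simp
qed simp

lemma q_ge: "int n \<le> q (n + 3)"
proof (induction n)
  case 0
  then show ?case using q_nonneg by simp
next
  case (Suc n)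
  have "1 * q (Suc (n + 2)) \<le> int (a (n + 2)) * q (Suc (n + 2))"
    using digit_pos q_nonneg by (intro mult_right_mono) auto
  moreover have "q (Suc n + 3) = int (a (n + 2)) * q (Suc (n + 2)) + q (n + 2)"
    by (simp add: numeral_3_eq_3 cf_rec)
  ultimately show ?case using Suc q_pos[of n] by (simp add: numeral_3_eq_3)
qed

lemma det: "p (Suc n) * q n - p n * q (Suc n) = (-1) ^ n"
  by (induction n) (auto simp: algebra_simps cf_rec)

lemma coprime_pq: "coprime (p n) (q n)"
proof (rule coprimeI)
  fix d assume d: "d dvd p n" "d dvd q n"
  have "d dvd p (Suc n) * q n - p n * q (Suc n)" using d by (intro dvd_diff dvd_mult dvd_mult2)
  then have "d dvd (-1) ^ n" by (simp add: det)
  moreover have "((-1)::int) ^ n dvd 1" by (cases "even n") auto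
  ultimately show "d dvd 1" by (rule dvd_trans)
qed

text \<open>The matrix of two consecutive convergents maps the remaining tail to \<alpha>, which
  fixes the ratio of consecutive errors. The sign shows that \<alpha> lies between consecutive
  convergents.\<close>

lemma delta_step: "\<delta> (Suc (Suc n)) = - tail (Suc n) * \<delta> (Suc n)"
proof (induction n)
  case 0
  show ?case by (simp add: \<delta>_def \<alpha>_def cf_rec)
next
  case (Suc n)
  have rec: "\<delta> (Suc (Suc (Suc n))) = real (a (Suc n)) * \<delta> (Suc (Suc n)) + \<delta> (Suc n)"
    by (simp add: \<delta>_def algebra_simps cf_rec)
  define t t' where "t = tail (Suc n)" and "t' = tail (Suc (Suc n))"
  have t: "t * (real (a (Suc n)) + t') = 1" unfolding t_def t'_def by (rule tail_step')
  have "\<delta> (Suc n) = t * (real (a (Suc n)) + t') * \<delta> (Suc n)" by (simp add: t)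
  also have "\<dots> = - (real (a (Suc n)) + t') * \<delta> (Suc (Suc n))"
    unfolding Suc.IH t_def t'_def by (simp add: algebra_simps)
  finally show ?case unfolding rec t'_def[symmetric] by (simp add: algebra_simps)
qed

lemma delta_sign: "0 < (-1) ^ n * \<delta> (Suc n)"
proof (induction n)
  case 0
  show ?case by (simp add: \<delta>_def)
next
  case (Suc n)
  then have "0 < tail (Suc n) * ((-1) ^ n * \<delta> (Suc n))" by (rule mult_pos_pos[OF tail_bounds(1)])
  moreover have "(-1) ^ Suc n * \<delta> (Suc (Suc n)) = tail (Suc n) * ((-1) ^ n * \<delta> (Suc n))"
    unfolding delta_step by simp
  ultimately show ?case by simp
qed

lemma delta_nonzero: "\<delta> (Suc n) \<noteq> 0"
  using delta_sign[of n] by auto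

text \<open>By \<open>rho_step\<close> this is the continued fraction of the earlier digits read
  backwards, \<open>[0; a (n - 1), ..., a 1]\<close>; it is the reason why one word enters the
  digits reversed. The step fails at 0 because \<open>q (Suc 0)\<close> is 0.\<close>

definition rho :: "nat \<Rightarrow> real" where "rho n = of_int (q n) / of_int (q (Suc n))"

lemma rho_step: "1 \<le> n \<Longrightarrow> rho (Suc n) = 1 / (real (a n) + rho n)"
proof -
  assume "1 \<le> n"
  then obtain m where n: "n = Suc m" by (cases n) auto
  have "0 < q (Suc n)" using q_pos[of m] n by simp
  have "rho (Suc n) = of_int (q (Suc n)) / (real (a n) * of_int (q (Suc n)) + of_int (q n))"
    by (simp add: rho_def cf_rec)
  also have "\<dots> = 1 / (real (a n) + rho n)"
    unfolding rho_def using \<open>0 < q (Suc n)\<close> by (simp add: field_simps)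
  finally show ?thesis .
qed

lemma rho_bounds: "1 \<le> n \<Longrightarrow> 0 \<le> rho n" "1 \<le> n \<Longrightarrow> rho n \<le> 1"
proof -
  show "0 \<le> rho n" unfolding rho_def using q_nonneg by simp
  assume "1 \<le> n"
  then obtain m where n: "n = Suc m" by (cases n) auto
  show "rho n \<le> 1" using q_Suc_le[of n] q_pos[of m] n unfolding rho_def by simp
qed

lemma rho_ev: "1 \<le> n \<Longrightarrow> rho (n + m) = ev (rev (map a [n..<n + m])) (rho n)"
  by (induction m) (auto simp: rho_step)

text \<open>Perron's formula. It is the determinant identity \<open>det\<close> written in terms of
  the errors, with the later error eliminated by \<open>delta_step\<close> and the later denominator
  by its recursion.\<close>

lemma q_delta: "1 \<le> n \<Longrightarrow> of_int (q (Suc n)) * \<bar>\<delta> (Suc n)\<bar> = 1 / (real (a n) + tail (Suc n) + rho n)"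
proof -
  assume "1 \<le> n"
  then obtain m where n: "n = Suc m" by (cases n) auto
  have q: "0 < q (Suc n)" using q_pos[of m] n by simp
  define D where "D = \<bar>\<delta> (Suc n)\<bar>"
  have D': "\<bar>\<delta> (Suc (Suc n))\<bar> = tail (Suc n) * D"
    unfolding delta_step D_def using tail_bounds(1)[of "Suc n"] by (simp add: abs_mult)
  have "(-1) ^ Suc n = of_int (p (Suc (Suc n))) * real_of_int (q (Suc n)) - of_int (p (Suc n)) * of_int (q (Suc (Suc n)))"
    using det[of "Suc n"] by (metis of_int_1 of_int_diff of_int_minus of_int_mult of_int_power)
  also have "\<dots> = \<delta> (Suc (Suc n)) * of_int (q (Suc n)) - \<delta> (Suc n) * of_int (q (Suc (Suc n)))"
    by (simp add: \<delta>_def algebra_simps)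
  also have "\<dots> = - \<delta> (Suc n) * (tail (Suc n) * of_int (q (Suc n)) + of_int (q (Suc (Suc n))))"
    unfolding delta_step by (simp add: algebra_simps)
  finally have "\<bar>(-1) ^ Suc n\<bar> = D * \<bar>tail (Suc n) * of_int (q (Suc n)) + of_int (q (Suc (Suc n)))\<bar>"
    by (simp add: abs_mult D_def)
  then have 1: "1 = D * (tail (Suc n) * of_int (q (Suc n)) + of_int (q (Suc (Suc n))))"
    using tail_bounds(1)[of "Suc n"] q q_nonneg[of "Suc (Suc n)"] by (simp add: power_abs)
  have "tail (Suc n) * of_int (q (Suc n)) + of_int (q (Suc (Suc n))) = of_int (q (Suc n)) * (real (a n) + tail (Suc n) + rho n)"
    using q by (simp add: rho_def field_simps cf_rec)
  with 1 have "of_int (q (Suc n)) * D * (real (a n) + tail (Suc n) + rho n) = 1" by (simp add: algebra_simps)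
  moreover have "0 < real (a n) + tail (Suc n) + rho n"
    using tail_bounds(1)[of "Suc n"] rho_bounds(1)[OF \<open>1 \<le> n\<close>] by simp
  ultimately show ?thesis by (simp add: D_def field_simps)
qed

lemma delta_le: "of_int (q (Suc (Suc n))) * \<bar>\<delta> (Suc n)\<bar> \<le> 1"
proof (cases "n = 0")
  case True
  then show ?thesis by (simp add: \<delta>_def cf_rec)
next
  case False
  then have n: "1 \<le> n" by simp
  have q: "0 < q (Suc n)" using q_pos[of "n - 1"] n by simp
  define r t where "r = rho n" and "t = tail (Suc n)"
  have rt: "0 \<le> r" "0 < t" "1 \<le> real (a n)"
    using rho_bounds(1)[OF n] tail_bounds(1)[of "Suc n"] digit_pos[of n] by (auto simp: r_def t_def)
  have "of_int (q (Suc (Suc n))) = of_int (q (Suc n)) * (real (a n) + r)"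
    using q unfolding r_def rho_def cf_rec by (simp add: distrib_left mult.commute)
  then have "of_int (q (Suc (Suc n))) * \<bar>\<delta> (Suc n)\<bar> = (of_int (q (Suc n)) * \<bar>\<delta> (Suc n)\<bar>) * (real (a n) + r)"
    by (simp only: mult_ac)
  also have "of_int (q (Suc n)) * \<bar>\<delta> (Suc n)\<bar> = 1 / (real (a n) + t + r)"
    unfolding r_def t_def by (rule q_delta[OF n])
  also have "1 / (real (a n) + t + r) * (real (a n) + r) \<le> 1"
    using rt by (simp add: divide_le_eq)
  finally show ?thesis .
qed

text \<open>For \<alpha> = u / v the numbers \<open>of_int v * \<delta> (Suc n)\<close> would be
  nonzero integers, but by \<open>delta_le\<close> their absolute value drops below 1 once the next
  denominator exceeds v.\<close>

lemma alpha_irrational: "\<alpha> \<notin> \<rat>"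
proof
  assume "\<alpha> \<in> \<rat>"
  then obtain u v :: int where uv: "v > 0" "\<alpha> = of_int u / of_int v"
    by (rule Rats_cases') blast
  define n where "n = nat v + 2"
  have "of_int v * \<delta> (Suc n) = of_int (v * p (Suc n) - u * q (Suc n))"
    using uv by (simp add: \<delta>_def field_simps)
  moreover have "of_int v * \<delta> (Suc n) \<noteq> 0" using delta_nonzero uv by simp
  ultimately have "1 \<le> \<bar>of_int v * \<delta> (Suc n)\<bar>"
  proof -
    define N where "N = v * p (Suc n) - u * q (Suc n)"
    assume h: "of_int v * \<delta> (Suc n) = of_int (v * p (Suc n) - u * q (Suc n))" "of_int v * \<delta> (Suc n) \<noteq> 0"
    have e: "of_int v * \<delta> (Suc n) = of_int N" unfolding N_def by (rule h)
    with h(2) have "N \<noteq> 0" by (metis of_int_0)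
    then show ?thesis unfolding e by linarith
  qed
  then have "1 \<le> of_int v * \<bar>\<delta> (Suc n)\<bar>" using uv by (simp add: abs_mult)
  moreover have "of_int v * \<bar>\<delta> (Suc n)\<bar> < of_int (q (Suc (Suc n))) * \<bar>\<delta> (Suc n)\<bar>"
  proof (rule mult_strict_right_mono)
    have "int (nat v + 1) \<le> q (nat v + 1 + 3)" by (rule q_ge)
    moreover have "nat v + 1 + 3 = Suc (Suc n)" by (simp add: n_def)
    ultimately have "int (nat v + 1) \<le> q (Suc (Suc n))" by metis
    then have "v < q (Suc (Suc n))" using uv by linarith
    then show "real_of_int v < of_int (q (Suc (Suc n)))" by linarith
    show "0 < \<bar>\<delta> (Suc n)\<bar>" using delta_nonzero by simp
  qed
  ultimately show False using delta_le[of n] by simp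
qed

text \<open>Two consecutive convergents form a basis of the lattice; A and B are the coordinates of
  (x, y). As y lies strictly between 0 and the larger denominator and B is nonzero, A and B have
  opposite signs. The two errors have opposite signs as well, so the contributions add up instead of
  cancelling.\<close>

lemma best_approximation:
  assumes "q (Suc n) \<le> y" "y < q (Suc (Suc n))" "0 < y"
    and "\<not> (\<exists>g. (x, y) = (g * p (Suc n), g * q (Suc n)))"
  shows "\<bar>\<delta> (Suc n)\<bar> \<le> \<bar>of_int x - \<alpha> * of_int y\<bar>"
proof -
  define s :: int where "s = (-1) ^ Suc n"
  have s: "s * s = 1" by (simp add: s_def flip: power_mult_distrib)
  define A B where "A = s * (p (Suc (Suc n)) * y - q (Suc (Suc n)) * x)" and "B = s * (q (Suc n) * x - p (Suc n) * y)"
  have d: "p (Suc (Suc n)) * q (Suc n) - p (Suc n) * q (Suc (Suc n)) = s"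
    using det[of "Suc n"] by (simp add: s_def)
  have y: "y = A * q (Suc n) + B * q (Suc (Suc n))"
  proof -
    have "A * q (Suc n) + B * q (Suc (Suc n)) = s * (p (Suc (Suc n)) * q (Suc n) - p (Suc n) * q (Suc (Suc n))) * y"
      unfolding A_def B_def by (simp add: algebra_simps)
    then show ?thesis unfolding d by (simp add: s)
  qed
  have x: "x = A * p (Suc n) + B * p (Suc (Suc n))"
  proof -
    have "A * p (Suc n) + B * p (Suc (Suc n)) = s * (p (Suc (Suc n)) * q (Suc n) - p (Suc n) * q (Suc (Suc n))) * x"
      unfolding A_def B_def by (simp add: algebra_simps)
    then show ?thesis unfolding d by (simp add: s)
  qed
  have B: "B \<noteq> 0"
  proof
    assume "B = 0"
    then have "(x, y) = (A * p (Suc n), A * q (Suc n))" using x y by simp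
    with assms(4) show False by blast
  qed
  have qn: "0 \<le> q (Suc n)" "0 < q (Suc (Suc n))" using q_nonneg[of "Suc n"] q_pos[of n] by linarith+
  have AB: "A \<noteq> 0 \<and> (B > 0 \<longrightarrow> A < 0) \<and> (B < 0 \<longrightarrow> A > 0)"
  proof (intro conjI impI)
    have pos: "A < 0" if "B > 0"
    proof (rule ccontr)
      assume "\<not> A < 0"
      then have "0 \<le> A * q (Suc n)" "1 * q (Suc (Suc n)) \<le> B * q (Suc (Suc n))"
        using qn that by (auto intro!: mult_right_mono)
      then show False using y assms(2) by linarith
    qed
    have neg: "A > 0" if "B < 0"
    proof (rule ccontr)
      assume "\<not> A > 0"
      then have "A * q (Suc n) \<le> 0" "B * q (Suc (Suc n)) \<le> 0"
        using qn that by (auto intro!: mult_nonpos_nonneg)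
      then show False using y assms(3) by linarith
    qed
    show "A < 0" if "B > 0" by (rule pos[OF that])
    show "A > 0" if "B < 0" by (rule neg[OF that])
    show "A \<noteq> 0" using pos neg B by (cases "B > 0") auto
  qed
  have e: "of_int x - \<alpha> * of_int y = of_int A * \<delta> (Suc n) + of_int B * \<delta> (Suc (Suc n))"
  proof -
    have "real_of_int x = of_int A * of_int (p (Suc n)) + of_int B * of_int (p (Suc (Suc n)))"
      "real_of_int y = of_int A * of_int (q (Suc n)) + of_int B * of_int (q (Suc (Suc n)))"
      using arg_cong[OF x, of real_of_int] arg_cong[OF y, of real_of_int] by simp_all
    then show ?thesis unfolding \<delta>_def by (simp only: algebra_simps)
  qed
  also have "\<dots> = (of_int A - of_int B * tail (Suc n)) * \<delta> (Suc n)"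
    by (simp add: delta_step algebra_simps)
  finally have "\<bar>of_int x - \<alpha> * of_int y\<bar> = \<bar>of_int A - of_int B * tail (Suc n)\<bar> * \<bar>\<delta> (Suc n)\<bar>"
    by (simp add: abs_mult)
  moreover have "1 \<le> \<bar>of_int A - of_int B * tail (Suc n)\<bar>"
  proof (cases "B > 0")
    case True
    then have "of_int A \<le> (-1::real)" "0 \<le> of_int B * tail (Suc n)"
      using AB tail_bounds(1)[of "Suc n"] by (auto simp: less_eq_real_def)
    then show ?thesis by linarith
  next
    case False
    then have "B < 0" using B by simp
    then have "1 \<le> (of_int A :: real)" "of_int B * tail (Suc n) \<le> 0"
      using AB tail_bounds(1)[of "Suc n"] by (auto intro: mult_nonpos_nonneg less_imp_le)
    then show ?thesis by linarith
  qed
  ultimately show ?thesis using mult_right_mono[of 1 _ "\<bar>\<delta> (Suc n)\<bar>"] by simp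
qed

lemma exists_denominator_index:
  assumes "1 \<le> y"
  shows "\<exists>n. q (Suc n) \<le> y \<and> y < q (Suc (Suc n))"
proof -
  define P where "P m \<longleftrightarrow> y < q (Suc m)" for m
  have "P (nat y + 3)"
    using q_ge[of "Suc (nat y)"] assms by (simp add: P_def numeral_3_eq_3)
  moreover have "\<not> P 0" using assms by (simp add: P_def)
  ultimately obtain m where "\<not> P m" "P (Suc m)"
    using nat_induct[of "\<lambda>m. \<not> P m"] by blast
  then show ?thesis unfolding P_def by (meson linorder_not_less)
qed

text \<open>Legendre's criterion for vectors that may be imprimitive. With n chosen by the size of
  y, a vector off the line of the convergent would have x q - p y as a nonzero integer, yet
  \<open>best_approximation\<close> bounds it by twice the product in the hypothesis. On that line
  coprimality yields the integer factor g.\<close>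

lemma legendre:
  assumes "1 \<le> y" "of_int y * \<bar>of_int x - \<alpha> * of_int y\<bar> < 1 / 2"
  shows "\<exists>n g. 1 \<le> n \<and> 1 \<le> g \<and> x = g * p (Suc n) \<and> y = g * q (Suc n)"
proof -
  obtain n where n: "q (Suc n) \<le> y" "y < q (Suc (Suc n))"
    using exists_denominator_index[OF assms(1)] by blast
  have n1: "1 \<le> n"
  proof (rule ccontr)
    assume "\<not> 1 \<le> n"
    then have "n = 0" by simp
    then show False using n assms(1) by (simp add: cf_rec)
  qed
  then have q1: "1 \<le> q (Suc n)" using q_pos[of "n - 1"] by simp
  show ?thesis
  proof (cases "\<exists>g. (x, y) = (g * p (Suc n), g * q (Suc n))")
    case True
    then obtain g where g: "x = g * p (Suc n)" "y = g * q (Suc n)" by auto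
    have "1 \<le> g"
    proof (rule ccontr)
      assume "\<not> 1 \<le> g"
      then have "g * q (Suc n) \<le> 0" using q1 by (intro mult_nonpos_nonneg) auto
      then show False using g(2) assms(1) by simp
    qed
    then show ?thesis using g n1 by blast
  next
    case False
    define d where "d = \<bar>of_int x - \<alpha> * of_int y\<bar>"
    have d: "\<bar>\<delta> (Suc n)\<bar> \<le> d" unfolding d_def by (rule best_approximation) (use n assms False in auto)
    have yd: "of_int y * d < 1/2" using assms(2) by (simp add: d_def)
    show ?thesis
    proof (cases "x * q (Suc n) = p (Suc n) * y")
      case True
      have "q (Suc n) dvd y"
        using coprime_dvd_mult_right_iff[of "q (Suc n)" "p (Suc n)" y] coprime_pq[of "Suc n"] dvd_triv_right[of "q (Suc n)" x]
        unfolding True by (simp add: coprime_commute)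
      then obtain g where g: "y = g * q (Suc n)" by (auto simp: dvd_def mult.commute)
      then have "(x - g * p (Suc n)) * q (Suc n) = 0" using True by (simp add: algebra_simps)
      then have "x = g * p (Suc n)" using q1 by simp
      with g \<open>\<not> (\<exists>g. (x, y) = (g * p (Suc n), g * q (Suc n)))\<close> show ?thesis by blast
    next
      case False
      then have "1 \<le> \<bar>x * q (Suc n) - p (Suc n) * y\<bar>" by linarith
      then have "1 \<le> \<bar>of_int (x * q (Suc n) - p (Suc n) * y) :: real\<bar>" by linarith
      also have "of_int (x * q (Suc n) - p (Suc n) * y) = (of_int x - \<alpha> * of_int y) * of_int (q (Suc n)) - \<delta> (Suc n) * of_int y"
        by (simp add: \<delta>_def algebra_simps)
      also have "\<bar>\<dots>\<bar> \<le> d * of_int (q (Suc n)) + \<bar>\<delta> (Suc n)\<bar> * of_int y"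
        using q1 assms(1) abs_triangle_ineq4[of "(of_int x - \<alpha> * of_int y) * of_int (q (Suc n))" "\<delta> (Suc n) * of_int y"]
        by (simp add: abs_mult d_def)
      also have "\<dots> \<le> d * of_int y + d * of_int y"
        using n(1) d assms(1) by (intro add_mono mult_left_mono mult_right_mono) (auto simp: d_def)
      finally show ?thesis using yd by (simp add: mult.commute)
    qed
  qed
qed

end

section \<open>Words in the parabolic generators\<close>

type_synonym lin = "int \<times> int \<Rightarrow> int \<times> int"

definition lmat :: "int \<Rightarrow> int \<Rightarrow> int \<Rightarrow> int \<Rightarrow> lin" where
  "lmat a b c d = (\<lambda>(x, y). (a * x + b * y, c * x + d * y))"

definition SL2Z :: "lin set" where
  "SL2Z = {lmat a b c d | a b c d. a * d - b * c = 1}"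

lemma lmat_comp: "lmat a b c d \<circ> lmat a' b' c' d' = lmat (a * a' + b * c') (a * b' + b * d') (c * a' + d * c') (c * b' + d * d')"
  by (auto simp: lmat_def fun_eq_iff algebra_simps)

lemma lmat_id: "lmat 1 0 0 1 = id"
  by (auto simp: lmat_def)

lemma lmat_SL2Z: "a * d - b * c = 1 \<Longrightarrow> lmat a b c d \<in> SL2Z"
  unfolding SL2Z_def by blast

lemma SL2Z_comp: "f \<in> SL2Z \<Longrightarrow> g \<in> SL2Z \<Longrightarrow> f \<circ> g \<in> SL2Z"
proof -
  assume "f \<in> SL2Z" "g \<in> SL2Z"
  then obtain a b c d a' b' c' d' where f: "f = lmat a b c d" "a * d - b * c = 1" and g: "g = lmat a' b' c' d'" "a' * d' - b' * c' = 1"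
    by (auto simp: SL2Z_def)
  have "(a * a' + b * c') * (c * b' + d * d') - (a * b' + b * d') * (c * a' + d * c') = (a * d - b * c) * (a' * d' - b' * c')"
    by (simp add: algebra_simps)
  then show ?thesis unfolding SL2Z_def f g lmat_comp using f(2) g(2) by fastforce
qed

definition lett :: "bool \<times> nat \<Rightarrow> lin" where
  "lett l = (if fst l then lmat 1 (int (snd l)) 0 1 else lmat 1 0 (int (snd l)) 1)"

definition prodl :: "(bool \<times> nat) list \<Rightarrow> lin" where
  "prodl w = foldr (\<lambda>l f. lett l \<circ> f) w id"

lemma prodl_simps [simp]: "prodl [] = id" "prodl (l # w) = lett l \<circ> prodl w"
  by (simp_all add: prodl_def)

lemma prodl_append: "prodl (u @ v) = prodl u \<circ> prodl v"
  by (induction u) (auto simp: o_assoc)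

lemma lett_SL2Z: "lett l \<in> SL2Z"
  by (simp add: lett_def lmat_SL2Z)

lemma prodl_SL2Z: "prodl w \<in> SL2Z"
proof (induction w)
  case Nil
  have "lmat 1 0 0 1 \<in> SL2Z" by (rule lmat_SL2Z) simp
  then show ?case by (simp only: lmat_id prodl_simps)
next
  case (Cons l w)
  then show ?case by (simp only: prodl_simps SL2Z_comp lett_SL2Z)
qed

text \<open>The digits of a continued fraction become exponents of the upper and lower unipotent
  generators in alternation.\<close>

fun lab :: "bool \<Rightarrow> nat list \<Rightarrow> (bool \<times> nat) list" where
  "lab b [] = []"
| "lab b (a # w) = (b, a) # lab (\<not> b) w"

lemma lab_append: "lab b (u @ v) = lab b u @ lab (if even (length u) then b else \<not> b) v"
  by (induction u arbitrary: b) auto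

lemma lab_rev: "lab b (rev w) = rev (lab (if even (length w) then \<not> b else b) w)"
  by (induction w arbitrary: b) (auto simp: lab_append)

lemma lab_map: "lab b (map f w) = map (\<lambda>(b, a). (b, f a)) (lab b w)"
  by (induction w arbitrary: b) auto

text \<open>The columns of the product are the last two convergents. The letter of
  \<open>a n\<close> adds \<open>a n\<close> times the newer column to the older one, which is their
  recursion. Because the letters alternate, the newer column is the first one for even n and the
  second one for odd n.\<close>

lemma prodl_lab_cf:
  "prodl (lab True (map a [0..<n])) (if even n then (1, 0) else (0, 1)) = (cfp a (Suc n), cfq a (Suc n)) \<and>
   prodl (lab True (map a [0..<n])) (if even n then (0, 1) else (1, 0)) = (cfp a n, cfq a n)"
proof (induction n)
  case (Suc n)
  define f where "f = prodl (lab True (map a [0..<n]))"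
  obtain \<alpha> \<beta> \<gamma> \<epsilon> where f: "f = lmat \<alpha> \<beta> \<gamma> \<epsilon>" using prodl_SL2Z unfolding f_def SL2Z_def by blast
  have "lab True (map a [0..<Suc n]) = lab True (map a [0..<n]) @ [(even n, a n)]"
    by (simp add: lab_append)
  then have e: "prodl (lab True (map a [0..<Suc n])) = f \<circ> lett (even n, a n)"
    by (simp only: prodl_append f_def) simp
  show ?case
    unfolding e using Suc.IH[folded f_def]
    by (cases "even n") (auto simp: f lett_def lmat_def cf_rec algebra_simps)
qed (auto)

text \<open>The maps in \<open>twist\<close> are the conjugates in SL(2,Z) of the powers with
  exponent k l of the upper unipotent generator: the primitive vector (a, b) is the first column of
  the conjugating matrix, and a y - b x is its determinant with (x, y).\<close>

locale twist_invariant =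
  fixes H :: "(int \<times> int) set" and k :: nat
  assumes k_pos: "0 < k"
    and twist: "\<And>a b x y l. coprime a b \<Longrightarrow> (x, y) \<in> H \<Longrightarrow>
      (x + l * int k * (a * y - b * x) * a, y + l * int k * (a * y - b * x) * b) \<in> H"
    and uminus_H: "\<And>x y. (x, y) \<in> H \<Longrightarrow> (- x, - y) \<in> H"
    and zero_H: "(0, 0) \<notin> H"
begin

lemma twist_iff:
  assumes "coprime a b"
  shows "(x + l * int k * (a * y - b * x) * a, y + l * int k * (a * y - b * x) * b) \<in> H \<longleftrightarrow> (x, y) \<in> H"
proof
  define x' y' where "x' = x + l * int k * (a * y - b * x) * a" and "y' = y + l * int k * (a * y - b * x) * b"
  assume "(x + l * int k * (a * y - b * x) * a, y + l * int k * (a * y - b * x) * b) \<in> H"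
  then have "(x' + (- l) * int k * (a * y' - b * x') * a, y' + (- l) * int k * (a * y' - b * x') * b) \<in> H"
    by (intro twist assms) (simp add: x'_def y'_def)
  moreover have "a * y' - b * x' = a * y - b * x" by (simp add: x'_def y'_def algebra_simps)
  ultimately show "(x, y) \<in> H" by (simp add: x'_def y'_def)
qed (rule twist[OF assms])

text \<open>The largest normal subgroup of \<open>SL(2,\<int>)\<close> preserving \<open>H\<close>.\<close>

definition N :: "lin set" where
  "N = {f \<in> SL2Z. \<forall>a b c d v. a * d - b * c = 1 \<longrightarrow> (lmat a b c d (f (lmat d (-b) (-c) a v)) \<in> H \<longleftrightarrow> v \<in> H)}"

lemma inv_lmat:
  assumes "a * d - b * c = (1::int)"
  shows "lmat d (-b) (-c) a (lmat a b c d v) = v" "lmat a b c d (lmat d (-b) (-c) a v) = v"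
proof -
  obtain x y where v: "v = (x, y)" by force
  have "d * (a * x + b * y) - b * (c * x + d * y) = (a * d - b * c) * x"
    "- c * (a * x + b * y) + a * (c * x + d * y) = (a * d - b * c) * y"
    "a * (d * x - b * y) + b * (- c * x + a * y) = (a * d - b * c) * x"
    "c * (d * x - b * y) + d * (- c * x + a * y) = (a * d - b * c) * y"
    by (simp_all add: algebra_simps)
  then show "lmat d (-b) (-c) a (lmat a b c d v) = v" "lmat a b c d (lmat d (-b) (-c) a v) = v"
    using assms by (simp_all add: lmat_def v)
qed

lemma N_preserves: "f \<in> N \<Longrightarrow> f v \<in> H \<longleftrightarrow> v \<in> H"
proof -
  assume "f \<in> N"
  then have "1 * 1 - 0 * 0 = (1::int) \<longrightarrow> (lmat 1 0 0 1 (f (lmat 1 (-0) (-0) 1 v)) \<in> H \<longleftrightarrow> v \<in> H)"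
    unfolding N_def by blast
  then show ?thesis by (simp add: lmat_id)
qed

lemma N_comp: "f \<in> N \<Longrightarrow> g \<in> N \<Longrightarrow> f \<circ> g \<in> N"
proof -
  assume f: "f \<in> N" and g: "g \<in> N"
  have "lmat a b c d ((f \<circ> g) (lmat d (-b) (-c) a v)) \<in> H \<longleftrightarrow> v \<in> H" if D: "a * d - b * c = 1" for a b c d v
  proof -
    define w where "w = lmat a b c d (g (lmat d (-b) (-c) a v))"
    have "lmat a b c d ((f \<circ> g) (lmat d (-b) (-c) a v)) = lmat a b c d (f (lmat d (-b) (-c) a w))"
      unfolding w_def inv_lmat(1)[OF D] by simp
    also have "\<dots> \<in> H \<longleftrightarrow> w \<in> H" using f D unfolding N_def by blast
    also have "\<dots> \<longleftrightarrow> v \<in> H" using g D unfolding N_def w_def by blast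
    finally show ?thesis .
  qed
  then show ?thesis using f g SL2Z_comp unfolding N_def by blast
qed

lemma N_id: "id \<in> N"
  unfolding N_def using inv_lmat(2) prodl_SL2Z[of "[]"] by simp

text \<open>Normality in the form in which it is used: an element of \<open>N\<close> may be
  inserted anywhere into a product, since u f x = (u f u^-1) (u x).\<close>

lemma N_insert:
  assumes f: "f \<in> N" and u: "u \<in> SL2Z" and ux: "u \<circ> x \<in> N"
  shows "u \<circ> (f \<circ> x) \<in> N"
proof -
  obtain a b c d where u: "u = lmat a b c d" and D: "a * d - b * c = 1" using u unfolding SL2Z_def by blast
  define u' where "u' = lmat d (-b) (-c) a"
  have u'u: "u' \<circ> u = id" and uu': "u \<circ> u' = id" unfolding u'_def u using inv_lmat[OF D] by auto
  have u'S: "u' \<in> SL2Z" unfolding u'_def using D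
    by (intro lmat_SL2Z) (simp add: algebra_simps)
  have "u \<circ> f \<circ> u' \<in> N"
  proof -
    have "lmat \<alpha> \<beta> \<gamma> \<epsilon> ((u \<circ> f \<circ> u') (lmat \<epsilon> (-\<beta>) (-\<gamma>) \<alpha> v)) \<in> H \<longleftrightarrow> v \<in> H" if D': "\<alpha> * \<epsilon> - \<beta> * \<gamma> = 1" for \<alpha> \<beta> \<gamma> \<epsilon> v
    proof -
      define a' b' c' d' where "a' = \<alpha> * a + \<beta> * c" and "b' = \<alpha> * b + \<beta> * d" and "c' = \<gamma> * a + \<epsilon> * c" and "d' = \<gamma> * b + \<epsilon> * d"
      have 1: "lmat \<alpha> \<beta> \<gamma> \<epsilon> \<circ> u = lmat a' b' c' d'" unfolding u lmat_comp a'_def b'_def c'_def d'_def ..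
      have 2: "u' \<circ> lmat \<epsilon> (-\<beta>) (-\<gamma>) \<alpha> = lmat d' (-b') (-c') a'"
        unfolding u'_def lmat_comp a'_def b'_def c'_def d'_def by (simp add: algebra_simps)
      have "a' * d' - b' * c' = (\<alpha> * \<epsilon> - \<beta> * \<gamma>) * (a * d - b * c)"
        unfolding a'_def b'_def c'_def d'_def by (simp add: algebra_simps)
      then have "a' * d' - b' * c' = 1" using D D' by simp
      then have "lmat a' b' c' d' (f (lmat d' (-b') (-c') a' v)) \<in> H \<longleftrightarrow> v \<in> H" using f unfolding N_def by blast
      then show ?thesis unfolding 1[symmetric] 2[symmetric] by simp
    qed
    moreover have "u \<circ> f \<circ> u' \<in> SL2Z" using f u u'S SL2Z_comp \<open>u \<in> SL2Z\<close> unfolding N_def by blast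
    ultimately show ?thesis unfolding N_def by blast
  qed
  then have "(u \<circ> f \<circ> u') \<circ> (u \<circ> x) \<in> N" using ux by (rule N_comp)
  moreover have "(u \<circ> f \<circ> u') \<circ> (u \<circ> x) = u \<circ> f \<circ> (u' \<circ> u) \<circ> x" by (simp only: o_assoc)
  ultimately show ?thesis unfolding u'u by (simp add: o_assoc)
qed

text \<open>Conjugating a power of a generator by a matrix gives a twist along the first column of
  that matrix in the upper triangular case, and an inverse twist along the second column in the
  lower triangular case.\<close>

lemma lett_N: "k dvd n \<Longrightarrow> lett (b, n) \<in> N"
proof -
  assume "k dvd n"
  then obtain l where n: "n = k * l" by (rule dvdE)
  have "lmat \<alpha> \<beta> \<gamma> \<epsilon> (lett (b, n) (lmat \<epsilon> (-\<beta>) (-\<gamma>) \<alpha> v)) \<in> H \<longleftrightarrow> v \<in> H" if D: "\<alpha> * \<epsilon> - \<beta> * \<gamma> = 1" for \<alpha> \<beta> \<gamma> \<epsilon> v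
  proof -
    obtain x y where v: "v = (x, y)" by force
    show ?thesis
    proof (cases b)
      case True
      have "coprime \<alpha> \<gamma>"
        using D by (metis coprimeI dvd_diff dvd_mult2 dvd_mult)
      moreover have "lmat \<alpha> \<beta> \<gamma> \<epsilon> (lett (b, n) (lmat \<epsilon> (-\<beta>) (-\<gamma>) \<alpha> v)) =
         ((\<alpha> * \<epsilon> - \<beta> * \<gamma>) * x + int l * int k * (\<alpha> * y - \<gamma> * x) * \<alpha>, (\<alpha> * \<epsilon> - \<beta> * \<gamma>) * y + int l * int k * (\<alpha> * y - \<gamma> * x) * \<gamma>)"
        using True by (simp add: lett_def n v lmat_def algebra_simps)
      ultimately show ?thesis unfolding D using twist_iff[of \<alpha> \<gamma> x "int l" y] v by simp
    next
      case False
      have "coprime \<beta> \<epsilon>"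
        using D by (metis coprimeI dvd_diff dvd_mult2 dvd_mult)
      moreover have "lmat \<alpha> \<beta> \<gamma> \<epsilon> (lett (b, n) (lmat \<epsilon> (-\<beta>) (-\<gamma>) \<alpha> v)) =
         ((\<alpha> * \<epsilon> - \<beta> * \<gamma>) * x + (- int l) * int k * (\<beta> * y - \<epsilon> * x) * \<beta>, (\<alpha> * \<epsilon> - \<beta> * \<gamma>) * y + (- int l) * int k * (\<beta> * y - \<epsilon> * x) * \<epsilon>)"
        using False by (simp add: lett_def n v lmat_def algebra_simps)
      ultimately show ?thesis unfolding D using twist_iff[of \<beta> \<epsilon> x "- int l" y] v by simp
    qed
  qed
  then show ?thesis using lett_SL2Z unfolding N_def by blast
qed

section \<open>Inverses modulo \<open>N\<close> by positive words\<close>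

definition cmpl :: "nat \<Rightarrow> nat" where "cmpl a = k - a mod k"

text \<open>The residue of -a modulo k is taken in {1..k} and not in {0..k-1}, because it becomes a
  digit of a continued fraction.\<close>

lemma cmpl: "1 \<le> cmpl a" "cmpl a \<le> k" "k dvd a + cmpl a"
proof -
  have m: "a mod k < k" using k_pos by simp
  then show "1 \<le> cmpl a" "cmpl a \<le> k" by (auto simp: cmpl_def)
  have "a + cmpl a = (a - a mod k) + k" using m mod_less_eq_dividend[of a k] unfolding cmpl_def by linarith
  then have "a + cmpl a = k * (a div k) + k" by (simp add: minus_mod_eq_mult_div)
  then show "k dvd a + cmpl a" by simp
qed

definition linv :: "(bool \<times> nat) list \<Rightarrow> (bool \<times> nat) list" where
  "linv w = map (\<lambda>(b, a). (b, cmpl a)) (rev w)"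

lemma lett_add: "lett (b, m) \<circ> lett (b, n) = lett (b, m + n)"
  by (auto simp: lett_def lmat_comp add.commute)

lemma prodl_insert:
  assumes "f \<in> N" "prodl (x @ y) \<in> N"
  shows "prodl x \<circ> (f \<circ> prodl y) \<in> N"
  using N_insert[OF assms(1) prodl_SL2Z[of x], of "prodl y"] assms(2) by (simp add: prodl_append)

text \<open>The outermost pair of letters is inserted first; its two letters then join x and y, and
  the rest of the word is inserted between them.\<close>

lemma prodl_cancel:
  assumes "prodl (x @ y) \<in> N"
  shows "prodl (x @ w @ linv w @ y) \<in> N" "prodl (x @ linv w @ w @ y) \<in> N"
proof -
  have c: "lett (b, a) \<circ> lett (b, cmpl a) \<in> N" "lett (b, cmpl a) \<circ> lett (b, a) \<in> N" for a b
    unfolding lett_add using cmpl(3)[of a] lett_N by (simp_all add: add.commute)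
  show "prodl (x @ w @ linv w @ y) \<in> N" using assms
  proof (induction w arbitrary: x y)
    case (Cons l w)
    obtain b a where l: "l = (b, a)" by force
    have "prodl x \<circ> ((lett (b, a) \<circ> lett (b, cmpl a)) \<circ> prodl y) \<in> N" by (rule prodl_insert[OF c(1) Cons.prems])
    then have "prodl ((x @ [l]) @ [(b, cmpl a)] @ y) \<in> N" by (simp add: prodl_append o_assoc l)
    from Cons.IH[OF this] show ?case by (simp add: linv_def l)
  qed (simp add: linv_def)
  show "prodl (x @ linv w @ w @ y) \<in> N" using assms
  proof (induction w arbitrary: x y rule: rev_induct)
    case (snoc l w)
    obtain b a where l: "l = (b, a)" by force
    have "prodl x \<circ> ((lett (b, cmpl a) \<circ> lett (b, a)) \<circ> prodl y) \<in> N" by (rule prodl_insert[OF c(2) snoc.prems])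
    then have "prodl ((x @ [(b, cmpl a)]) @ [l] @ y) \<in> N" by (simp add: prodl_append o_assoc l)
    from snoc.IH[OF this] show ?case by (simp add: linv_def l)
  qed (simp add: linv_def)
qed

text \<open>Modulo \<open>N\<close> the word \<open>linv w\<close> is inverse to \<open>w\<close>; it has positive exponents bounded by \<open>k\<close>. The two
  letters \<open>k\<close>, trivial modulo \<open>N\<close>, only restore the alternation of the generators.\<close>

definition block :: "nat list \<Rightarrow> nat list \<Rightarrow> nat list" where
  "block W A = W @ [k] @ map cmpl (rev W) @ map cmpl (rev A) @ [k] @ A"

text \<open>Reversing an alternating word of even length exchanges the generator it starts with. The
  letter k before \<open>rev W\<close> therefore shifts the alternation to what \<open>linv\<close>
  requires, and the letter k before \<open>A\<close> shifts it back. As the block has even length,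
  the next one starts with the upper generator again.\<close>

lemma block_N:
  assumes "even (length W)" "even (length A)"
  shows "prodl (lab True (block W A)) \<in> N"
proof -
  have inv: "lab False (map cmpl (rev w)) = linv (lab True w)" if "even (length w)" for w
    using that by (simp add: lab_map lab_rev linv_def rev_map)
  define w a where "w = lab True W" and "a = lab True A"
  have e: "lab True (block W A) = w @ [(True, k)] @ linv w @ linv a @ [(False, k)] @ a"
    unfolding block_def lab_append w_def a_def using assms inv by (simp add: lab_append)
  have "prodl ([] @ []) \<in> N" using N_id by simp
  then have "prodl ([] @ linv a @ a @ []) \<in> N" by (rule prodl_cancel)
  then have "prodl (linv a @ a) \<in> N" by simp
  from prodl_insert[OF lett_N[of k False] this] have "prodl (linv a @ [(False, k)] @ a) \<in> N" by (simp add: prodl_append)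
  then have "prodl ([] @ w @ linv w @ linv a @ [(False, k)] @ a) \<in> N" by (intro prodl_cancel) simp
  then have "prodl (w @ linv w @ linv a @ [(False, k)] @ a) \<in> N" by simp
  from prodl_insert[OF lett_N[of k True] this] show ?thesis unfolding e by (simp add: prodl_append)
qed

theorem hall_approximation:
  assumes m: "(m, 0) \<in> H"
  shows "\<exists>m0 r0. 0 < m0 \<and> 0 < r0 \<and> (\<forall>t\<ge>r0. \<exists>\<alpha>::real. \<alpha> \<notin> \<rat> \<and>
    (\<forall>\<epsilon>>0. \<exists>Y. \<forall>(x, y)\<in>H. Y \<le> y \<longrightarrow> m0\<^sup>2 / t - \<epsilon> \<le> of_int y * \<bar>of_int x - \<alpha> * of_int y\<bar>) \<and>
    (\<forall>\<epsilon>>0. \<forall>Y. \<exists>(x, y)\<in>H. Y \<le> y \<and> of_int y * \<bar>of_int x - \<alpha> * of_int y\<bar> \<le> m0\<^sup>2 / t + \<epsilon>))"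
proof -
  have "\<exists>n>0. (int n, 0) \<in> H"
  proof (cases "m > 0")
    case True
    then show ?thesis using m by (intro exI[of _ "nat m"]) auto
  next
    case False
    then have "m < 0" using m zero_H by (cases "m = 0") auto
    then show ?thesis using uminus_H[OF m] by (intro exI[of _ "nat (- m)"]) auto
  qed
  then obtain n0 where n0: "n0 > 0 \<and> (int n0, 0) \<in> H" by blast
  define m0 where "m0 = (LEAST n. n > 0 \<and> (int n, 0) \<in> H)"
  have m0: "m0 > 0" "(int m0, 0) \<in> H" using LeastI[of "\<lambda>n. n > 0 \<and> (int n, 0) \<in> H", OF n0] by (auto simp: m0_def)
  have m0_le: "int m0 \<le> g" if "1 \<le> g" "(g, 0) \<in> H" for g
    using that Least_le[of "\<lambda>n. n > 0 \<and> (int n, 0) \<in> H" "nat g"] by (simp add: m0_def)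
  \<comment> \<open>K bounds every digit outside the positions of \<open>L\<close>: the Hall words
    use digits up to 8, the correcting digits go up to k. There the product of denominator and error
    is at least 1 / (K + 2), and \<open>r0\<close> makes m0^2 / t no larger than that.\<close>
  define K where "K = max 8 k"
  define r0 where "r0 = (real m0)\<^sup>2 * (real K + 2)"
  have m0sq: "1 \<le> (real m0)\<^sup>2" using m0 by simp
  have K8: "8 \<le> real K" by (simp add: K_def)
  have r0: "(real m0)\<^sup>2 * 10 \<le> r0" using K8 unfolding r0_def by (intro mult_left_mono) auto
  have main: "\<exists>\<alpha>::real. \<alpha> \<notin> \<rat> \<and>
    (\<forall>\<epsilon>>0. \<exists>Y. \<forall>(x, y)\<in>H. Y \<le> y \<longrightarrow> (real m0)\<^sup>2 / t - \<epsilon> \<le> of_int y * \<bar>of_int x - \<alpha> * of_int y\<bar>) \<and>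
    (\<forall>\<epsilon>>0. \<forall>Y. \<exists>(x, y)\<in>H. Y \<le> y \<and> of_int y * \<bar>of_int x - \<alpha> * of_int y\<bar> \<le> (real m0)\<^sup>2 / t + \<epsilon>)"
    if t: "r0 \<le> t" for t
  proof -
    have t10: "10 \<le> t" "(real m0)\<^sup>2 * 10 \<le> t" using r0 t m0sq by linarith+
    have mt: "(real m0)\<^sup>2 \<le> t * t"
    proof -
      have "1 * t \<le> t * t" using t10 by (intro mult_right_mono) auto
      then show ?thesis using t10 m0sq by linarith
    qed
    \<comment> \<open>This puts s = t - L into [2 \<open>hlam\<close>, 2 \<open>hlam\<close> + 1),
      which lies in the range of \<open>hall_words\<close> because 2 (\<open>hmu\<close> -
      \<open>hlam\<close>) = 14 \<open>hlam\<close> > 1.\<close>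
    define L where "L = nat \<lfloor>t - 2 * hlam\<rfloor>"
    define s where "s = t - real L"
    have fl: "1 \<le> \<lfloor>t - 2 * hlam\<rfloor>" using t10 hlam_bounds by (simp add: le_floor_iff)
    then have L: "1 \<le> L" unfolding L_def by linarith
    have "real L = of_int \<lfloor>t - 2 * hlam\<rfloor>" using fl unfolding L_def by simp
    then have "real L \<le> t - 2 * hlam" "t - 2 * hlam < real L + 1" by linarith+
    then have s: "2 * hlam \<le> s" "s \<le> 2 * hmu" using hlam_bounds by (simp_all add: s_def hmu_def)
    define P where "P j uv \<longleftrightarrow> length (fst uv) = 2 * j + 2 \<and> length (snd uv) = 2 * j + 3 \<and>
      set (fst uv) \<subseteq> {1..8} \<and> set (snd uv) \<subseteq> {1..8} \<and>
      (\<forall>y z. 0 \<le> y \<longrightarrow> y \<le> 1 \<longrightarrow> 0 \<le> z \<longrightarrow> z \<le> 1 \<longrightarrow>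
        \<bar>ev (fst uv) y + ev (snd uv) z - s\<bar> \<le> 2 / real (2 * j + 2))" for j uv
    have "\<exists>uv. P j uv" for j
    proof -
      have "0 < 2 * j + 2" by simp
      from hall_words[OF s this] obtain u v where "length u = 2 * j + 2" "length v = Suc (2 * j + 2)" "set u \<subseteq> {1..8}" "set v \<subseteq> {1..8}"
        "\<forall>y z. 0 \<le> y \<longrightarrow> y \<le> 1 \<longrightarrow> 0 \<le> z \<longrightarrow> z \<le> 1 \<longrightarrow> \<bar>ev u y + ev v z - s\<bar> \<le> 2 / real (2 * j + 2)"
        by blast
      then have "P j (u, v)" by (simp add: P_def)
      then show ?thesis ..
    qed
    then obtain uv where uv: "\<And>j. P j (uv j)" by metis
    define u v where "u j = fst (uv j)" and "v j = snd (uv j)" for j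
    have lu: "length (u j) = 2 * j + 2" and lv: "length (v j) = 2 * j + 3"
      and su: "set (u j) \<subseteq> {1..8}" and sv: "set (v j) \<subseteq> {1..8}" for j
      using uv[of j] by (auto simp: u_def v_def P_def)
    have uvs: "\<bar>ev (u j) y + ev (v j) z - s\<bar> \<le> 1 / real (Suc j)" if "0 \<le> y" "y \<le> 1" "0 \<le> z" "z \<le> 1" for j y z
    proof -
      have "2 / real (2 * j + 2) = 1 / real (Suc j)" by (simp add: field_simps)
      then show ?thesis using uv[of j] that unfolding P_def u_def v_def by metis
    qed
    \<comment> \<open>The block ends with the reversed first word of the next index, so that the
      digit \<open>L\<close> that opens block j, for j > 0, has \<open>rev (u j)\<close> on its left
      and \<open>v j\<close> on its right.\<close>
    define bl where "bl j = block (L # v j) (rev (u (Suc j)))" for j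
    define blt where "blt j = v j @ [k] @ map cmpl (rev (L # v j)) @ map cmpl (u (Suc j)) @ [k] @ rev (u (Suc j))" for j
    have bl: "bl j = L # blt j" for j by (simp add: bl_def block_def blt_def)
    have blt: "1 \<le> b \<and> b \<le> K" if b: "b \<in> set (blt j)" for b j
    proof -
      have "b \<in> {1..8} \<or> b = k \<or> b \<in> range cmpl"
        using b su[of "Suc j"] sv[of j] unfolding blt_def by auto
      then show ?thesis using cmpl k_pos unfolding K_def by (auto simp: le_max_iff_disj)
    qed
    have bl_even: "even (length (bl j))" for j
      by (simp add: bl_def block_def lu lv)
    define pre where "pre n = concat (map bl [0..<n])" for n
    have pre_Suc: "pre (Suc n) = pre n @ bl n" for n by (simp add: pre_def)
    have pre0: "pre 0 = []" by (simp add: pre_def)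
    define st where "st n = length (pre n)" for n
    have st_Suc: "st (Suc n) = st n + length (bl n)" for n by (simp add: st_def pre_Suc)
    have st_less: "st n < st (Suc n)" for n unfolding st_Suc by (simp add: bl)
    have st_smono: "strict_mono st" using st_less by (simp add: strict_mono_Suc_iff)
    have st_ge: "n \<le> st n" for n by (rule strict_mono_imp_increasing[OF st_smono])
    \<comment> \<open>Digit n of the infinite concatenation: all blocks are nonempty, so n + 1 of
      them reach beyond position n.\<close>
    define a where "a n = pre (Suc n) ! n" for n
    have pre_nth: "pre m ! n = pre l ! n" if "m \<le> l" "n < st m" for m l n
      using that(1)
    proof (induction l rule: dec_induct)
      case (step l)
      have "st m \<le> st l" using step st_smono by (simp add: strict_mono_less_eq)
      then show ?case using step that(2) by (simp add: pre_Suc nth_append st_def)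
    qed simp
    have a_pre: "a n = pre m ! n" if "n < st m" for n m
    proof -
      have n: "n < st (Suc n)" using st_ge[of "Suc n"] by linarith
      show ?thesis
      proof (cases "m \<le> Suc n")
        case True
        show ?thesis unfolding a_def by (rule pre_nth[OF True that, symmetric])
      next
        case False
        show ?thesis unfolding a_def by (rule pre_nth) (use False n in auto)
      qed
    qed
    have a_bl: "a (st j + i) = bl j ! i" if "i < length (bl j)" for i j
      using a_pre[of "st j + i" "Suc j"] that by (simp add: st_Suc pre_Suc) (simp add: st_def)
    have pos: "\<exists>j i. n = st j + i \<and> i < length (bl j)" for n
    proof -
      have "\<exists>j. st j \<le> n \<and> n < st (Suc j)"
      proof (rule ccontr)
        assume *: "\<nexists>j. st j \<le> n \<and> n < st (Suc j)"
        have "st j \<le> n" for j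
          by (induction j) (use * in \<open>auto simp: st_def pre0 not_less\<close>)
        then show False using st_ge[of "Suc n"] by (meson Suc_n_not_le_n le_trans)
      qed
      then obtain j where j: "st j \<le> n" "n < st (Suc j)" by blast
      then show ?thesis unfolding st_Suc by (intro exI[of _ j] exI[of _ "n - st j"]) auto
    qed
    have a_cases: "(1 \<le> a n \<and> a n \<le> K) \<or> (\<exists>j. n = st j \<and> a n = L)" for n
    proof -
      obtain j i where ji: "n = st j + i" "i < length (bl j)" using pos by blast
      show ?thesis
      proof (cases i)
        case 0
        then show ?thesis using ji a_bl[of 0 j] by (auto simp: bl)
      next
        case (Suc i')
        then have "a n \<in> set (blt j)" using ji a_bl[of i j] by (simp add: bl)
        then show ?thesis using blt by blast
      qed
    qed
    interpret cf_digits a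
    proof
      show "1 \<le> a i" for i using a_cases[of i] L by auto
    qed
    have a_map: "map a [0..<st j] = pre j" for j
      by (rule nth_equalityI) (auto simp: st_def intro!: a_pre)
    have pre_N: "prodl (lab True (pre j)) \<in> N \<and> even (st j)" for j
    proof (induction j)
      case 0
      have "prodl (lab True (pre 0)) \<in> N" by (simp only: pre0 lab.simps prodl_simps N_id)
      moreover have "even (st 0)" by (simp add: pre0 st_def)
      ultimately show ?case ..
    next
      case (Suc j)
      have "prodl (lab True (bl j)) \<in> N" unfolding bl_def using lu lv by (intro block_N) auto
      with Suc have "prodl (lab True (pre j)) \<circ> prodl (lab True (bl j)) \<in> N" by (intro N_comp) auto
      moreover have "prodl (lab True (pre (Suc j))) = prodl (lab True (pre j)) \<circ> prodl (lab True (bl j))"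
        using Suc by (simp only: pre_Suc lab_append prodl_append st_def if_True)
      moreover have "even (st (Suc j))" using Suc bl_even[of j] by (simp add: st_Suc)
      ultimately show ?case by metis
    qed
    \<comment> \<open>The matrix of the first j blocks lies in \<open>N\<close> and sends (1, 0) to
      the convergent before the next \<open>L\<close>, hence (g, 0) to its g-fold multiple.\<close>
    have H_st: "(g * p (Suc (st j)), g * q (Suc (st j))) \<in> H \<longleftrightarrow> (g, 0) \<in> H" for g j
    proof -
      obtain \<alpha> \<beta> \<gamma> \<epsilon> where f: "prodl (lab True (pre j)) = lmat \<alpha> \<beta> \<gamma> \<epsilon>" using prodl_SL2Z unfolding SL2Z_def by blast
      have "(p (Suc (st j)), q (Suc (st j))) = lmat \<alpha> \<beta> \<gamma> \<epsilon> (1, 0)"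
        using prodl_lab_cf[of a "st j"] pre_N[of j] unfolding a_map f by simp
      then have "(g * p (Suc (st j)), g * q (Suc (st j))) = lmat \<alpha> \<beta> \<gamma> \<epsilon> (g, 0)" by (simp add: lmat_def mult.commute)
      then show ?thesis using N_preserves[OF pre_N[of j, THEN conjunct1], of "(g, 0)"] unfolding f by simp
    qed
    have a_map_from: "map a [st j + i..<st j + i + l] = take l (drop i (bl j))" if "i + l \<le> length (bl j)" for i j l
      by (rule nth_equalityI) (use that in \<open>auto simp: add.assoc a_bl\<close>)
    define T where "T j = real L + tail (Suc (st j)) + rho (st j)" for j
    \<comment> \<open>The forward tail begins with \<open>v j\<close>, the backward expansion with
      \<open>u j\<close>. The case j = 0 is left out because nothing precedes the first
      block.\<close>
    have T: "\<bar>T j - t\<bar> \<le> 1 / real (Suc j)" if j: "1 \<le> j" for j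
    proof -
      obtain i where i: "j = Suc i" using j by (cases j) auto
      have "map a [st j + 1..<st j + 1 + length (v j)] = v j"
        by (subst a_map_from) (auto simp: bl blt_def)
      then have 1: "tail (Suc (st j)) = ev (v j) (tail (Suc (st j) + length (v j)))"
        using tail_ev[of "Suc (st j)" "length (v j)"] by simp
      define n where "n = st i + (length (bl i) - length (u j))"
      have lb: "length (u j) < length (bl i)" by (simp add: bl blt_def i)
      have n: "n + length (u j) = st j" "1 \<le> n" using lb by (auto simp: n_def i st_Suc)
      define X where "X = L # v i @ [k] @ map cmpl (rev (L # v i)) @ map cmpl (u j) @ [k]"
      have X: "bl i = X @ rev (u j)" by (simp add: bl blt_def X_def i)
      have "length (bl i) - length (u j) + length (u j) \<le> length (bl i)" using lb by simp
      from a_map_from[OF this] have "map a [n..<n + length (u j)] = take (length (u j)) (drop (length X) (bl i))"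
        by (simp add: n_def X)
      then have "map a [n..<n + length (u j)] = rev (u j)" by (simp add: X)
      then have 2: "rho (st j) = ev (u j) (rho n)"
        using rho_ev[of n "length (u j)"] n by simp
      have "\<bar>ev (u j) (rho n) + ev (v j) (tail (Suc (st j) + length (v j))) - s\<bar> \<le> 1 / real (Suc j)"
        using rho_bounds[OF n(2)] tail_bounds[of "Suc (st j) + length (v j)"] by (intro uvs) auto
      then show ?thesis unfolding T_def 1[symmetric] 2[symmetric] s_def by (simp add: add_ac diff_diff_eq2)
    qed
    have qd: "of_int (q (Suc (st j))) * \<bar>\<delta> (Suc (st j))\<bar> = 1 / T j" if "1 \<le> j" for j
    proof -
      have "a (st j) = L" using a_bl[of 0 j] by (simp add: bl)
      moreover have "1 \<le> st j" using that st_ge[of j] by simp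
      ultimately show ?thesis using q_delta[of "st j"] by (simp add: T_def)
    qed
    have scale: "of_int (g * q (Suc n)) * \<bar>of_int (g * p (Suc n)) - \<alpha> * of_int (g * q (Suc n))\<bar>
        = (of_int g)\<^sup>2 * (of_int (q (Suc n)) * \<bar>\<delta> (Suc n)\<bar>)" if "0 \<le> g" for g n
    proof -
      have "of_int (g * p (Suc n)) - \<alpha> * of_int (g * q (Suc n)) = of_int g * \<delta> (Suc n)"
        by (simp add: \<delta>_def algebra_simps)
      then show ?thesis using that by (simp add: abs_mult power2_eq_square)
    qed
    have lower: "\<exists>Y. \<forall>(x, y)\<in>H. Y \<le> y \<longrightarrow> (real m0)\<^sup>2 / t - \<epsilon> \<le> of_int y * \<bar>of_int x - \<alpha> * of_int y\<bar>" if \<epsilon>: "0 < \<epsilon>" for \<epsilon> :: real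
    proof -
      obtain J where J: "1 / real (Suc J) < \<epsilon>" using nat_approx_posE[OF \<epsilon>] by blast
      \<comment> \<open>At a digit \<open>L\<close> the denominator D is at most G, so multiples
        with g >= G contribute at least 1. For g < G the lower bound on y pushes the index beyond
        \<open>st J\<close>, where D is within \<epsilon> of t.\<close>
      define G where "G = int L + 2"
      have bound: "(real m0)\<^sup>2 / t - \<epsilon> \<le> of_int y * \<bar>of_int x - \<alpha> * of_int y\<bar>"
        if xy: "(x, y) \<in> H" "G * q (Suc (st J)) + 1 \<le> y" for x y
      proof -
        have "0 \<le> G * q (Suc (st J))" using q_nonneg by (simp add: G_def)
        then have y1: "1 \<le> y" using xy by simp
        \<comment> \<open>The target is at most 1/10, so only vectors with a value below 1/2 can
          violate the bound, and to these \<open>legendre\<close> applies.\<close>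
        have mt1: "(real m0)\<^sup>2 / t \<le> 1 / 10" using t10 by (simp add: divide_le_eq)
        show ?thesis
        proof (cases "of_int y * \<bar>of_int x - \<alpha> * of_int y\<bar> < 1 / 2")
          case True
          obtain n g where ng: "1 \<le> n" "1 \<le> g" "x = g * p (Suc n)" "y = g * q (Suc n)"
            using legendre[OF y1 True] by blast
          define D where "D = real (a n) + tail (Suc n) + rho n"
          have val: "of_int y * \<bar>of_int x - \<alpha> * of_int y\<bar> = (of_int g)\<^sup>2 / D"
            unfolding ng(3,4) using scale[of g n] ng(2) q_delta[OF ng(1)] by (simp add: D_def)
          have D: "0 < D" "D \<le> real (a n) + 2"
            using tail_bounds[of "Suc n"] rho_bounds[OF ng(1)] unfolding D_def by linarith+
          have g1: "1 \<le> (of_int g :: real)\<^sup>2" using ng(2) by simp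
          consider "a n \<le> K" | j where "n = st j" "a n = L" "G \<le> g" | j where "n = st j" "a n = L" "g < G"
            using a_cases[of n] by fastforce
          then show ?thesis
          proof cases
            case 1
            have "(real m0)\<^sup>2 / t \<le> 1 / (real K + 2)" using t m0sq t10 K8 by (simp add: r0_def field_simps)
            also have "\<dots> \<le> (of_int g)\<^sup>2 / D" using D 1 g1 K8 by (intro frac_le) auto
            finally show ?thesis using \<epsilon> val by simp
          next
            case (2 j)
            have "real_of_int G \<le> of_int g" "1 \<le> (of_int g :: real)" using 2 ng by linarith+
            then have "1 * real_of_int G \<le> of_int g * of_int g" by (intro mult_mono) (auto simp: G_def)
            then have "D \<le> of_int g * of_int g" using D 2 by (simp add: G_def)
            then have "1 \<le> (of_int g)\<^sup>2 / D" using D by (simp add: power2_eq_square)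
            then show ?thesis unfolding val using \<epsilon> mt1 by linarith
          next
            case (3 j)
            have "st J < n"
            proof (rule ccontr)
              assume "\<not> st J < n"
              then have "q (Suc n) \<le> q (Suc (st J))" by (intro q_mono) auto
              then have "g * q (Suc n) \<le> G * q (Suc (st J))" using 3 ng q_nonneg by (intro mult_mono) auto
              then show False using xy(2) ng(4) by simp
            qed
            then have j: "J < j" using 3(1) st_smono by (simp add: strict_mono_less)
            have "(g, 0) \<in> H" using xy(1) H_st[of g j] 3(1) ng by simp
            then have "int m0 \<le> g" using m0_le ng(2) by blast
            then have "real m0 \<le> of_int g" by linarith
            then have gm: "(real m0)\<^sup>2 \<le> (of_int g)\<^sup>2" by (intro power_mono) auto
            define d where "d = 1 / real (Suc j)"
            have dJ: "d \<le> 1 / real (Suc J)" using j unfolding d_def by (intro divide_left_mono) auto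
            have d0: "0 \<le> d" by (simp add: d_def)
            have "D = T j" using 3 by (simp add: D_def T_def)
            then have Dt: "D \<le> t + d" using T[of j] j unfolding d_def by linarith
            have "(real m0)\<^sup>2 / t - d \<le> (real m0)\<^sup>2 / (t + d)"
            proof -
              have "(real m0)\<^sup>2 \<le> t * (t + d)" using mt d0 t10 by (simp add: distrib_left add_increasing2)
              then have "d * (real m0)\<^sup>2 \<le> d * (t * (t + d))" using d0 by (intro mult_left_mono) auto
              then have "((real m0)\<^sup>2 - d * t) * (t + d) \<le> (real m0)\<^sup>2 * t" by (simp add: algebra_simps)
              moreover have "(real m0)\<^sup>2 / t - d = ((real m0)\<^sup>2 - d * t) / t" using t10 by (simp add: field_simps)
              ultimately show ?thesis using t10 d0 by (simp add: pos_le_divide_eq pos_divide_le_eq mult.commute)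
            qed
            also have "\<dots> \<le> (of_int g)\<^sup>2 / D" using gm D Dt by (intro frac_le) auto
            finally show ?thesis using val J dJ by simp
          qed
        next
          case False
          then show ?thesis using mt1 \<epsilon> by linarith
        qed
      qed
      then show ?thesis by blast
    qed
    have upper: "\<exists>(x, y)\<in>H. Y \<le> y \<and> of_int y * \<bar>of_int x - \<alpha> * of_int y\<bar> \<le> (real m0)\<^sup>2 / t + \<epsilon>" if \<epsilon>: "0 < \<epsilon>" for \<epsilon> :: real and Y
    proof -
      obtain J where J: "1 / real (Suc J) < \<epsilon> / 2" using nat_approx_posE[of "\<epsilon> / 2"] \<epsilon> by auto
      \<comment> \<open>The first entry makes the error of \<open>T j\<close> small, the second
        forces the denominator beyond Y through \<open>q_ge\<close>.\<close>
      define j where "j = max (Suc J) (nat Y + 3)"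
      have j: "1 \<le> j" "J \<le> j" "nat Y + 3 \<le> j" by (auto simp: j_def)
      define x y where "x = int m0 * p (Suc (st j))" and "y = int m0 * q (Suc (st j))"
      have "(x, y) \<in> H" unfolding x_def y_def H_st by (rule m0)
      moreover have "Y \<le> y"
      proof -
        have "nat Y + 3 \<le> Suc (st j)" using j st_ge[of j] by simp
        then have "q (nat Y + 3) \<le> q (Suc (st j))" by (intro q_mono) auto
        then have "Y \<le> q (Suc (st j))" using q_ge[of "nat Y"] by linarith
        also have "\<dots> \<le> y" unfolding y_def using m0(1) q_nonneg[of "Suc (st j)"]
          mult_right_mono[of 1 "int m0" "q (Suc (st j))"] by simp
        finally show ?thesis .
      qed
      moreover have "of_int y * \<bar>of_int x - \<alpha> * of_int y\<bar> \<le> (real m0)\<^sup>2 / t + \<epsilon>"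
      proof -
        define d where "d = 1 / real (Suc j)"
        have d: "0 \<le> d" "d \<le> 1" by (auto simp: d_def)
        have "d \<le> 1 / real (Suc J)" unfolding d_def using j by (intro divide_left_mono) auto
        then have d\<epsilon>: "2 * d \<le> \<epsilon>" using J by simp
        have "of_int y * \<bar>of_int x - \<alpha> * of_int y\<bar> = (real m0)\<^sup>2 / T j"
          unfolding x_def y_def using scale[of "int m0" "st j"] qd[OF j(1)] by simp
        also have "\<dots> \<le> (real m0)\<^sup>2 / (t - d)"
          using T[OF j(1)] t10 d unfolding d_def[symmetric] by (intro divide_left_mono mult_pos_pos) auto
        also have "\<dots> \<le> (real m0)\<^sup>2 / t + 2 * d"
        proof -
          have "t * t \<le> t * (2 * (t - d))" using t10 d by (intro mult_left_mono) auto
          then have "(real m0)\<^sup>2 \<le> t * (2 * (t - d))" using mt by simp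
          then have "d * (real m0)\<^sup>2 \<le> d * (t * (2 * (t - d)))" using d by (intro mult_left_mono) auto
          then have "(real m0)\<^sup>2 * t \<le> ((real m0)\<^sup>2 + 2 * d * t) * (t - d)" by (simp add: algebra_simps)
          moreover have "(real m0)\<^sup>2 / t + 2 * d = ((real m0)\<^sup>2 + 2 * d * t) / t" using t10 by (simp add: field_simps)
          ultimately show ?thesis using t10 d by (simp add: pos_le_divide_eq pos_divide_le_eq mult.commute)
        qed
        finally show ?thesis using d\<epsilon> by simp
      qed
      ultimately show ?thesis by blast
    qed
    show ?thesis using alpha_irrational lower upper by blast
  qed
  have "0 < r0" using r0 m0sq by linarith
  then show ?thesis using main m0(1) by (intro exI[of _ "real m0"] exI[of _ r0]) simp
qed

end

section \<open>Lifting to a branched cover of the torus\<close>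

definition gauss :: "complex set" where "gauss = {z. Re z \<in> \<int> \<and> Im z \<in> \<int>}"

lemma gauss_iff: "z \<in> gauss \<longleftrightarrow> (\<exists>x y. z = Complex (of_int x) (of_int y))"
  by (cases z) (auto simp: gauss_def elim!: Ints_cases)

lemma gauss_diff: "z \<in> gauss \<Longrightarrow> w \<in> gauss \<Longrightarrow> z - w \<in> gauss"
  and gauss_minus: "z \<in> gauss \<Longrightarrow> - z \<in> gauss"
  and gauss_of_int_mult: "z \<in> gauss \<Longrightarrow> of_int k * z \<in> gauss"
  and gauss_0 [simp]: "0 \<in> gauss"
  by (auto simp: gauss_def)

lemma gauss_of_real [simp]: "of_real t \<in> gauss \<longleftrightarrow> t \<in> \<int>"
  by (simp add: gauss_def)

lemma cis_2pi_eq_iff: "cis (2 * pi * x) = cis (2 * pi * y) \<longleftrightarrow> x - y \<in> \<int>"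
proof -
  have "cis (2 * pi * x) = cis (2 * pi * y) \<longleftrightarrow> (\<exists>n::int. 2 * pi * x = 2 * pi * y + 2 * pi * of_int n)"
    using sin_cos_eq_iff[of "2 * pi * x" "2 * pi * y"] by (auto simp: complex_eq_iff)
  also have "\<dots> \<longleftrightarrow> (\<exists>n::int. x = y + of_int n)"
  proof -
    have "2 * pi * x = 2 * pi * y + 2 * pi * of_int n \<longleftrightarrow> 2 * pi * (x - (y + of_int n)) = 0" for n :: int
      by (simp add: algebra_simps)
    then show ?thesis by simp
  qed
  also have "\<dots> \<longleftrightarrow> x - y \<in> \<int>"
    by (auto simp: Ints_def image_iff diff_eq_eq add.commute)
  finally show ?thesis .
qed

lemma torus_proj_eq_iff: "torus_proj z = torus_proj w \<longleftrightarrow> z - w \<in> gauss"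
  by (simp add: torus_proj_def cis_2pi_eq_iff gauss_def)

lemma torus_proj_eq_0_iff: "torus_proj z = torus_proj 0 \<longleftrightarrow> z \<in> gauss"
  by (simp add: torus_proj_eq_iff)

lemma torus_proj_add_gauss: "w \<in> gauss \<Longrightarrow> torus_proj (z + w) = torus_proj z"
  by (simp add: torus_proj_eq_iff)

lemma continuous_torus_proj: "continuous_on A torus_proj"
  unfolding torus_proj_def by (intro continuous_intros)

lemma torus_proj_in_torus [simp]: "torus_proj z \<in> topspace torus"
  by (simp add: torus_def torus_proj_def)

lemma closed_gauss: "closed gauss"
proof -
  have "closed (torus_proj -` {torus_proj 0})"
    by (intro continuous_closed_vimage) (use continuous_torus_proj[of UNIV] in \<open>auto simp: continuous_on_eq_continuous_at\<close>)
  moreover have "torus_proj -` {torus_proj 0} = gauss" by (auto simp: torus_proj_eq_0_iff)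
  ultimately show ?thesis by simp
qed

lemma countable_gauss: "countable gauss"
proof -
  have "gauss \<subseteq> (\<lambda>q. Complex (of_int (fst q)) (of_int (snd q))) ` (UNIV :: (int \<times> int) set)"
  proof
    fix z assume "z \<in> gauss"
    then obtain x y where "z = Complex (of_int x) (of_int y)" by (auto simp: gauss_iff)
    then show "z \<in> (\<lambda>q. Complex (of_int (fst q)) (of_int (snd q))) ` (UNIV :: (int \<times> int) set)"
      by (intro image_eqI[of _ _ "(x, y)"]) auto
  qed
  then show ?thesis by (rule countable_subset) simp
qed

text \<open>Continuity into the abstract topology of a surface, in pointwise form: the paths below
  are defined piecewise and are checked at each parameter separately.\<close>

lemma continuous_map_top_of_set_iff:
  fixes f :: "'b::topological_space \<Rightarrow> 'a"
  shows "continuous_map (top_of_set A) S f \<longleftrightarrow>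
    (\<forall>t\<in>A. f t \<in> topspace S \<and> (\<forall>W. openin S W \<longrightarrow> f t \<in> W \<longrightarrow> (\<forall>\<^sub>F u in at t within A. f u \<in> W)))"
proof
  assume c: "continuous_map (top_of_set A) S f"
  show "\<forall>t\<in>A. f t \<in> topspace S \<and> (\<forall>W. openin S W \<longrightarrow> f t \<in> W \<longrightarrow> (\<forall>\<^sub>F u in at t within A. f u \<in> W))"
  proof (intro ballI conjI allI impI)
    fix t assume t: "t \<in> A"
    show "f t \<in> topspace S" using c t by (auto simp: continuous_map_def)
    fix W assume W: "openin S W" "f t \<in> W"
    then have "openin (top_of_set A) {x \<in> A. f x \<in> W}" using c by (auto simp: continuous_map_def)
    then obtain T where "open T" "{x \<in> A. f x \<in> W} = A \<inter> T" by (auto simp: openin_open)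
    then show "\<forall>\<^sub>F u in at t within A. f u \<in> W"
      unfolding eventually_at_topological using W t by blast
  qed
next
  assume r: "\<forall>t\<in>A. f t \<in> topspace S \<and> (\<forall>W. openin S W \<longrightarrow> f t \<in> W \<longrightarrow> (\<forall>\<^sub>F u in at t within A. f u \<in> W))"
  have "openin (top_of_set A) {x \<in> A. f x \<in> W}" if W: "openin S W" for W
  proof (subst openin_subopen, intro ballI)
    fix t assume t: "t \<in> {x \<in> A. f x \<in> W}"
    then have "\<forall>\<^sub>F u in at t within A. f u \<in> W" using r W by auto
    then obtain T where T: "open T" "t \<in> T" "\<forall>u\<in>T. u \<noteq> t \<longrightarrow> u \<in> A \<longrightarrow> f u \<in> W"
      unfolding eventually_at_topological by blast
    show "\<exists>T. openin (top_of_set A) T \<and> t \<in> T \<and> T \<subseteq> {x \<in> A. f x \<in> W}"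
      by (rule exI[of _ "A \<inter> T"]) (use T t in \<open>auto simp: openin_open\<close>)
  qed
  then show "continuous_map (top_of_set A) S f" using r by (auto simp: continuous_map_def)
qed

lemma continuous_map_paste_closed:
  fixes f g :: "'b::topological_space \<Rightarrow> 'a"
  assumes f: "continuous_map (top_of_set A) S f" and g: "continuous_map (top_of_set B) S g"
    and A: "closed A" and B: "closed B" and eq: "\<And>x. x \<in> A \<Longrightarrow> x \<in> B \<Longrightarrow> f x = g x"
  shows "continuous_map (top_of_set (A \<union> B)) S (\<lambda>x. if x \<in> A then f x else g x)"
proof -
  let ?h = "\<lambda>x. if x \<in> A then f x else g x"
  have "openin (top_of_set (A \<union> B)) {x \<in> A \<union> B. ?h x \<in> W} " if "openin S W" for W
  proof -
    obtain T1 where T1: "open T1" "{x \<in> A. f x \<in> W} = A \<inter> T1"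
      using f \<open>openin S W\<close> by (auto simp: continuous_map_def openin_open)
    obtain T2 where T2: "open T2" "{x \<in> B. g x \<in> W} = B \<inter> T2"
      using g \<open>openin S W\<close> by (auto simp: continuous_map_def openin_open)
    have "{x \<in> A \<union> B. ?h x \<in> W} = (A \<union> B) \<inter> ((T1 \<union> - A) \<inter> (T2 \<union> - B))"
    proof -
      have 1: "f x \<in> W \<longleftrightarrow> x \<in> T1" if "x \<in> A" for x using T1(2) that by blast
      have 2: "g x \<in> W \<longleftrightarrow> x \<in> T2" if "x \<in> B" for x using T2(2) that by blast
      have 3: "x \<in> T1 \<longleftrightarrow> x \<in> T2" if "x \<in> A" "x \<in> B" for x using 1[OF that(1)] 2[OF that(2)] eq[OF that] by simp
      show ?thesis using 1 2 3 by auto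
    qed
    moreover have "open ((T1 \<union> - A) \<inter> (T2 \<union> - B))" using A B T1 T2 by (intro open_Int open_Un) auto
    ultimately show ?thesis unfolding openin_open by blast
  qed
  moreover have "?h x \<in> topspace S" if "x \<in> A \<union> B" for x
    using that f g by (auto simp: continuous_map_def)
  ultimately show ?thesis by (auto simp: continuous_map_def)
qed

lemma finite_of_isolated:
  assumes S: "compact_space S" and F: "closedin S F"
    and iso: "\<And>x. x \<in> F \<Longrightarrow> \<exists>U. openin S U \<and> x \<in> U \<and> U \<inter> F \<subseteq> {x}"
  shows "finite F"
proof -
  define \<U> where "\<U> = {U. openin S U \<and> (\<exists>x. U \<inter> F \<subseteq> {x})}"
  have op: "openin S U" if "U \<in> \<U>" for U using that by (simp add: \<U>_def)
  have cover: "F \<subseteq> \<Union>\<U>"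
  proof
    fix x assume "x \<in> F"
    then obtain U where "openin S U" "x \<in> U" "U \<inter> F \<subseteq> {x}" using iso by blast
    then show "x \<in> \<Union>\<U>" unfolding \<U>_def by blast
  qed
  have "compactin S F" using S F by (rule closedin_compact_space)
  then have "\<exists>\<F>. finite \<F> \<and> \<F> \<subseteq> \<U> \<and> F \<subseteq> \<Union>\<F>" using op cover by (rule compactinD)
  then obtain \<F> where \<F>: "finite \<F>" "\<F> \<subseteq> \<U>" "F \<subseteq> \<Union>\<F>" by (elim exE conjE)
  have "finite (V \<inter> F)" if "V \<in> \<F>" for V
  proof -
    obtain x where "V \<inter> F \<subseteq> {x}" using \<F>(2) \<open>V \<in> \<F>\<close> unfolding \<U>_def by blast
    then show ?thesis by (rule finite_subset) simp
  qed
  then have "finite (\<Union>V\<in>\<F>. V \<inter> F)" using \<F>(1) by blast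
  moreover have "F \<subseteq> (\<Union>V\<in>\<F>. V \<inter> F)" using \<F>(3) by blast
  ultimately show ?thesis by (rule finite_subset[rotated])
qed

text \<open>The topological content of a square-tiled surface, with the complex structure left
  behind. \<open>locinj\<close> says that p ramifies at most in \<open>Sg\<close>, so a point over 0
  outside \<open>Sg\<close> is regular; \<open>hor\<close> says that points over short horizontal
  segments occur arbitrarily close to every point over 0.\<close>

locale torus_cover =
  fixes S :: "'a topology" and p :: "'a \<Rightarrow> complex \<times> complex" and Sg :: "'a set"
  assumes haus: "Hausdorff_space S" and comp: "compact_space S"
    and cov: "covering_off_origin S p"
    and Sg_sub: "Sg \<subseteq> topspace S" and Sg_ne: "Sg \<noteq> {}"
    and Sg_p: "x \<in> Sg \<Longrightarrow> p x = torus_proj 0"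
    and fin0: "finite {x \<in> topspace S. p x = torus_proj 0}"
    and locinj: "x \<in> topspace S \<Longrightarrow> x \<notin> Sg \<Longrightarrow> \<exists>U. openin S U \<and> x \<in> U \<and> inj_on p U"
    and hor: "openin S U \<Longrightarrow> x \<in> U \<Longrightarrow> p x = torus_proj 0 \<Longrightarrow>
      \<exists>\<delta>>0. \<forall>\<epsilon>\<in>{0<..<\<delta>}. \<exists>y\<in>U. p y = torus_proj (of_real \<epsilon>)"
begin

lemma p_continuous: "continuous_map S euclidean p"
  using cov unfolding covering_off_origin_def torus_def by (simp add: continuous_map_in_subtopology)

definition fib :: "complex \<Rightarrow> 'a set" where "fib z = {x \<in> topspace S. p x = torus_proj z}"

text \<open>The set of agreement is open because p is locally injective off \<open>Sg\<close>, and
  closed because the surface is Hausdorff. Lifts may pass over lattice points as long as they avoid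
  \<open>Sg\<close>.\<close>

lemma unique_lift:
  fixes f g :: "'b::topological_space \<Rightarrow> 'a"
  assumes D: "connected D" and f: "continuous_map (top_of_set D) S f" and g: "continuous_map (top_of_set D) S g"
    and pe: "\<And>z. z \<in> D \<Longrightarrow> p (f z) = p (g z)" and nS: "\<And>z. z \<in> D \<Longrightarrow> f z \<notin> Sg"
    and z0: "z0 \<in> D" "f z0 = g z0" and z: "z \<in> D"
  shows "f z = g z"
proof -
  define A where "A = {z \<in> D. f z = g z}"
  have fg: "f z \<in> topspace S" "g z \<in> topspace S" if "z \<in> D" for z
    using f g that by (auto simp: continuous_map_def)
  have op: "openin (top_of_set D) {z \<in> D. f z \<in> U}" "openin (top_of_set D) {z \<in> D. g z \<in> U}" if "openin S U" for U
    using f g that by (auto simp: continuous_map_def)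
  have "openin (top_of_set D) A"
  proof (subst openin_subopen, intro ballI)
    fix z assume z: "z \<in> A"
    then have "z \<in> D" by (simp add: A_def)
    then obtain U where U: "openin S U" "f z \<in> U" "inj_on p U" using locinj fg nS by metis
    show "\<exists>T. openin (top_of_set D) T \<and> z \<in> T \<and> T \<subseteq> A"
    proof (intro exI conjI)
      show "openin (top_of_set D) ({z \<in> D. f z \<in> U} \<inter> {z \<in> D. g z \<in> U})" using op U by (intro openin_Int)
      show "z \<in> {z \<in> D. f z \<in> U} \<inter> {z \<in> D. g z \<in> U}" using z U by (auto simp: A_def)
      show "{z \<in> D. f z \<in> U} \<inter> {z \<in> D. g z \<in> U} \<subseteq> A" using U(3) pe by (auto simp: A_def inj_on_def)
    qed
  qed
  moreover have "openin (top_of_set D) (D - A)"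
  proof (subst openin_subopen, intro ballI)
    fix z assume z: "z \<in> D - A"
    then have "f z \<noteq> g z" "f z \<in> topspace S" "g z \<in> topspace S" using fg by (auto simp: A_def)
    then obtain U V where UV: "openin S U" "openin S V" "f z \<in> U" "g z \<in> V" "disjnt U V"
      using haus unfolding Hausdorff_space_def by metis
    show "\<exists>T. openin (top_of_set D) T \<and> z \<in> T \<and> T \<subseteq> D - A"
    proof (intro exI conjI)
      show "openin (top_of_set D) ({z \<in> D. f z \<in> U} \<inter> {z \<in> D. g z \<in> V})" using op UV by (intro openin_Int)
      show "z \<in> {z \<in> D. f z \<in> U} \<inter> {z \<in> D. g z \<in> V}" using z UV by auto
      show "{z \<in> D. f z \<in> U} \<inter> {z \<in> D. g z \<in> V} \<subseteq> D - A" using UV(5) by (auto simp: A_def disjnt_iff)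
    qed
  qed
  then have "closedin (top_of_set D) A" by (simp add: closedin_def A_def)
  ultimately have "A = {} \<or> A = D" using D unfolding connected_clopen by blast
  then show ?thesis using z0 z by (auto simp: A_def)
qed

definition is_sec :: "complex set \<Rightarrow> (complex \<Rightarrow> 'a) \<Rightarrow> bool" where
  "is_sec D \<sigma> \<longleftrightarrow> continuous_map (top_of_set D) S \<sigma> \<and> (\<forall>z\<in>D. p (\<sigma> z) = torus_proj z)"

lemma is_sec_subset: "is_sec D \<sigma> \<Longrightarrow> E \<subseteq> D \<Longrightarrow> is_sec E \<sigma>"
  unfolding is_sec_def by (meson continuous_map_from_subtopology_mono subset_iff)

lemma is_sec_topspace: "is_sec D \<sigma> \<Longrightarrow> z \<in> D \<Longrightarrow> \<sigma> z \<in> topspace S"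
  by (auto simp: is_sec_def continuous_map_def)

lemma not_Sg:
  assumes "p x = torus_proj z" "z \<notin> gauss"
  shows "x \<notin> Sg"
proof
  assume "x \<in> Sg"
  then have "torus_proj z = torus_proj 0" using Sg_p[of x] assms(1) by simp
  then show False using torus_proj_eq_0_iff[of z] assms(2) by simp
qed

lemma is_sec_unique:
  assumes "is_sec D \<sigma>" "is_sec D \<tau>" "connected D" "D \<inter> gauss = {}" "z0 \<in> D" "\<sigma> z0 = \<tau> z0" "z \<in> D"
  shows "\<sigma> z = \<tau> z"
proof (rule unique_lift[of D \<sigma> \<tau> z0 z])
  show "continuous_map (top_of_set D) S \<sigma>" "continuous_map (top_of_set D) S \<tau>"
    using assms(1,2) by (simp_all add: is_sec_def)
  fix y assume y: "y \<in> D"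
  then have pt: "p (\<sigma> y) = torus_proj y" "p (\<tau> y) = torus_proj y" using assms(1,2) by (simp_all add: is_sec_def)
  show "p (\<sigma> y) = p (\<tau> y)" unfolding pt ..
  show "\<sigma> y \<notin> Sg" using not_Sg[OF pt(1)] y assms(4) by blast
qed (use assms in auto)

text \<open>Over a good set the pulled back covering is trivial. Balls are good since they can be
  chosen evenly covered; strips become good by gluing.\<close>

definition good :: "complex set \<Rightarrow> bool" where
  "good D \<longleftrightarrow> D \<inter> gauss = {} \<and> (\<forall>z\<in>D. \<forall>x\<in>fib z. \<exists>\<sigma>. is_sec D \<sigma> \<and> \<sigma> z = x)"

lemma goodD:
  assumes "good D" "z \<in> D" "x \<in> fib z"
  obtains \<sigma> where "is_sec D \<sigma>" "\<sigma> z = x"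
proof -
  have "\<forall>z\<in>D. \<forall>x\<in>fib z. \<exists>\<sigma>. is_sec D \<sigma> \<and> \<sigma> z = x" using assms(1) unfolding good_def by (rule conjunct2)
  from bspec[OF bspec[OF this assms(2)] assms(3)] show ?thesis using that by (elim exE conjE)
qed

lemma good_free: "good D \<Longrightarrow> D \<inter> gauss = {}"
  unfolding good_def by (rule conjunct1)

lemma goodI:
  assumes "D \<inter> gauss = {}" "\<And>z x. z \<in> D \<Longrightarrow> x \<in> fib z \<Longrightarrow> \<exists>\<sigma>. is_sec D \<sigma> \<and> \<sigma> z = x"
  shows "good D"
  unfolding good_def by (intro conjI ballI assms)

lemma good_subset:
  assumes "good D" "E \<subseteq> D"
  shows "good E"
proof (rule goodI)
  show "E \<inter> gauss = {}" using good_free[OF assms(1)] assms(2) by auto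
  fix z x assume z: "z \<in> E" "x \<in> fib z"
  obtain \<sigma> where "is_sec D \<sigma>" "\<sigma> z = x" by (rule goodD[OF assms(1) subsetD[OF assms(2) z(1)] z(2)])
  then show "\<exists>\<sigma>. is_sec E \<sigma> \<and> \<sigma> z = x" using is_sec_subset[OF _ assms(2)] by (intro exI[of _ \<sigma>] conjI)
qed

lemma good_ball:
  assumes z0: "z0 \<notin> gauss"
  shows "\<exists>\<delta>>0. good (ball z0 \<delta>)"
proof -
  have "torus_proj z0 \<in> topspace torus - {torus_proj 0}" using z0 by (simp add: torus_proj_eq_0_iff)
  then obtain V \<U> where V: "openin torus V" "torus_proj z0 \<in> V" and U: "\<Union>\<U> = {x \<in> topspace S. p x \<in> V}"
    "\<forall>U\<in>\<U>. openin S U" "\<forall>U\<in>\<U>. homeomorphic_map (subtopology S U) (subtopology torus V) p"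
    using cov unfolding covering_off_origin_def by blast
  obtain V' where V': "open V'" "V = topspace torus \<inter> V'"
    using V unfolding torus_def by (auto simp: openin_open)
  have "open (torus_proj -` V' \<inter> - gauss)"
    by (intro open_Int open_vimage open_Compl V' continuous_torus_proj closed_gauss)
  moreover have "z0 \<in> torus_proj -` V' \<inter> - gauss" using V V' z0 by auto
  ultimately obtain \<delta> where \<delta>: "\<delta> > 0" "ball z0 \<delta> \<subseteq> torus_proj -` V' \<inter> - gauss"
    by (meson open_contains_ball)
  have inV: "torus_proj w \<in> V" if "w \<in> ball z0 \<delta>" for w using that \<delta> V' by auto
  have "\<exists>\<sigma>. is_sec (ball z0 \<delta>) \<sigma> \<and> \<sigma> z = x" if z: "z \<in> ball z0 \<delta>" "x \<in> fib z" for z x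
  proof -
    have "x \<in> \<Union>\<U>" unfolding U using z inV by (auto simp: fib_def)
    then obtain W where W: "W \<in> \<U>" "x \<in> W" by blast
    have Wt: "W \<subseteq> topspace S" using U W openin_subset by blast
    have "homeomorphic_map (subtopology S W) (subtopology torus V) p" using U W by blast
    then obtain s where s: "homeomorphic_maps (subtopology S W) (subtopology torus V) p s"
      unfolding homeomorphic_map_maps by blast
    have tV: "topspace (subtopology torus V) = V" using openin_subset[OF V(1)] by auto
    have tW: "topspace (subtopology S W) = W" using Wt by auto
    have sc: "continuous_map (subtopology torus V) (subtopology S W) s"
      and ps: "\<And>y. y \<in> V \<Longrightarrow> p (s y) = y" and sp: "\<And>x. x \<in> W \<Longrightarrow> s (p x) = x"
      using s unfolding homeomorphic_maps_def tV tW by blast+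
    have "continuous_map (top_of_set (ball z0 \<delta>)) (subtopology torus V) torus_proj"
      unfolding continuous_map_in_subtopology torus_def
    proof (intro conjI)
      show "continuous_map (top_of_set (ball z0 \<delta>)) euclidean torus_proj"
        by (simp add: continuous_torus_proj)
      show "torus_proj \<in> topspace (top_of_set (ball z0 \<delta>)) \<rightarrow> sphere 0 1 \<times> sphere 0 1"
        by (auto simp: torus_proj_def)
      show "torus_proj \<in> topspace (top_of_set (ball z0 \<delta>)) \<rightarrow> V" using inV by auto
    qed
    then have "continuous_map (top_of_set (ball z0 \<delta>)) (subtopology S W) (s \<circ> torus_proj)"
      using sc by (rule continuous_map_compose)
    then have "continuous_map (top_of_set (ball z0 \<delta>)) S (s \<circ> torus_proj)"
      by (simp only: continuous_map_in_subtopology)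
    then have "is_sec (ball z0 \<delta>) (s \<circ> torus_proj)"
      unfolding is_sec_def using ps inV by simp
    moreover have "(s \<circ> torus_proj) z = x" using z(2) sp[OF W(2)] by (simp add: fib_def)
    ultimately show ?thesis by blast
  qed
  then have "good (ball z0 \<delta>)" using \<delta>(2) by (intro goodI) auto
  then show ?thesis using \<delta>(1) by (intro exI[of _ \<delta>] conjI)
qed

text \<open>Two sections that agree at one point of the overlap agree on all of it, because the
  overlap is connected. Closedness of both sets allows the sections to be pasted.\<close>

lemma good_glue:
  assumes "good A" "good B" "closed A" "closed B" "connected A" "connected B" "connected (A \<inter> B)" "A \<inter> B \<noteq> {}"
  shows "good (A \<union> B)"
proof -
  have half: "\<exists>\<sigma>. is_sec (A \<union> B) \<sigma> \<and> \<sigma> z = x"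
    if h: "good A" "good B" "closed A" "closed B" "connected (A \<inter> B)" "A \<inter> B \<noteq> {}" "z \<in> A" "x \<in> fib z" for A B z x
  proof -
    obtain \<sigma> where \<sigma>: "is_sec A \<sigma>" "\<sigma> z = x" by (rule goodD[OF h(1,7,8)])
    obtain w where w: "w \<in> A" "w \<in> B" using h by blast
    have "\<sigma> w \<in> fib w" using \<sigma> w by (auto simp: fib_def is_sec_def continuous_map_def)
    then obtain \<tau> where \<tau>: "is_sec B \<tau>" "\<tau> w = \<sigma> w" by (rule goodD[OF h(2) w(2)])
    have "\<sigma> y = \<tau> y" if "y \<in> A" "y \<in> B" for y
    proof (rule is_sec_unique[of "A \<inter> B"])
      show "is_sec (A \<inter> B) \<sigma>" "is_sec (A \<inter> B) \<tau>" using is_sec_subset[OF \<sigma>(1)] is_sec_subset[OF \<tau>(1)] by blast+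
      show "A \<inter> B \<inter> gauss = {}" using good_free[OF h(1)] by auto
      show "w \<in> A \<inter> B" "\<sigma> w = \<tau> w" "y \<in> A \<inter> B" using w \<tau> that by auto
    qed (rule h)
    then have "continuous_map (top_of_set (A \<union> B)) S (\<lambda>y. if y \<in> A then \<sigma> y else \<tau> y)"
      using \<sigma> \<tau> h by (intro continuous_map_paste_closed) (auto simp: is_sec_def)
    then have "is_sec (A \<union> B) (\<lambda>y. if y \<in> A then \<sigma> y else \<tau> y)"
      using \<sigma> \<tau> unfolding is_sec_def by auto
    then show ?thesis using \<sigma> h by (intro exI[of _ "\<lambda>y. if y \<in> A then \<sigma> y else \<tau> y"]) auto
  qed
  have "\<exists>\<sigma>. is_sec (A \<union> B) \<sigma> \<and> \<sigma> z = x" if "z \<in> A \<union> B" "x \<in> fib z" for z x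
  proof (cases "z \<in> A")
    case True
    then show ?thesis using half[of A B z x] assms that by blast
  next
    case False
    then have "z \<in> B" using that by blast
    then show ?thesis using half[of B A z x] assms that(2) unfolding Int_commute[of B A] Un_commute[of B A] by blast
  qed
  moreover have "(A \<union> B) \<inter> gauss = {}" using good_free[OF assms(1)] good_free[OF assms(2)] by auto
  ultimately show ?thesis by (intro goodI)
qed

end

section \<open>Rectangles and strips along a lattice direction\<close>

definition wedge :: "complex \<Rightarrow> complex \<Rightarrow> real" where
  "wedge e z = Re e * Im z - Im e * Re z"

text \<open>The coordinate along e in units of e, complementing the height \<open>wedge e\<close>.
  Heights of lattice points over a lattice direction are integers, so an open strip between
  consecutive integral heights contains none of them.\<close>

definition cs :: "complex \<Rightarrow> complex \<Rightarrow> real" where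
  "cs e z = (Re e * Re z + Im e * Im z) / (cmod e)\<^sup>2"

definition rect_pt :: "complex \<Rightarrow> real \<Rightarrow> real \<Rightarrow> complex" where
  "rect_pt e r s = of_real (r / (cmod e)\<^sup>2) * (\<i> * e) + of_real s * e"

definition rect :: "complex \<Rightarrow> real \<Rightarrow> real \<Rightarrow> real \<Rightarrow> real \<Rightarrow> complex set" where
  "rect e a b c d = {z. a \<le> wedge e z \<and> wedge e z \<le> b \<and> c \<le> cs e z \<and> cs e z \<le> d}"

lemma wedge_linear: "linear (wedge e)"
  by (rule linearI) (auto simp: wedge_def algebra_simps)

lemma cs_linear: "linear (cs e)"
  by (rule linearI) (auto simp: cs_def algebra_simps add_divide_distrib)

lemma wedge_add: "wedge e (z + w) = wedge e z + wedge e w"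
  and wedge_scale: "wedge e (of_real t * z) = t * wedge e z"
  and wedge_self [simp]: "wedge e e = 0"
  by (auto simp: wedge_def algebra_simps)

lemma continuous_wedge: "continuous_on A (wedge e)"
  and continuous_cs: "continuous_on A (cs e)"
  by (simp_all add: linear_continuous_on linear_conv_bounded_linear[symmetric] wedge_linear cs_linear)

lemma rect_pt_coords:
  assumes "e \<noteq> 0"
  shows "wedge e (rect_pt e r s) = r" "cs e (rect_pt e r s) = s"
proof -
  have n: "(cmod e)\<^sup>2 \<noteq> 0" using assms by simp
  have n': "(cmod e)\<^sup>2 = Re e * Re e + Im e * Im e"
    using cmod_power2[of e] by (simp only: power2_eq_square[of "Re e"] power2_eq_square[of "Im e"])
  have "wedge e (rect_pt e r s) = r / (cmod e)\<^sup>2 * (Re e * Re e + Im e * Im e)"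
    by (simp add: wedge_def rect_pt_def algebra_simps)
  then show "wedge e (rect_pt e r s) = r" using n by (simp flip: n')
  have "cs e (rect_pt e r s) = s * (Re e * Re e + Im e * Im e) / (cmod e)\<^sup>2"
    by (simp add: cs_def rect_pt_def algebra_simps)
  then show "cs e (rect_pt e r s) = s" using n by (simp flip: n')
qed

lemma rect_pt_inverse:
  assumes "e \<noteq> 0"
  shows "rect_pt e (wedge e z) (cs e z) = z"
proof -
  define n where "n = (cmod e)\<^sup>2"
  have n: "n \<noteq> 0" using assms by (simp add: n_def)
  have n2: "n = Re e * Re e + Im e * Im e"
    unfolding n_def using cmod_power2[of e] by (simp only: power2_eq_square[of "Re e"] power2_eq_square[of "Im e"])
  define W C where "W = wedge e z" and "C = Re e * Re z + Im e * Im z"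
  have "n * Re (rect_pt e (wedge e z) (cs e z)) = - W * Im e + C * Re e"
    unfolding rect_pt_def cs_def n_def[symmetric] W_def[symmetric] C_def[symmetric]
    using n by (simp add: field_simps)
  also have "\<dots> = n * Re z" unfolding n2 W_def C_def wedge_def by (simp add: algebra_simps)
  finally have re: "n * Re (rect_pt e (wedge e z) (cs e z)) = n * Re z" .
  have "n * Im (rect_pt e (wedge e z) (cs e z)) = W * Re e + C * Im e"
    unfolding rect_pt_def cs_def n_def[symmetric] W_def[symmetric] C_def[symmetric]
    using n by (simp add: field_simps)
  also have "\<dots> = n * Im z" unfolding n2 W_def C_def wedge_def by (simp add: algebra_simps)
  finally show ?thesis using re n by (simp add: complex_eq_iff)
qed

lemma rect_convex: "convex (rect e a b c d)"
proof -
  have "rect e a b c d = wedge e -` {a..b} \<inter> cs e -` {c..d}" by (auto simp: rect_def)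
  then show ?thesis using convex_linear_vimage[OF wedge_linear] convex_linear_vimage[OF cs_linear]
    by (simp add: convex_Int)
qed

lemma rect_closed: "closed (rect e a b c d)"
proof -
  have "rect e a b c d = wedge e -` {a..b} \<inter> cs e -` {c..d}" by (auto simp: rect_def)
  then show ?thesis
    using continuous_wedge[of UNIV e] continuous_cs[of UNIV e]
    by (simp add: closed_Int closed_vimage)
qed

lemma rect_nonempty: "e \<noteq> 0 \<Longrightarrow> a \<le> b \<Longrightarrow> c \<le> d \<Longrightarrow> rect e a b c d \<noteq> {}"
proof -
  assume "e \<noteq> 0" "a \<le> b" "c \<le> d"
  then have "rect_pt e a c \<in> rect e a b c d" using rect_pt_coords[of e a c] by (simp add: rect_def)
  then show ?thesis by blast
qed

lemma rect_near:
  assumes "e \<noteq> 0"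
  shows "dist (rect_pt e r s) z \<le> \<bar>wedge e z - r\<bar> / cmod e + \<bar>cs e z - s\<bar> * cmod e"
proof -
  have "z - rect_pt e r s = rect_pt e (wedge e z) (cs e z) - rect_pt e r s" using rect_pt_inverse[OF assms] by simp
  also have "\<dots> = of_real ((wedge e z - r) / (cmod e)\<^sup>2) * (\<i> * e) + of_real (cs e z - s) * e"
    by (simp add: rect_pt_def algebra_simps diff_divide_distrib)
  finally have "cmod (z - rect_pt e r s) \<le> cmod (of_real ((wedge e z - r) / (cmod e)\<^sup>2) * (\<i> * e)) + cmod (of_real (cs e z - s) * e)"
    by (simp only: norm_triangle_ineq)
  also have "\<dots> = \<bar>wedge e z - r\<bar> / cmod e + \<bar>cs e z - s\<bar> * cmod e"
    using assms by (simp add: norm_mult norm_divide norm_of_real power2_eq_square del: of_real_diff of_real_divide)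
  finally show ?thesis by (simp add: dist_norm norm_minus_commute)
qed

context torus_cover
begin

text \<open>A segment free of lattice points is thickened: short pieces lie in good balls, and
  \<open>Bolzano\<close> subdivision glues them, adjacent pieces meeting in a rectangle of zero
  width. \<open>rect_good\<close> then stacks the thin rectangles in the same way.\<close>

lemma rect_good_thin:
  assumes e: "e \<noteq> 0" and "c \<le> d" and free: "\<And>s. c \<le> s \<Longrightarrow> s \<le> d \<Longrightarrow> rect_pt e r s \<notin> gauss"
  shows "\<exists>\<delta>>0. good (rect e (r - \<delta>) (r + \<delta>) c d)"
  using \<open>c \<le> d\<close>
proof (induction rule: Bolzano)
  case (trans a b c)
  then obtain \<delta>1 \<delta>2 where d: "\<delta>1 > 0" "\<delta>2 > 0" "good (rect e (r - \<delta>1) (r + \<delta>1) a b)" "good (rect e (r - \<delta>2) (r + \<delta>2) b c)" by blast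
  define \<delta> where "\<delta> = min \<delta>1 \<delta>2"
  have \<delta>0: "r - \<delta> \<le> r + \<delta>" using d unfolding \<delta>_def by linarith
  have u: "rect e (r - \<delta>) (r + \<delta>) a c = rect e (r - \<delta>) (r + \<delta>) a b \<union> rect e (r - \<delta>) (r + \<delta>) b c"
    using trans(3,4) by (auto simp: rect_def)
  have i: "rect e (r - \<delta>) (r + \<delta>) a b \<inter> rect e (r - \<delta>) (r + \<delta>) b c = rect e (r - \<delta>) (r + \<delta>) b b"
    using trans(3,4) by (auto simp: rect_def)
  have "good (rect e (r - \<delta>) (r + \<delta>) a c)" unfolding u
  proof (rule good_glue)
    show "good (rect e (r - \<delta>) (r + \<delta>) a b)" by (rule good_subset[OF d(3)]) (auto simp: rect_def \<delta>_def)
    show "good (rect e (r - \<delta>) (r + \<delta>) b c)" by (rule good_subset[OF d(4)]) (auto simp: rect_def \<delta>_def)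
  qed (unfold i, use rect_nonempty[OF e \<delta>0 order_refl, of b] in \<open>simp_all add: rect_closed convex_connected rect_convex\<close>)
  then show ?case using d by (intro exI[of _ \<delta>]) (auto simp: \<delta>_def)
next
  case (local s)
  obtain \<eta> where \<eta>: "\<eta> > 0" "good (ball (rect_pt e r s) \<eta>)" using good_ball free local by blast
  define m where "m = 1 / cmod e + cmod e"
  have m: "m > 0" using e by (auto simp: m_def intro: add_pos_pos)
  define d where "d = \<eta> / (2 * m)"
  have d: "d > 0" using \<eta> m by (simp add: d_def)
  have dm: "d / cmod e + d * cmod e < \<eta>"
  proof -
    have "d / cmod e + d * cmod e = d * m" by (simp add: m_def algebra_simps)
    also have "\<dots> = \<eta> / 2" using m by (simp add: d_def)
    finally show ?thesis using \<eta> by simp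
  qed
  show ?case
  proof (rule exI[of _ d], intro conjI allI impI)
    fix a b assume ab: "a \<le> s \<and> s \<le> b \<and> b - a < d"
    have "rect e (r - d) (r + d) a b \<subseteq> ball (rect_pt e r s) \<eta>"
    proof
      fix z assume z: "z \<in> rect e (r - d) (r + d) a b"
      then have "\<bar>wedge e z - r\<bar> \<le> d" "\<bar>cs e z - s\<bar> \<le> d" using ab by (auto simp: rect_def)
      then have "\<bar>wedge e z - r\<bar> / cmod e + \<bar>cs e z - s\<bar> * cmod e \<le> d / cmod e + d * cmod e"
        by (intro add_mono divide_right_mono mult_right_mono) auto
      then show "z \<in> ball (rect_pt e r s) \<eta>" using rect_near[OF e, of r s z] dm by simp
    qed
    then have "good (rect e (r - d) (r + d) a b)" by (rule good_subset[OF \<eta>(2)])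
    then show "\<exists>\<delta>>0. good (rect e (r - \<delta>) (r + \<delta>) a b)" using d by blast
  qed (rule d)
qed

lemma rect_good:
  assumes e: "e \<noteq> 0" and "a \<le> b" "c \<le> d" and free: "rect e a b c d \<inter> gauss = {}"
  shows "good (rect e a b c d)"
  using \<open>a \<le> b\<close>
proof (induction rule: Bolzano)
  case (trans x y z)
  have u: "rect e x z c d = rect e x y c d \<union> rect e y z c d"
    using trans(3,4) by (auto simp: rect_def)
  have i: "rect e x y c d \<inter> rect e y z c d = rect e y y c d"
    using trans(3,4) by (auto simp: rect_def)
  show ?case unfolding u
    by (rule good_glue)
       (unfold i, use trans rect_nonempty[OF e order_refl \<open>c \<le> d\<close>, of y] in \<open>simp_all add: rect_closed convex_connected rect_convex\<close>)
next
  case (local r)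
  have "rect_pt e r s \<notin> gauss" if "c \<le> s" "s \<le> d" for s
  proof -
    have "rect_pt e r s \<in> rect e a b c d" using local that rect_pt_coords[OF e, of r s] by (auto simp: rect_def)
    then show ?thesis using free by blast
  qed
  from rect_good_thin[OF e \<open>c \<le> d\<close> this] obtain \<delta> where \<delta>: "\<delta> > 0" "good (rect e (r - \<delta>) (r + \<delta>) c d)" by blast
  have "good (rect e x y c d)" if "x \<le> r \<and> r \<le> y \<and> y - x < \<delta>" for x y
    by (rule good_subset[OF \<delta>(2)]) (use that in \<open>auto simp: rect_def\<close>)
  then show ?case using \<delta> by blast
qed

definition strip :: "complex \<Rightarrow> int \<Rightarrow> complex set" where
  "strip e j = {z. of_int j < wedge e z \<and> wedge e z < of_int j + 1}"

lemma wedge_gauss: "e \<in> gauss \<Longrightarrow> z \<in> gauss \<Longrightarrow> wedge e z \<in> \<int>"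
  by (auto simp: gauss_def wedge_def)

lemma strip_free:
  assumes "e \<in> gauss" shows "strip e j \<inter> gauss = {}"
proof -
  have False if z: "z \<in> gauss" "z \<in> strip e j" for z
  proof -
    obtain n where "wedge e z = of_int n" using wedge_gauss[OF assms z(1)] by (elim Ints_cases)
    then have "of_int j < (of_int n :: real)" "of_int n < (of_int (j + 1) :: real)" using z(2) by (simp_all add: strip_def)
    then show False unfolding of_int_less_iff by linarith
  qed
  then show ?thesis by blast
qed

lemma strip_connected: "connected (strip e j)"
proof -
  have "strip e j = wedge e -` {of_int j<..<of_int j + 1}" by (auto simp: strip_def)
  then show ?thesis using convex_connected convex_linear_vimage[OF wedge_linear, of "{of_int j<..<of_int j + 1}" e] by simp
qed

text \<open>The strip is exhausted by compact rectangles \<open>R n\<close>, whose sections through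
  a fixed point extend each other by uniqueness. The open cores \<open>T n\<close> still cover the
  strip and permit pasting on open sets.\<close>

lemma strip_good:
  assumes e: "e \<in> gauss" "e \<noteq> 0"
  shows "good (strip e j)"
proof -
  define w where "w n = 1 / real (Suc (Suc n))" for n :: nat
  have w: "0 < w n" "w n \<le> 1/2" for n by (auto simp: w_def field_simps)
  have w_mono: "w n \<le> w m" if "m \<le> n" for m n using that by (auto simp: w_def intro!: divide_left_mono)
  define R where "R n = rect e (of_int j + w n) (of_int j + 1 - w n) (- real n) (real n)" for n
  define T where "T n = {z. of_int j + w n < wedge e z \<and> wedge e z < of_int j + 1 - w n \<and> - real n < cs e z \<and> cs e z < real n}" for n
  have TR: "T n \<subseteq> R n" for n by (auto simp: T_def R_def rect_def)
  have RS: "R n \<subseteq> strip e j" for n using w[of n] by (auto simp: R_def rect_def strip_def)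
  have Rmono: "R m \<subseteq> R n" if "m \<le> n" for m n using w_mono[OF that] that by (auto simp: R_def rect_def)
  have Rgood: "good (R n)" for n
    unfolding R_def using w[of n] RS[of n] strip_free[OF e(1), of j] by (intro rect_good e) (auto simp: R_def)
  have Rconn: "connected (R n)" for n unfolding R_def by (intro convex_connected rect_convex)
  have Topen: "open (T n)" for n
  proof -
    have "T n = wedge e -` {of_int j + w n<..<of_int j + 1 - w n} \<inter> cs e -` {- real n<..<real n}" by (auto simp: T_def)
    then show ?thesis using continuous_wedge[of UNIV e] continuous_cs[of UNIV e] by (simp add: open_Int open_vimage)
  qed
  have Tcover: "\<exists>n\<ge>m. z \<in> T n" if z: "z \<in> strip e j" for z m
  proof -
    define \<mu> where "\<mu> = min (wedge e z - of_int j) (of_int j + 1 - wedge e z)"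
    have "\<mu> > 0" using z by (auto simp: \<mu>_def strip_def)
    then obtain n1 where n1: "1 / real (Suc n1) < \<mu>" using nat_approx_posE by blast
    obtain n2 where n2: "\<bar>cs e z\<bar> < real n2" using reals_Archimedean2 by blast
    define n where "n = max m (max n1 n2)"
    have "w n \<le> 1 / real (Suc n1)" unfolding w_def by (intro divide_left_mono) (auto simp: n_def)
    then have "w n < \<mu>" using n1 by simp
    moreover have "\<bar>cs e z\<bar> < real n" using n2 by (simp add: n_def)
    ultimately have "z \<in> T n" by (auto simp: T_def \<mu>_def abs_less_iff)
    then show ?thesis by (intro exI[of _ n]) (simp add: n_def)
  qed
  have "\<exists>\<sigma>. is_sec (strip e j) \<sigma> \<and> \<sigma> z = x" if z: "z \<in> strip e j" "x \<in> fib z" for z x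
  proof -
    obtain n0 where n0: "z \<in> T n0" using Tcover[OF z(1)] by blast
    have zR: "z \<in> R n" if "n \<ge> n0" for n using n0 TR Rmono that by blast
    have "\<exists>\<sigma>. n \<ge> n0 \<longrightarrow> is_sec (R n) \<sigma> \<and> \<sigma> z = x" for n
    proof (cases "n \<ge> n0")
      case True
      obtain \<sigma> where "is_sec (R n) \<sigma>" "\<sigma> z = x" by (rule goodD[OF Rgood zR[OF True] z(2)])
      then show ?thesis by blast
    qed blast
    then obtain \<sigma> where \<sigma>: "\<And>n. n \<ge> n0 \<Longrightarrow> is_sec (R n) (\<sigma> n) \<and> \<sigma> n z = x" by metis
    have agree: "\<sigma> n y = \<sigma> m y" if "n0 \<le> n" "n \<le> m" "y \<in> R n" for n m y
    proof (rule is_sec_unique[OF _ _ Rconn[of n]])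
      show "is_sec (R n) (\<sigma> n)" using \<sigma> that by blast
      have "is_sec (R m) (\<sigma> m)" using \<sigma>[of m] that by simp
      then show "is_sec (R n) (\<sigma> m)" by (rule is_sec_subset) (rule Rmono[OF that(2)])
      show "R n \<inter> gauss = {}" using RS strip_free[OF e(1)] by blast
      show "z \<in> R n" using zR that by blast
      show "\<sigma> n z = \<sigma> m z" using \<sigma>[of n] \<sigma>[of m] that by simp
    qed (rule that)
    define N where "N y = (SOME n. n \<ge> n0 \<and> y \<in> T n)" for y
    have N: "N y \<ge> n0" "y \<in> T (N y)" if "y \<in> strip e j" for y
      using someI_ex[of "\<lambda>n. n \<ge> n0 \<and> y \<in> T n"] Tcover[OF that, of n0] unfolding N_def by auto
    define \<tau> where "\<tau> y = \<sigma> (N y) y" for y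
    have ag: "\<tau> y = \<sigma> n y" if "y \<in> strip e j" "n \<ge> n0" "y \<in> T n" for y n
    proof (cases "n \<le> N y")
      case True
      have "y \<in> R n" using that TR by blast
      then show ?thesis using agree[of n "N y" y] that True by (simp add: \<tau>_def)
    next
      case False
      have "y \<in> R (N y)" using N[OF that(1)] TR by blast
      then show ?thesis using agree[of "N y" n y] N[OF that(1)] False by (simp add: \<tau>_def)
    qed
    have "continuous_map (top_of_set (strip e j)) S \<tau>"
    proof (rule pasting_lemma[where I = "{n0..}" and T = "\<lambda>n. strip e j \<inter> T n" and f = \<sigma>])
      fix n assume n: "n \<in> {n0..}"
      show "openin (top_of_set (strip e j)) (strip e j \<inter> T n)" using Topen by (simp add: openin_open_Int)
      have "continuous_map (top_of_set (R n)) S (\<sigma> n)" using \<sigma> n by (auto simp: is_sec_def)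
      then have "continuous_map (top_of_set (strip e j \<inter> T n)) S (\<sigma> n)"
        by (rule continuous_map_from_subtopology_mono) (use TR in blast)
      then show "continuous_map (subtopology (top_of_set (strip e j)) (strip e j \<inter> T n)) S (\<sigma> n)"
        by (simp add: subtopology_subtopology)
    next
      fix n m y assume "n \<in> {n0..}" "m \<in> {n0..}" "y \<in> topspace (top_of_set (strip e j)) \<inter> (strip e j \<inter> T n) \<inter> (strip e j \<inter> T m)"
      then show "\<sigma> n y = \<sigma> m y" using ag[of y n] ag[of y m] by auto
    next
      fix y assume "y \<in> topspace (top_of_set (strip e j))"
      then show "\<exists>n. n \<in> {n0..} \<and> y \<in> strip e j \<inter> T n \<and> \<tau> y = \<sigma> n y"
        using N[of y] by (intro exI[of _ "N y"]) (auto simp: \<tau>_def)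
    qed
    moreover have "p (\<tau> y) = torus_proj y" if "y \<in> strip e j" for y
      using \<sigma>[OF N(1)[OF that]] N(2)[OF that] TR unfolding is_sec_def \<tau>_def by blast
    moreover have "\<tau> z = x" using \<sigma>[OF N(1)[OF z(1)]] by (simp add: \<tau>_def)
    ultimately show ?thesis unfolding is_sec_def by blast
  qed
  then show ?thesis by (intro goodI strip_free[OF e(1)])
qed

end

section \<open>Fibres, periodicity along strips and confinement of lifts\<close>

context torus_cover
begin

lemma fib_closed: "closedin S (fib z)"
proof -
  have "closedin S {x \<in> topspace S. p x \<in> {torus_proj z}}"
    by (rule closedin_continuous_map_preimage[OF p_continuous]) simp
  then show ?thesis by (simp add: fib_def)
qed

lemma fib_finite: "finite (fib z)"
proof (cases "z \<in> gauss")
  case True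
  then show ?thesis using fin0 torus_proj_eq_0_iff[of z] by (simp add: fib_def)
next
  case False
  have nS: "x \<notin> Sg" if "x \<in> fib z" for x using not_Sg[of x z] that False by (simp add: fib_def)
  have "\<exists>U. openin S U \<and> x \<in> U \<and> U \<inter> fib z \<subseteq> {x}" if x: "x \<in> fib z" for x
  proof -
    obtain U where "openin S U" "x \<in> U" "inj_on p U" using locinj[of x] nS x by (auto simp: fib_def)
    then show ?thesis using x by (intro exI[of _ U]) (auto simp: fib_def inj_on_def)
  qed
  then show ?thesis by (rule finite_of_isolated[OF comp fib_closed])
qed

lemma card_fib_le:
  assumes D: "good D" "connected D" and zw: "z \<in> D" "w \<in> D"
  shows "card (fib z) \<le> card (fib w)"
proof -
  have "\<exists>\<sigma>. is_sec D \<sigma> \<and> \<sigma> z = x" if "x \<in> fib z" for x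
    using goodD[OF D(1) zw(1) that] by metis
  then obtain \<sigma> where \<sigma>: "\<And>x. x \<in> fib z \<Longrightarrow> is_sec D (\<sigma> x) \<and> \<sigma> x z = x" by metis
  have "inj_on (\<lambda>x. \<sigma> x w) (fib z)"
  proof (rule inj_onI)
    fix x y assume xy: "x \<in> fib z" "y \<in> fib z" "\<sigma> x w = \<sigma> y w"
    have "\<sigma> x z = \<sigma> y z"
      by (rule is_sec_unique[of D "\<sigma> x" "\<sigma> y" w z]) (use \<sigma> xy D zw good_free[OF D(1)] in simp_all)
    then show "x = y" using \<sigma> xy by metis
  qed
  moreover have "(\<lambda>x. \<sigma> x w) ` fib z \<subseteq> fib w"
  proof
    fix y assume "y \<in> (\<lambda>x. \<sigma> x w) ` fib z"
    then obtain x where x: "x \<in> fib z" "y = \<sigma> x w" by blast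
    then show "y \<in> fib w" using \<sigma>[OF x(1)] is_sec_topspace[of D "\<sigma> x" w] zw by (simp add: fib_def is_sec_def)
  qed
  ultimately show ?thesis using card_inj_on_le fib_finite by blast
qed

text \<open>The cardinality is locally constant off the lattice, since sections over a good ball
  inject one fibre into another. The complement of the countable lattice in the plane is
  connected.\<close>

lemma card_fib_const:
  assumes "z \<notin> gauss" "w \<notin> gauss"
  shows "card (fib z) = card (fib w)"
proof -
  have "connected (UNIV - gauss)"
    by (rule connected_open_diff_countable) (use countable_gauss in auto)
  then have c: "connected (- gauss)" by (simp add: Compl_eq_Diff_UNIV)
  show ?thesis
  proof (rule connected_local_const[OF c])
    show "\<forall>a\<in>- gauss. \<forall>\<^sub>F b in at a within - gauss. card (fib a) = card (fib b)"
    proof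
      fix a assume "a \<in> - gauss"
      then obtain \<delta> where \<delta>: "\<delta> > 0" "good (ball a \<delta>)" using good_ball by auto
      have "card (fib a) = card (fib b)" if "b \<in> ball a \<delta>" for b
        using card_fib_le[OF \<delta>(2), of a b] card_fib_le[OF \<delta>(2), of b a] that \<delta>(1) by (simp add: connected_ball)
      moreover have "\<forall>\<^sub>F b in at a within - gauss. b \<in> ball a \<delta>"
        unfolding eventually_at_topological using \<delta>(1) by (intro exI[of _ "ball a \<delta>"]) auto
      ultimately show "\<forall>\<^sub>F b in at a within - gauss. card (fib a) = card (fib b)"
        by (auto elim: eventually_mono)
    qed
  qed (use assms in auto)
qed

text \<open>The number of squares; by \<open>card_fib\<close> any base point off the lattice gives
  the same value.\<close>

definition sheets :: nat where "sheets = card (fib (Complex (1/2) 0))"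

lemma card_fib:
  assumes "z \<notin> gauss" shows "card (fib z) = sheets"
proof -
  have "(1/2::real) \<notin> \<int>"
  proof
    assume "(1/2::real) \<in> \<int>"
    then obtain n where "(1/2::real) = of_int n" by (elim Ints_cases)
    then have "(1::real) = of_int (2 * n)" by simp
    then have "1 = 2 * n" by linarith
    then show False by presburger
  qed
  then have "Complex (1/2) 0 \<notin> gauss" by (simp add: gauss_def)
  then show ?thesis unfolding sheets_def using card_fib_const assms by blast
qed

lemma wedge_shift: "wedge e (z + of_real t * e) = wedge e z"
  by (simp add: wedge_add wedge_scale)

text \<open>Among the \<open>N + 1\<close> points over \<open>z\<close> that a section visits on translating \<open>N\<close> times, two coincide.\<close>

lemma strip_periodic:
  assumes e: "e \<in> gauss" "e \<noteq> 0" and \<sigma>: "is_sec (strip e j) \<sigma>" and z: "z \<in> strip e j"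
  shows "\<sigma> (z + of_int (l * fact sheets) * e) = \<sigma> z"
proof -
  let ?D = "strip e j"
  have sh: "y + of_int n * e \<in> ?D \<longleftrightarrow> y \<in> ?D" for y n
    using wedge_shift[of e y "of_int n"] by (simp add: strip_def)
  have sec: "is_sec ?D (\<lambda>y. \<sigma> (y + of_int n * e))" for n
  proof -
    have "continuous_map (top_of_set ?D) (top_of_set ?D) (\<lambda>y. y + of_int n * e)"
      using sh by (auto simp: continuous_map_in_subtopology intro!: continuous_intros)
    then have "continuous_map (top_of_set ?D) S (\<sigma> \<circ> (\<lambda>y. y + of_int n * e))"
      using \<sigma> by (intro continuous_map_compose[of _ "top_of_set ?D"]) (auto simp: is_sec_def)
    moreover have "p (\<sigma> (y + of_int n * e)) = torus_proj y" if "y \<in> ?D" for y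
      using \<sigma> that sh[of y n] torus_proj_add_gauss[OF gauss_of_int_mult[OF e(1)]] by (simp add: is_sec_def)
    ultimately show ?thesis by (simp add: is_sec_def comp_def)
  qed
  define h where "h n = \<sigma> (z + of_int (int n) * e)" for n :: nat
  have zg: "z \<notin> gauss" using z strip_free[OF e(1)] by blast
  have "h ` {0..sheets} \<subseteq> fib z"
  proof
    fix x assume "x \<in> h ` {0..sheets}"
    then obtain n where n: "x = h n" by blast
    show "x \<in> fib z" using sec[of "int n"] z is_sec_topspace[OF \<sigma>, of "z + of_int (int n) * e"] sh[of z "int n"]
      by (simp add: fib_def n h_def is_sec_def)
  qed
  then have "card (h ` {0..sheets}) \<le> sheets" using card_mono[OF fib_finite] card_fib[OF zg] by metis
  then have "\<not> inj_on h {0..sheets}" using card_image[of h "{0..sheets}"] by auto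
  then obtain a b where "a \<in> {0..sheets}" "b \<in> {0..sheets}" "a \<noteq> b" "h a = h b" by (auto simp: inj_on_def)
  then obtain a b where ab: "a < b" "b \<le> sheets" "h a = h b" by (metis atLeastAtMost_iff linorder_neqE_nat)
  have eq: "\<sigma> (y + of_int (int a) * e) = \<sigma> (y + of_int (int b) * e)" if "y \<in> ?D" for y
    by (rule is_sec_unique[OF sec sec strip_connected strip_free[OF e(1)] z _ that]) (use ab in \<open>simp add: h_def\<close>)
  define d where "d = int b - int a"
  have step: "\<sigma> (y + of_int d * e) = \<sigma> y" if "y \<in> ?D" for y
    using eq[of "y + of_int (- int a) * e"] sh[of y "- int a"] that by (simp add: d_def algebra_simps)
  have step_nat: "\<sigma> (y + of_int (int n * d) * e) = \<sigma> y" if "y \<in> ?D" for y n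
  proof (induction n)
    case (Suc n)
    have "\<sigma> (y + of_int (int n * d) * e + of_int d * e) = \<sigma> (y + of_int (int n * d) * e)"
      by (rule step) (use sh[of y "int n * d"] that in blast)
    then show ?case using Suc by (simp add: algebra_simps)
  qed simp
  have step_int: "\<sigma> (y + of_int (m * d) * e) = \<sigma> y" if "y \<in> ?D" for y m
  proof (cases "m \<ge> 0")
    case True
    then show ?thesis using step_nat[OF that, of "nat m"] by simp
  next
    case False
    have "\<sigma> (y + of_int (m * d) * e + of_int (int (nat (- m)) * d) * e) = \<sigma> (y + of_int (m * d) * e)"
      by (rule step_nat) (use sh[of y "m * d"] that in blast)
    moreover have "of_int (m * d) * e + of_int (int (nat (- m)) * d) * e = 0"
      using False by (simp flip: distrib_right of_int_add)
    ultimately show ?thesis by (simp add: add.assoc)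
  qed
  \<comment> \<open>The period d depends on the strip and the section, but it is at least 1 and at
    most \<open>sheets\<close>; the factorial is a common multiple that serves all strips and
    directions.\<close>
  have "d dvd fact sheets"
  proof -
    have "b - a dvd fact sheets" using ab by (intro dvd_fact) auto
    then have "int (b - a) dvd int (fact sheets)" by (simp only: int_dvd_int_iff)
    then show ?thesis using ab by (simp add: d_def of_nat_diff)
  qed
  then obtain m where "fact sheets = d * m" by (rule dvdE)
  then show ?thesis using step_int[OF z, of "l * m"] by (simp add: mult_ac)
qed

text \<open>A lift leaving \<open>W1\<close> would meet the complement \<open>F\<close> of two open sets that separate \<open>x0\<close> from the
  rest of its fibre, and the compact set \<open>p ` F\<close> does not contain the image of \<open>z0\<close>.\<close>

lemma confinement:
  assumes x0: "x0 \<in> fib z0" and W: "openin S W" "x0 \<in> W"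
  obtains W1 \<delta> where "openin S W1" "x0 \<in> W1" "W1 \<subseteq> W" "\<delta> > 0"
    "\<And>C \<sigma> c. connected C \<Longrightarrow> C \<subseteq> ball z0 \<delta> \<Longrightarrow> is_sec C \<sigma> \<Longrightarrow> c \<in> C \<Longrightarrow> \<sigma> c \<in> W1 \<Longrightarrow> \<sigma> ` C \<subseteq> W1"
    "\<And>y. y \<in> fib z0 \<Longrightarrow> y \<noteq> x0 \<Longrightarrow> \<exists>V. openin S V \<and> y \<in> V \<and> disjnt V W1"
proof -
  have "closedin S (fib z0 - {x0})"
    by (rule closedin_Hausdorff_finite[OF haus]) (use fib_finite in \<open>auto simp: fib_def\<close>)
  moreover have "closedin S (topspace S - W)" using W by blast
  ultimately have cl: "closedin S ((topspace S - W) \<union> (fib z0 - {x0}))" by (intro closedin_Un)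
  have "regular_space S" using comp haus compact_Hausdorff_imp_regular_space by blast
  moreover define B where "B = (topspace S - W) \<union> (fib z0 - {x0})"
  moreover have "x0 \<in> topspace S - B" using x0 W by (auto simp: fib_def B_def)
  ultimately have "\<exists>W1 V. openin S W1 \<and> openin S V \<and> x0 \<in> W1 \<and> B \<subseteq> V \<and> disjnt W1 V"
    using cl unfolding regular_space_def by blast
  then obtain W1 V where V: "openin S W1" "openin S V" "x0 \<in> W1" "(topspace S - W) \<union> (fib z0 - {x0}) \<subseteq> V" "disjnt W1 V"
    unfolding B_def by blast
  define F where "F = topspace S - W1 - V"
  have "closedin S F" unfolding F_def using V by (simp add: closedin_diff)
  then have "compactin S F" using comp by (intro closedin_compact_space)
  then have "compact (p ` F)" using image_compactin[OF _ p_continuous] by (simp add: compactin_euclidean_iff)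
  then have "closed (p ` F)" by (rule compact_imp_closed)
  then have "open (torus_proj -` (- p ` F))" using continuous_torus_proj by (intro open_vimage open_Compl)
  moreover have "z0 \<in> torus_proj -` (- p ` F)"
  proof -
    have "x \<in> fib z0 \<Longrightarrow> x \<notin> F" for x using V(3,4) by (auto simp: F_def)
    then show ?thesis by (force simp: fib_def F_def)
  qed
  ultimately obtain \<delta> where \<delta>: "\<delta> > 0" "ball z0 \<delta> \<subseteq> torus_proj -` (- p ` F)" by (meson open_contains_ball)
  show ?thesis
  proof (rule that[of W1 \<delta>])
    show "openin S W1" "x0 \<in> W1" "\<delta> > 0" using V \<delta> by auto
    show "W1 \<subseteq> W"
    proof
      fix x assume x: "x \<in> W1"
      then have "x \<in> topspace S" "x \<notin> V" using openin_subset[OF V(1)] V(5) by (auto simp: disjnt_iff)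
      then show "x \<in> W" using V(4) by blast
    qed
    show "\<exists>V. openin S V \<and> y \<in> V \<and> disjnt V W1" if "y \<in> fib z0" "y \<noteq> x0" for y
      using V that by (intro exI[of _ V]) (auto simp: disjnt_sym)
  next
    fix C \<sigma> c assume C: "connected C" "C \<subseteq> ball z0 \<delta>" "is_sec C \<sigma>" "c \<in> C" "\<sigma> c \<in> W1"
    have "\<sigma> z \<in> W1 \<union> V" if "z \<in> C" for z
    proof (rule ccontr)
      assume "\<sigma> z \<notin> W1 \<union> V"
      then have "\<sigma> z \<in> F" using is_sec_topspace[OF C(3) that] by (simp add: F_def)
      moreover have "p (\<sigma> z) = torus_proj z" using C that by (simp add: is_sec_def)
      ultimately show False using \<delta>(2) C(2) that by force
    qed
    then have cov: "\<sigma> ` C \<subseteq> W1 \<union> V" by blast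
    have "connectedin S (\<sigma> ` C)"
      using connectedin_continuous_map_image[of "top_of_set C" S \<sigma> C] C by (simp add: is_sec_def connectedin_subtopology)
    moreover have "W1 \<inter> V \<inter> \<sigma> ` C = {}" using V(5) by (auto simp: disjnt_iff)
    ultimately have "W1 \<inter> \<sigma> ` C = {} \<or> V \<inter> \<sigma> ` C = {}"
      using cov V(1,2) unfolding connectedin by blast
    then show "\<sigma> ` C \<subseteq> W1" using C cov by blast
  qed
qed

text \<open>The topological counterpart of being the period of a saddle connection: a path over a
  straight segment. \<open>Hol_eq\<close> identifies the two notions, and twisting takes place on
  this one.\<close>

definition saddle_vec :: "complex \<Rightarrow> bool" where
  "saddle_vec v \<longleftrightarrow> v \<noteq> 0 \<and> (\<exists>\<gamma>. continuous_map (top_of_set {0..1::real}) S \<gamma> \<and> \<gamma> 0 \<in> Sg \<and> \<gamma> 1 \<in> Sg \<and>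
    (\<forall>t\<in>{0<..<1}. \<gamma> t \<notin> Sg) \<and> (\<forall>t\<in>{0..1}. p (\<gamma> t) = torus_proj (of_real t * v)))"

lemma saddle_vec_gauss: "saddle_vec v \<Longrightarrow> v \<in> gauss"
proof -
  assume "saddle_vec v"
  then obtain \<gamma> where "\<gamma> (1::real) \<in> Sg" "\<forall>t\<in>{0..1}. p (\<gamma> t) = torus_proj (of_real t * v)" unfolding saddle_vec_def by blast
  then have "torus_proj v = torus_proj 0" using Sg_p[of "\<gamma> 1"] by force
  then show ?thesis by (simp add: torus_proj_eq_0_iff)
qed

lemma saddle_vec_minus: "saddle_vec v \<Longrightarrow> saddle_vec (- v)"
proof -
  assume sv: "saddle_vec v"
  then obtain \<gamma> where \<gamma>: "continuous_map (top_of_set {0..1::real}) S \<gamma>" "\<gamma> 0 \<in> Sg" "\<gamma> 1 \<in> Sg"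
    "\<forall>t\<in>{0<..<1}. \<gamma> t \<notin> Sg" "\<forall>t\<in>{0..1}. p (\<gamma> t) = torus_proj (of_real t * v)" unfolding saddle_vec_def by blast
  have "continuous_map (top_of_set {0..1::real}) (top_of_set {0..1}) (\<lambda>t. 1 - t)"
    by (auto simp: continuous_map_in_subtopology intro!: continuous_intros)
  from continuous_map_compose[OF this \<gamma>(1)] have "continuous_map (top_of_set {0..1::real}) S (\<lambda>t. \<gamma> (1 - t))" by (simp add: comp_def)
  moreover have "p (\<gamma> (1 - t)) = torus_proj (of_real t * (- v))" if "t \<in> {0..1}" for t
  proof -
    have "p (\<gamma> (1 - t)) = torus_proj (of_real (1 - t) * v)" using \<gamma>(5) that by simp
    also have "of_real (1 - t) * v = of_real t * (- v) + v" by (simp add: algebra_simps)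
    also have "torus_proj \<dots> = torus_proj (of_real t * (- v))" by (rule torus_proj_add_gauss[OF saddle_vec_gauss[OF sv]])
    finally show ?thesis .
  qed
  moreover have "\<gamma> (1 - 0) \<in> Sg" "\<gamma> (1 - 1) \<in> Sg" "\<forall>t\<in>{0<..<1}. \<gamma> (1 - t) \<notin> Sg" using \<gamma> by auto
  ultimately show ?thesis using sv unfolding saddle_vec_def by (intro conjI exI[of _ "\<lambda>t. \<gamma> (1 - t)"] ballI) (auto simp del: mult_minus_right)
qed

end

lemma eventually_ball_of_continuous:
  fixes f :: "'b::topological_space \<Rightarrow> complex"
  assumes "continuous_on UNIV f" "f t0 = z" "0 < d"
  shows "\<forall>\<^sub>F u in at t0 within A. f u \<in> ball z d"
proof -
  have "open (f -` ball z d)" using assms(1) by (intro open_vimage) auto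
  moreover have "t0 \<in> f -` ball z d" using assms by simp
  ultimately show ?thesis unfolding eventually_at_topological by blast
qed

section \<open>Multitwists of saddle connections\<close>

context torus_cover
begin

text \<open>The new path is the image of \<open>\<gamma>\<close> under the multitwist in the direction \<open>e\<close>: on the strip
  \<open>j < wedge e z < j + 1\<close> a point at height \<open>h\<close> is moved by \<open>h - j\<close> times a common period of the cylinders.\<close>

lemma twist_pos:
  assumes \<gamma>: "continuous_map (top_of_set {0..1::real}) S \<gamma>"
    and \<gamma>p: "\<And>t. t \<in> {0..1} \<Longrightarrow> p (\<gamma> t) = torus_proj (of_real t * v)"
    and \<gamma>S: "\<gamma> 0 \<in> Sg" "\<gamma> 1 \<in> Sg" "\<And>t. t \<in> {0<..<1} \<Longrightarrow> \<gamma> t \<notin> Sg"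
    and e: "e \<in> gauss" "e \<noteq> 0" and v: "v \<in> gauss" and n: "wedge e v = real n" "0 < n"
  shows "\<exists>\<gamma>'. continuous_map (top_of_set {0..1::real}) S \<gamma>' \<and> \<gamma>' 0 \<in> Sg \<and> \<gamma>' 1 \<in> Sg \<and>
    (\<forall>t\<in>{0<..<1}. \<gamma>' t \<notin> Sg) \<and>
    (\<forall>t\<in>{0..1}. p (\<gamma>' t) = torus_proj (of_real t * (v + of_int (l * fact sheets * int n) * e)))"
proof -
  define kk where "kk = l * fact sheets"
  have wt: "wedge e (of_real t * v) = t * real n" for t by (simp add: wedge_scale n)
  have in_strip: "of_real t * v \<in> strip e j \<longleftrightarrow> of_int j < t * real n \<and> t * real n < of_int j + 1" for t j
    by (simp add: strip_def wt)
  \<comment> \<open>As \<open>wedge e v\<close> is positive, the height increases along the path and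
    each strip is crossed in a single interval, over which \<open>unique_lift\<close> identifies the
    path with a section. Over a strip that is not met any section serves as a placeholder.\<close>
  have "\<exists>\<sigma>. is_sec (strip e j) \<sigma> \<and> (\<forall>t. t \<in> {0..1} \<longrightarrow> of_real t * v \<in> strip e j \<longrightarrow> \<sigma> (of_real t * v) = \<gamma> t)" for j
  proof (cases "\<exists>t\<in>{0..1}. of_real t * v \<in> strip e j")
    case True
    then obtain t0 where t0: "t0 \<in> {0..1}" "of_real t0 * v \<in> strip e j" by blast
    have "\<gamma> t0 \<in> fib (of_real t0 * v)" using \<gamma> \<gamma>p t0 by (auto simp: fib_def continuous_map_def)
    then obtain \<sigma> where \<sigma>: "is_sec (strip e j) \<sigma>" "\<sigma> (of_real t0 * v) = \<gamma> t0" by (rule goodD[OF strip_good[OF e] t0(2)])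
    define D where "D = {t \<in> {0..1}. of_real t * v \<in> strip e j}"
    have "D = {0..1} \<inter> {of_int j / real n<..<(of_int j + 1) / real n}"
      unfolding D_def in_strip using n by (auto simp: field_simps)
    then have Dc: "connected D" by (simp add: convex_connected convex_Int)
    have "continuous_map (top_of_set D) (top_of_set (strip e j)) (\<lambda>t. of_real t * v)"
      by (auto simp: continuous_map_in_subtopology D_def intro!: continuous_intros)
    then have c\<sigma>: "continuous_map (top_of_set D) S (\<sigma> \<circ> (\<lambda>t. of_real t * v))"
      using \<sigma> by (intro continuous_map_compose[of _ "top_of_set (strip e j)"]) (auto simp: is_sec_def)
    have c\<gamma>: "continuous_map (top_of_set D) S \<gamma>"
      by (rule continuous_map_from_subtopology_mono[OF \<gamma>]) (auto simp: D_def)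
    have "(\<sigma> \<circ> (\<lambda>t. of_real t * v)) t = \<gamma> t" if t: "t \<in> D" for t
    proof (rule unique_lift[OF Dc c\<sigma> c\<gamma>])
      fix u assume u: "u \<in> D"
      then have u': "u \<in> {0..1}" "of_real u * v \<in> strip e j" by (auto simp: D_def)
      have "p (\<sigma> (of_real u * v)) = torus_proj (of_real u * v)" using \<sigma>(1) u' by (simp add: is_sec_def)
      then show "p ((\<sigma> \<circ> (\<lambda>t. of_real t * v)) u) = p (\<gamma> u)" "(\<sigma> \<circ> (\<lambda>t. of_real t * v)) u \<notin> Sg"
        using \<gamma>p[OF u'(1)] not_Sg[of "\<sigma> (of_real u * v)" "of_real u * v"] strip_free[OF e(1), of j] u'(2) by auto
    qed (use t0 \<sigma> t in \<open>auto simp: D_def\<close>)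
    then show ?thesis using \<sigma>(1) by (intro exI[of _ \<sigma>]) (auto simp: D_def)
  next
    case False
    obtain x where "x \<in> Sg" using Sg_ne by blast
    define z0 where "z0 = rect_pt e (of_int j + 1/2) 0"
    have z0: "z0 \<in> strip e j" using rect_pt_coords[OF e(2)] by (simp add: z0_def strip_def)
    have "p ` topspace S = topspace torus" using cov unfolding covering_off_origin_def by (elim conjE)
    then have "torus_proj z0 \<in> p ` topspace S" by simp
    then obtain y where "y \<in> fib z0" by (auto simp: fib_def)
    then obtain \<sigma> where "is_sec (strip e j) \<sigma>" by (rule goodD[OF strip_good[OF e] z0])
    then show ?thesis using False by blast
  qed
  then obtain \<sigma> where \<sigma>: "\<And>j. is_sec (strip e j) (\<sigma> j)"
    "\<And>j t. t \<in> {0..1} \<Longrightarrow> of_real t * v \<in> strip e j \<Longrightarrow> \<sigma> j (of_real t * v) = \<gamma> t" by metis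
  define fl where "fl t = \<lfloor>t * real n\<rfloor>" for t
  \<comment> \<open>The point is slid along e by \<open>kk\<close> times its height above level j.
    Changing j shifts the result by a multiple of \<open>kk\<close> e, which sections do not notice
    by \<open>strip_periodic\<close>. One fixed index can therefore be used on both sides of an
    edge, where continuity is delicate.\<close>
  define q where "q j t = of_real t * v + of_real (of_int kk * (t * real n - of_int j)) * e" for j t
  define \<gamma>' where "\<gamma>' t = (if t * real n \<in> \<int> then \<gamma> t else \<sigma> (fl t) (q (fl t) t))" for t
  have wq: "wedge e (q j t) = t * real n" for j t
    unfolding q_def using wedge_shift wt by metis
  have q_in: "q i t \<in> strip e (fl t)" if "t * real n \<notin> \<int>" for t i
  proof -
    have "of_int (fl t) \<noteq> t * real n" using that by (metis Ints_of_int)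
    then have "of_int (fl t) < t * real n" unfolding fl_def using of_int_floor_le[of "t * real n"] by linarith
    moreover have "t * real n < of_int (fl t) + 1" unfolding fl_def by linarith
    ultimately show ?thesis by (simp add: strip_def wq)
  qed
  have v_in: "of_real t * v \<in> strip e (fl t)" if "t * real n \<notin> \<int>" for t
    using q_in[OF that, of 0] by (simp add: strip_def wq wt)
  have shift: "\<sigma> j (q j t) = \<sigma> j (q i t)" if "q i t \<in> strip e j" for i j t
  proof -
    have "q j t = q i t + of_int ((i - j) * l * fact sheets) * e"
      by (simp add: q_def kk_def algebra_simps)
    then show ?thesis using strip_periodic[OF e \<sigma>(1) that, of "(i - j) * l"] by simp
  qed
  have \<gamma>'_alt: "\<gamma>' t = \<sigma> (fl t) (q i t)" if "t * real n \<notin> \<int>" for t i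
    using shift[OF q_in[OF that]] that by (simp add: \<gamma>'_def)
  have p': "p (\<gamma>' t) = torus_proj (of_real t * (v + of_int (l * fact sheets * int n) * e))" if t: "t \<in> {0..1}" for t
  proof -
    define w where "w = of_real t * (v + of_int (l * fact sheets * int n) * e)"
    show ?thesis unfolding w_def[symmetric]
    proof (cases "t * real n \<in> \<int>")
      case True
      then obtain m where m: "t * real n = of_int m" by (elim Ints_cases)
      have "w = of_real t * v + of_real (of_int kk * (t * real n)) * e"
        by (simp add: w_def kk_def algebra_simps)
      also have "\<dots> = of_real t * v + of_int (kk * m) * e" unfolding m by simp
      finally have "torus_proj w = torus_proj (of_real t * v)"
        by (simp only: torus_proj_add_gauss[OF gauss_of_int_mult[OF e(1)]])
      then show "p (\<gamma>' t) = torus_proj w" using True \<gamma>p[OF t] by (simp add: \<gamma>'_def)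
    next
      case False
      have "p (\<gamma>' t) = torus_proj (q (fl t) t)"
        using q_in[OF False, of "fl t"] \<sigma>(1)[of "fl t"] False by (simp add: \<gamma>'_def is_sec_def)
      also have "w = q (fl t) t + of_int (kk * fl t) * e"
        by (simp add: w_def q_def kk_def algebra_simps)
      then have "torus_proj (q (fl t) t) = torus_proj w"
        by (simp only: torus_proj_add_gauss[OF gauss_of_int_mult[OF e(1)]])
      finally show "p (\<gamma>' t) = torus_proj w" .
    qed
  qed
  have top': "\<gamma>' t \<in> topspace S" if "t \<in> {0..1}" for t
    using \<gamma> that is_sec_topspace[OF \<sigma>(1) q_in] by (auto simp: \<gamma>'_def continuous_map_def)
  have "continuous_map (top_of_set {0..1::real}) S \<gamma>'"
    unfolding continuous_map_top_of_set_iff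
  proof (intro ballI conjI allI impI top')
    fix t0 :: real and W assume t0: "t0 \<in> {0..1}" and W: "openin S W" "\<gamma>' t0 \<in> W"
    show "\<forall>\<^sub>F u in at t0 within {0..1}. \<gamma>' u \<in> W"
    proof (cases "t0 * real n \<in> \<int>")
      case False
      define j where "j = fl t0"
      define D where "D = {t. of_int j < t * real n \<and> t * real n < of_int j + 1}"
      have Dopen: "open D"
        unfolding D_def by (intro open_Collect_conj open_Collect_less continuous_intros)
      have t0D: "t0 \<in> D" using v_in[OF False] by (simp add: D_def in_strip j_def)
      have fl: "t * real n \<notin> \<int> \<and> fl t = j" if "t \<in> D" for t
      proof -
        have "fl t = j" using that unfolding fl_def D_def by (intro floor_unique) auto
        moreover have "t * real n \<notin> \<int>"
        proof
          assume "t * real n \<in> \<int>"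
          then obtain m where "t * real n = of_int m" by (elim Ints_cases)
          then have "of_int j < (of_int m :: real)" "of_int m < (of_int (j + 1) :: real)" using that by (auto simp: D_def)
          then show False unfolding of_int_less_iff by linarith
        qed
        ultimately show ?thesis by blast
      qed
      have "continuous_map (top_of_set D) (top_of_set (strip e j)) (q j)"
      proof -
        have "continuous_on D (q j)" unfolding q_def by (intro continuous_intros)
        moreover have "q j t \<in> strip e j" if "t \<in> D" for t using that by (simp add: strip_def wq D_def)
        ultimately show ?thesis by (auto simp: continuous_map_in_subtopology)
      qed
      then have "continuous_map (top_of_set D) S (\<sigma> j \<circ> q j)"
        using \<sigma>(1)[of j] by (intro continuous_map_compose[of _ "top_of_set (strip e j)"]) (auto simp: is_sec_def)
      moreover have eq: "(\<sigma> j \<circ> q j) t = \<gamma>' t" if "t \<in> D" for t using fl[OF that] by (simp add: \<gamma>'_def)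
      ultimately have "\<forall>\<^sub>F u in at t0 within D. (\<sigma> j \<circ> q j) u \<in> W"
        unfolding continuous_map_top_of_set_iff using t0D W eq[OF t0D] by auto
      then have "\<forall>\<^sub>F u in at t0. (\<sigma> j \<circ> q j) u \<in> W" using at_within_open[OF t0D Dopen] by simp
      moreover have "\<forall>\<^sub>F u in at t0. u \<in> D" using Dopen t0D by (rule eventually_at_in_open')
      ultimately have "\<forall>\<^sub>F u in at t0. \<gamma>' u \<in> W" by eventually_elim (use eq in auto)
      then show ?thesis by (rule filter_leD[OF at_le, rotated]) simp
    next
      case True
      \<comment> \<open>Continuity where the path crosses an edge of the strips or sits on a lattice
        point. For nearby u the segment from the old point to the slid point stays in one strip and
        in a small ball. Its lift starts on \<gamma> inside \<open>W1\<close>, so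
        \<open>confinement\<close> keeps all of it there.\<close>
      then obtain j0 where j0: "t0 * real n = of_int j0" by (elim Ints_cases)
      have "\<gamma> t0 \<in> fib (of_real t0 * v)" using \<gamma> \<gamma>p[OF t0] t0 by (auto simp: fib_def continuous_map_def)
      moreover have "\<gamma> t0 \<in> W" using W True by (simp add: \<gamma>'_def)
      ultimately obtain W1 \<delta> where W1: "openin S W1" "\<gamma> t0 \<in> W1" "W1 \<subseteq> W" "\<delta> > 0"
        and conf: "\<And>C \<sigma> c. connected C \<Longrightarrow> C \<subseteq> ball (of_real t0 * v) \<delta> \<Longrightarrow> is_sec C \<sigma> \<Longrightarrow> c \<in> C \<Longrightarrow> \<sigma> c \<in> W1 \<Longrightarrow> \<sigma> ` C \<subseteq> W1"
        using confinement[OF _ W(1)] by metis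
      have 1: "\<forall>\<^sub>F u in at t0 within {0..1}. \<gamma> u \<in> W1"
        using \<gamma> W1 t0 unfolding continuous_map_top_of_set_iff by blast
      have 2: "\<forall>\<^sub>F u in at t0 within {0..1}. of_real u * v \<in> ball (of_real t0 * v) \<delta>"
        by (rule eventually_ball_of_continuous) (auto intro!: continuous_intros simp: W1)
      have 3: "\<forall>\<^sub>F u in at t0 within {0..1}. q j0 u \<in> ball (of_real t0 * v) \<delta>"
        by (rule eventually_ball_of_continuous) (auto intro!: continuous_intros simp: W1 q_def j0)
      have 4: "\<forall>\<^sub>F u in at t0 within {0..1}. u \<in> {0..1}"
        by (simp add: eventually_at_filter)
      show ?thesis using 1 2 3 4
      proof eventually_elim
        case (elim u)
        show ?case
        proof (cases "u * real n \<in> \<int>")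
          case True
          then show ?thesis using elim(1) W1(3) by (auto simp: \<gamma>'_def)
        next
          case False
          define C where "C = closed_segment (of_real u * v) (q j0 u)"
          have "C \<subseteq> strip e (fl u)"
          proof -
            have "strip e (fl u) = wedge e -` {of_int (fl u)<..<of_int (fl u) + 1}" by (auto simp: strip_def)
            then have "convex (strip e (fl u))" using convex_linear_vimage[OF wedge_linear] by simp
            then show ?thesis unfolding C_def using v_in[OF False] q_in[OF False] by (intro closed_segment_subset)
          qed
          then have "is_sec C (\<sigma> (fl u))" by (rule is_sec_subset[OF \<sigma>(1)])
          moreover have "C \<subseteq> ball (of_real t0 * v) \<delta>" unfolding C_def using elim by (intro closed_segment_subset) auto
          moreover have "\<sigma> (fl u) (of_real u * v) \<in> W1" using \<sigma>(2)[OF elim(4) v_in[OF False]] elim(1) by simp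
          ultimately have "\<sigma> (fl u) ` C \<subseteq> W1" by (intro conf[of C _ "of_real u * v"]) (auto simp: C_def)
          moreover have "q j0 u \<in> C" by (simp add: C_def)
          ultimately show ?thesis using \<gamma>'_alt[OF False, of j0] W1(3) by auto
        qed
      qed
    qed
  qed
  moreover have "\<gamma>' 0 \<in> Sg" "\<gamma>' 1 \<in> Sg" using \<gamma>S by (simp_all add: \<gamma>'_def)
  moreover have "\<gamma>' t \<notin> Sg" if t: "t \<in> {0<..<1}" for t
  proof (cases "t * real n \<in> \<int>")
    case True
    then show ?thesis using \<gamma>S(3)[OF t] by (simp add: \<gamma>'_def)
  next
    case False
    have "p (\<gamma>' t) = torus_proj (q (fl t) t)"
      using q_in[OF False, of "fl t"] \<sigma>(1)[of "fl t"] False by (simp add: \<gamma>'_def is_sec_def)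
    moreover have "q (fl t) t \<notin> gauss" using q_in[OF False] strip_free[OF e(1)] by blast
    ultimately show ?thesis by (rule not_Sg)
  qed
  ultimately show ?thesis using p' by blast
qed

text \<open>The twist depends quadratically on e, so e and -e give the same map; this reduces a
  negative height of v to a positive one.\<close>

lemma saddle_vec_twist:
  assumes sv: "saddle_vec v" and e: "e \<in> gauss"
  shows "saddle_vec (v + of_real (of_int (l * fact sheets) * wedge e v) * e)"
proof -
  have v: "v \<in> gauss" using saddle_vec_gauss[OF sv] .
  obtain \<gamma> where \<gamma>: "continuous_map (top_of_set {0..1::real}) S \<gamma>" "\<gamma> 0 \<in> Sg" "\<gamma> 1 \<in> Sg"
    "\<forall>t\<in>{0<..<1}. \<gamma> t \<notin> Sg" "\<forall>t\<in>{0..1}. p (\<gamma> t) = torus_proj (of_real t * v)" using sv unfolding saddle_vec_def by blast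
  have pos: "saddle_vec (v + of_real (of_int (l * fact sheets) * wedge e v) * e)" if e: "e \<in> gauss" and w: "wedge e v > 0" for e
  proof -
    obtain m where m: "wedge e v = of_int m" using wedge_gauss[OF e v] by (elim Ints_cases)
    define n where "n = nat m"
    have n: "wedge e v = real n" "0 < n" using w m by (auto simp: n_def)
    have e0: "e \<noteq> 0" using w by (auto simp: wedge_def)
    define v' where "v' = v + of_int (l * fact sheets * int n) * e"
    have "wedge e v' = wedge e v" unfolding v'_def using wedge_shift[of e v "of_int (l * fact sheets * int n)"] by simp
    then have "v' \<noteq> 0" using w by (auto simp: wedge_def)
    moreover have "\<exists>\<gamma>'. continuous_map (top_of_set {0..1::real}) S \<gamma>' \<and> \<gamma>' 0 \<in> Sg \<and> \<gamma>' 1 \<in> Sg \<and>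
      (\<forall>t\<in>{0<..<1}. \<gamma>' t \<notin> Sg) \<and> (\<forall>t\<in>{0..1}. p (\<gamma>' t) = torus_proj (of_real t * v'))"
      unfolding v'_def by (rule twist_pos[OF \<gamma>(1) _ \<gamma>(2,3) _ e e0 v n]) (use \<gamma> in auto)
    ultimately have "saddle_vec v'" unfolding saddle_vec_def by blast
    moreover have "v' = v + of_real (of_int (l * fact sheets) * wedge e v) * e" by (simp add: v'_def n)
    ultimately show ?thesis by simp
  qed
  consider "wedge e v > 0" | "wedge e v = 0" | "wedge e v < 0" by linarith
  then show ?thesis
  proof cases
    case 3
    then have "wedge (- e) v > 0" by (simp add: wedge_def)
    from pos[OF gauss_minus[OF e] this] show ?thesis by (simp add: wedge_def algebra_simps)
  qed (use pos e sv in auto)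
qed

section \<open>Existence of a horizontal saddle connection\<close>

lemma in_unit_strip: "of_real t \<in> strip (- \<i>) 0 \<longleftrightarrow> 0 < t \<and> t < 1"
  by (simp add: strip_def wedge_def)

text \<open>In the direction \<open>- \<i>\<close> the height is the real part, so this strip
  contains the open unit segment. Compactness yields a cluster point of the lift at the end c,
  continuity of p puts it over the lattice, and \<open>confinement\<close> turns it into a
  limit.\<close>

lemma limit_at_end:
  assumes \<sigma>: "is_sec (strip (- \<i>) 0) \<sigma>" and c: "c = 0 \<or> c = (1::real)"
  shows "\<exists>x\<in>fib 0. \<forall>W. openin S W \<longrightarrow> x \<in> W \<longrightarrow>
    (\<exists>\<epsilon>>0. \<forall>t. 0 < t \<longrightarrow> t < 1 \<longrightarrow> \<bar>t - c\<bar> < \<epsilon> \<longrightarrow> \<sigma> (of_real t) \<in> W)"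
proof -
  have near: "\<exists>t. 0 < t \<and> t < 1 \<and> \<bar>t - c\<bar> < \<epsilon>" if "0 < \<epsilon>" for \<epsilon>
  proof -
    define m where "m = min (\<epsilon> / 2) (1 / 2)"
    have "0 < m" "m < 1" "m < \<epsilon>" using that by (auto simp: m_def)
    then show ?thesis using c by (intro exI[of _ "if c = 0 then m else 1 - m"]) auto
  qed
  define avoids where "avoids W \<epsilon> \<longleftrightarrow> (\<forall>t. 0 < t \<longrightarrow> t < 1 \<longrightarrow> \<bar>t - c\<bar> < \<epsilon> \<longrightarrow> \<sigma> (of_real t) \<notin> W)" for W \<epsilon>
  have "\<exists>x\<in>topspace S. \<forall>W. openin S W \<longrightarrow> x \<in> W \<longrightarrow> (\<forall>\<epsilon>>0. \<not> avoids W \<epsilon>)"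
  proof (rule ccontr)
    assume neg: "\<not> ?thesis"
    define \<U> where "\<U> = {W. openin S W \<and> (\<exists>\<epsilon>>0. avoids W \<epsilon>)}"
    have op: "openin S U" if "U \<in> \<U>" for U using that by (simp add: \<U>_def)
    have cover: "topspace S \<subseteq> \<Union>\<U>"
    proof
      fix x assume "x \<in> topspace S"
      then obtain W where "openin S W" "x \<in> W" "W \<in> \<U>" using neg unfolding \<U>_def by blast
      then show "x \<in> \<Union>\<U>" by blast
    qed
    have "compactin S (topspace S)" using comp by (simp add: compact_space_def)
    then have "\<exists>\<F>. finite \<F> \<and> \<F> \<subseteq> \<U> \<and> topspace S \<subseteq> \<Union>\<F>" using op cover by (rule compactinD)
    then obtain \<F> where \<F>: "finite \<F>" "\<F> \<subseteq> \<U>" "topspace S \<subseteq> \<Union>\<F>" by (elim exE conjE)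
    have "\<exists>\<epsilon>>0. \<forall>W\<in>\<F>. avoids W \<epsilon>"
      using \<F>(1,2)
    proof (induction \<F>)
      case empty
      show ?case by (intro exI[of _ 1]) simp
    next
      case (insert W \<F>)
      then obtain \<epsilon>1 where \<epsilon>1: "\<epsilon>1 > 0" "\<forall>W\<in>\<F>. avoids W \<epsilon>1" by auto
      from insert obtain \<epsilon>2 where \<epsilon>2: "\<epsilon>2 > 0" "avoids W \<epsilon>2"
        unfolding \<U>_def by auto
      have "avoids V (min \<epsilon>1 \<epsilon>2)" if "avoids V \<epsilon>1 \<or> avoids V \<epsilon>2" for V
        using that unfolding avoids_def by auto
      then show ?case by (intro exI[of _ "min \<epsilon>1 \<epsilon>2"]) (use \<epsilon>1 \<epsilon>2 in auto)
    qed
    then obtain \<epsilon> where \<epsilon>: "\<epsilon> > 0" "\<forall>W\<in>\<F>. avoids W \<epsilon>" by blast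
    obtain t where t: "0 < t" "t < 1" "\<bar>t - c\<bar> < \<epsilon>" using near[OF \<epsilon>(1)] by blast
    have "\<sigma> (of_real t) \<in> topspace S" using is_sec_topspace[OF \<sigma>, of "of_real t"] in_unit_strip[of t] t by simp
    then obtain W where "W \<in> \<F>" "\<sigma> (of_real t) \<in> W" using \<F>(3) by blast
    then show False using \<epsilon>(2) t unfolding avoids_def by blast
  qed
  then obtain x where x: "x \<in> topspace S" and cl': "\<forall>W. openin S W \<longrightarrow> x \<in> W \<longrightarrow> (\<forall>\<epsilon>>0. \<not> avoids W \<epsilon>)" by blast
  have cl: "\<exists>t. 0 < t \<and> t < 1 \<and> \<bar>t - c\<bar> < \<epsilon> \<and> \<sigma> (of_real t) \<in> W" if "openin S W" "x \<in> W" "\<epsilon> > 0" for W \<epsilon>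
  proof -
    have "\<not> avoids W \<epsilon>" using cl' that by blast
    then show ?thesis unfolding avoids_def by blast
  qed
  have "p x = torus_proj (of_real c)"
  proof (rule ccontr)
    assume "p x \<noteq> torus_proj (of_real c)"
    from hausdorff[OF this] obtain A B where AB: "open A" "open B" "p x \<in> A" "torus_proj (of_real c) \<in> B" "A \<inter> B = {}"
      by blast
    have opB: "open ((\<lambda>t. torus_proj (of_real t)) -` B)"
    proof (intro open_vimage AB)
      have "continuous_on UNIV (torus_proj \<circ> (of_real :: real \<Rightarrow> complex))"
        by (intro continuous_on_compose continuous_torus_proj continuous_intros)
      then show "continuous_on UNIV (\<lambda>t::real. torus_proj (of_real t))" by (simp add: comp_def)
    qed
    have "c \<in> (\<lambda>t. torus_proj (of_real t)) -` B" using AB(4) by simp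
    then obtain \<epsilon> where \<epsilon>: "\<epsilon> > 0" "ball c \<epsilon> \<subseteq> (\<lambda>t. torus_proj (of_real t)) -` B"
      by (rule openE[OF opB])
    have "openin S {x \<in> topspace S. p x \<in> A}" using p_continuous AB(1) by (auto simp: continuous_map_def)
    from cl[OF this _ \<epsilon>(1)] obtain t where t: "0 < t" "t < 1" "\<bar>t - c\<bar> < \<epsilon>" "p (\<sigma> (of_real t)) \<in> A"
      using x AB(3) by auto
    have "p (\<sigma> (of_real t)) = torus_proj (of_real t)" using \<sigma> in_unit_strip t by (simp add: is_sec_def)
    moreover have "torus_proj (of_real t) \<in> B" using \<epsilon>(2) t(3) by (auto simp: dist_real_def abs_minus_commute)
    ultimately show False using t(4) AB(5) by auto
  qed
  then have xc: "x \<in> fib (of_real c)" using x by (simp add: fib_def)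
  have "\<exists>\<epsilon>>0. \<forall>t. 0 < t \<longrightarrow> t < 1 \<longrightarrow> \<bar>t - c\<bar> < \<epsilon> \<longrightarrow> \<sigma> (of_real t) \<in> W" if W: "openin S W" "x \<in> W" for W
  proof -
    obtain W1 \<delta> where W1: "openin S W1" "x \<in> W1" "W1 \<subseteq> W" "\<delta> > 0"
      and conf: "\<And>C \<sigma> z. connected C \<Longrightarrow> C \<subseteq> ball (of_real c) \<delta> \<Longrightarrow> is_sec C \<sigma> \<Longrightarrow> z \<in> C \<Longrightarrow> \<sigma> z \<in> W1 \<Longrightarrow> \<sigma> ` C \<subseteq> W1"
      by (rule confinement[OF xc W]) blast
    define D where "D = {0<..<1} \<inter> {c - \<delta><..<c + \<delta>}"
    define C where "C = (of_real ` D :: complex set)"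
    obtain t where t: "0 < t" "t < 1" "\<bar>t - c\<bar> < \<delta>" "\<sigma> (of_real t) \<in> W1" using cl[OF W1(1,2,4)] by blast
    have "connected D" unfolding D_def by (intro convex_connected convex_Int) auto
    then have "connected C" unfolding C_def by (intro connected_continuous_image continuous_intros)
    moreover have "C \<subseteq> ball (of_real c) \<delta>"
      by (auto simp: C_def D_def dist_norm abs_less_iff simp flip: of_real_diff)
    moreover have "is_sec C \<sigma>" by (rule is_sec_subset[OF \<sigma>]) (auto simp: C_def D_def in_unit_strip)
    moreover have "of_real t \<in> C" using t by (auto simp: C_def D_def abs_less_iff)
    ultimately have "\<sigma> ` C \<subseteq> W1" using t(4) by (rule conf)
    moreover have "of_real t \<in> C" if "0 < t" "t < 1" "\<bar>t - c\<bar> < \<delta>" for t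
      using that by (auto simp: C_def D_def abs_less_iff)
    ultimately show ?thesis using W1(3,4) by blast
  qed
  moreover have "x \<in> fib 0" using xc c torus_proj_eq_0_iff[of 1] by (auto simp: fib_def gauss_def)
  ultimately show ?thesis by (intro bexI[of _ x] allI impI)
qed

definition hstep :: "'a \<Rightarrow> 'a \<Rightarrow> bool" where
  "hstep y y' \<longleftrightarrow> (\<exists>g. continuous_map (top_of_set {0..1::real}) S g \<and> g 0 = y \<and> g 1 = y' \<and>
     (\<forall>t\<in>{0..1}. p (g t) = torus_proj (of_real t)))"

text \<open>\<open>hor\<close> supplies a point near y over a small positive real, and the section
  through it runs over the whole unit segment. By \<open>confinement\<close> this section stays in
  \<open>W1\<close> towards 0, and \<open>W1\<close> is separated from the other points over 0, so
  its limit there is y itself.\<close>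

lemma hstep_exists:
  assumes y: "y \<in> fib 0"
  shows "\<exists>y'\<in>fib 0. hstep y y'"
proof -
  have yt: "y \<in> topspace S" "p y = torus_proj 0" using y by (auto simp: fib_def)
  obtain W1 \<delta> where W1: "openin S W1" "y \<in> W1" "\<delta> > 0"
    and conf: "\<And>C \<sigma> z. connected C \<Longrightarrow> C \<subseteq> ball 0 \<delta> \<Longrightarrow> is_sec C \<sigma> \<Longrightarrow> z \<in> C \<Longrightarrow> \<sigma> z \<in> W1 \<Longrightarrow> \<sigma> ` C \<subseteq> W1"
    and sep: "\<And>x. x \<in> fib 0 \<Longrightarrow> x \<noteq> y \<Longrightarrow> \<exists>V. openin S V \<and> x \<in> V \<and> disjnt V W1"
    by (rule confinement[OF y openin_topspace yt(1)]) blast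
  obtain \<delta>' where \<delta>': "\<delta>' > 0" "\<And>\<epsilon>. 0 < \<epsilon> \<Longrightarrow> \<epsilon> < \<delta>' \<Longrightarrow> \<exists>x\<in>W1. p x = torus_proj (of_real \<epsilon>)"
    using hor[OF W1(1,2) yt(2)] by auto
  define \<epsilon> where "\<epsilon> = min (min \<delta> \<delta>') 1 / 2"
  have \<epsilon>: "0 < \<epsilon>" "\<epsilon> < \<delta>" "\<epsilon> < \<delta>'" "\<epsilon> < 1" using W1(3) \<delta>'(1) by (auto simp: \<epsilon>_def)
  obtain x where x: "x \<in> W1" "p x = torus_proj (of_real \<epsilon>)" using \<delta>'(2) \<epsilon> by blast
  have "x \<in> fib (of_real \<epsilon>)" using x openin_subset[OF W1(1)] by (auto simp: fib_def)
  moreover have "good (strip (- \<i>) 0)" by (rule strip_good) (auto simp: gauss_def)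
  ultimately obtain \<sigma> where \<sigma>: "is_sec (strip (- \<i>) 0) \<sigma>" "\<sigma> (of_real \<epsilon>) = x"
    using goodD[of "strip (- \<i>) 0" "of_real \<epsilon>" x] in_unit_strip[of \<epsilon>] \<epsilon> by metis
  define C where "C = (of_real ` {0<..\<epsilon>} :: complex set)"
  have "connected C" unfolding C_def by (intro connected_continuous_image continuous_intros convex_connected) auto
  moreover have "C \<subseteq> ball 0 \<delta>" using \<epsilon> by (auto simp: C_def)
  moreover have "is_sec C \<sigma>" by (rule is_sec_subset[OF \<sigma>(1)]) (use \<epsilon> in \<open>auto simp: C_def in_unit_strip\<close>)
  moreover have "of_real \<epsilon> \<in> C" using \<epsilon> by (simp add: C_def)
  ultimately have C: "\<sigma> ` C \<subseteq> W1" using \<sigma>(2) x(1) by (intro conf) auto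
  obtain x0 where x0: "x0 \<in> fib 0" "\<And>W. openin S W \<Longrightarrow> x0 \<in> W \<Longrightarrow> \<exists>\<epsilon>>0. \<forall>t. 0 < t \<longrightarrow> t < 1 \<longrightarrow> \<bar>t - 0\<bar> < \<epsilon> \<longrightarrow> \<sigma> (of_real t) \<in> W"
    using limit_at_end[OF \<sigma>(1), of 0] by blast
  obtain x1 where x1: "x1 \<in> fib 0" "\<And>W. openin S W \<Longrightarrow> x1 \<in> W \<Longrightarrow> \<exists>\<epsilon>>0. \<forall>t. 0 < t \<longrightarrow> t < 1 \<longrightarrow> \<bar>t - 1\<bar> < \<epsilon> \<longrightarrow> \<sigma> (of_real t) \<in> W"
    using limit_at_end[OF \<sigma>(1), of 1] by blast
  have "x0 = y"
  proof (rule ccontr)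
    assume "x0 \<noteq> y"
    then obtain V where V: "openin S V" "x0 \<in> V" "disjnt V W1" using sep x0(1) by blast
    obtain \<eta> where \<eta>: "\<eta> > 0" "\<And>t. 0 < t \<Longrightarrow> t < 1 \<Longrightarrow> \<bar>t - 0\<bar> < \<eta> \<Longrightarrow> \<sigma> (of_real t) \<in> V" using x0(2)[OF V(1,2)] by blast
    define t where "t = min \<eta> \<epsilon> / 2"
    have t: "0 < t" "t < \<eta>" "t \<le> \<epsilon>" "t < 1" using \<eta>(1) \<epsilon> by (auto simp: t_def)
    have "\<sigma> (of_real t) \<in> V" using \<eta>(2) t by auto
    moreover have "\<sigma> (of_real t) \<in> W1" using C t by (auto simp: C_def)
    ultimately show False using V(3) by (auto simp: disjnt_iff)
  qed
  define g where "g t = (if t = 0 then y else if t = 1 then x1 else \<sigma> (of_real t))" for t :: real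
  have "continuous_map (top_of_set {0..1}) S g"
    unfolding continuous_map_top_of_set_iff
  proof (intro ballI conjI allI impI)
    fix t :: real assume t: "t \<in> {0..1}"
    show "g t \<in> topspace S" using t yt x1(1) is_sec_topspace[OF \<sigma>(1)] in_unit_strip[of t] by (auto simp: g_def fib_def)
    fix W assume W: "openin S W" "g t \<in> W"
    have ev: "\<forall>\<^sub>F u in at c within {0..1}. g u \<in> W"
      if "\<epsilon> > 0" "\<And>u. 0 < u \<Longrightarrow> u < 1 \<Longrightarrow> \<bar>u - c\<bar> < \<epsilon> \<Longrightarrow> \<sigma> (of_real u) \<in> W" "c = 0 \<or> c = 1" for c \<epsilon> :: real
      unfolding eventually_at using that(1,2) that(3)
      by (intro exI[of _ "min \<epsilon> 1"]) (auto simp: g_def dist_real_def)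
    consider "t = 0" | "t = 1" | "0 < t" "t < 1" using t by fastforce
    then show "\<forall>\<^sub>F u in at t within {0..1}. g u \<in> W"
    proof cases
      case 1
      then obtain \<eta> where "\<eta> > 0" "\<forall>t. 0 < t \<longrightarrow> t < 1 \<longrightarrow> \<bar>t - 0\<bar> < \<eta> \<longrightarrow> \<sigma> (of_real t) \<in> W"
        using x0(2)[OF W(1)] W(2) \<open>x0 = y\<close> by (auto simp: g_def)
      then show ?thesis unfolding 1 by (intro ev) auto
    next
      case 2
      then obtain \<eta> where "\<eta> > 0" "\<forall>t. 0 < t \<longrightarrow> t < 1 \<longrightarrow> \<bar>t - 1\<bar> < \<eta> \<longrightarrow> \<sigma> (of_real t) \<in> W"
        using x1(2)[OF W(1)] W(2) by (auto simp: g_def)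
      then show ?thesis unfolding 2 by (intro ev) auto
    next
      case 3
      have "continuous_map (top_of_set {0<..<1::real}) (top_of_set (strip (- \<i>) 0)) of_real"
        by (auto simp: continuous_map_in_subtopology in_unit_strip intro!: continuous_intros)
      then have "continuous_map (top_of_set {0<..<1::real}) S (\<sigma> \<circ> of_real)"
        using \<sigma>(1) by (intro continuous_map_compose[of _ "top_of_set (strip (- \<i>) 0)"]) (auto simp: is_sec_def)
      then have "\<forall>\<^sub>F u in at t within {0<..<1}. \<sigma> (of_real u) \<in> W"
        using 3 W unfolding continuous_map_top_of_set_iff by (auto simp: g_def)
      then have "\<forall>\<^sub>F u in at t. \<sigma> (of_real u) \<in> W" using 3 by (simp add: at_within_open[of t "{0<..<1}"])
      moreover have "\<forall>\<^sub>F u in at t. u \<in> {0<..<1}" using 3 by (intro eventually_at_in_open') auto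
      ultimately have "\<forall>\<^sub>F u in at t. g u \<in> W" by eventually_elim (auto simp: g_def)
      then show ?thesis by (rule filter_leD[OF at_le, rotated]) simp
    qed
  qed
  moreover have "p (g t) = torus_proj (of_real t)" if "t \<in> {0..1}" for t
    using that \<sigma>(1) x1(1) yt(2) in_unit_strip[of t] torus_proj_eq_0_iff[of 1]
    by (auto simp: g_def is_sec_def fib_def gauss_def)
  ultimately have "hstep y x1" unfolding hstep_def by (intro exI[of _ g]) (auto simp: g_def)
  then show ?thesis using x1(1) by blast
qed

text \<open>At a regular end point p is locally injective, so the two segments agree backwards on
  {0<..1}; their limits at 0 agree by the Hausdorff property. Forwards this fails, since several
  segments may leave a singularity.\<close>

lemma hstep_unique_predecessor:
  assumes "hstep y1 y'" "hstep y2 y'" "y' \<notin> Sg"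
  shows "y1 = y2"
proof -
  obtain g1 where g1: "continuous_map (top_of_set {0..1::real}) S g1" "g1 0 = y1" "g1 1 = y'" "\<forall>t\<in>{0..1}. p (g1 t) = torus_proj (of_real t)"
    using assms(1) unfolding hstep_def by blast
  obtain g2 where g2: "continuous_map (top_of_set {0..1::real}) S g2" "g2 0 = y2" "g2 1 = y'" "\<forall>t\<in>{0..1}. p (g2 t) = torus_proj (of_real t)"
    using assms(2) unfolding hstep_def by blast
  have eq: "g1 t = g2 t" if "t \<in> {0<..1}" for t
  proof (rule unique_lift[of "{0<..1}" g1 g2 1 t])
    show "continuous_map (top_of_set {0<..1}) S g1" "continuous_map (top_of_set {0<..1}) S g2"
      by (rule continuous_map_from_subtopology_mono[OF g1(1)], force)
         (rule continuous_map_from_subtopology_mono[OF g2(1)], force)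
    fix u :: real assume u: "u \<in> {0<..1}"
    show "p (g1 u) = p (g2 u)" using u g1 g2 by simp
    show "g1 u \<notin> Sg"
    proof (cases "u = 1")
      case False
      have "(of_real u :: complex) \<notin> gauss"
      proof
        assume "(of_real u :: complex) \<in> gauss"
        then obtain n where "u = of_int n" unfolding gauss_of_real by (elim Ints_cases)
        then show False using u False by auto
      qed
      then show ?thesis using not_Sg[of "g1 u" "of_real u"] u g1(4) by simp
    qed (use g1 assms in simp)
  qed (use that g1 g2 in \<open>auto simp: convex_connected\<close>)
  show ?thesis
  proof (rule ccontr)
    assume "y1 \<noteq> y2"
    moreover have "y1 \<in> topspace S" "y2 \<in> topspace S" using g1(1,2) g2(1,2) by (auto simp: continuous_map_def)
    ultimately obtain U V where UV: "openin S U" "openin S V" "y1 \<in> U" "y2 \<in> V" "disjnt U V"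
      using haus unfolding Hausdorff_space_def by blast
    have "\<forall>\<^sub>F t in at 0 within {0..1}. g1 t \<in> U" "\<forall>\<^sub>F t in at 0 within {0..1}. g2 t \<in> V"
      using g1(1,2) g2(1,2) UV unfolding continuous_map_top_of_set_iff by auto
    moreover have "\<forall>\<^sub>F t in at 0 within {0..1::real}. t \<in> {0<..1}"
      by (auto simp: eventually_at_filter)
    ultimately have "\<forall>\<^sub>F t in at 0 within {0..1::real}. False"
      by eventually_elim (use eq UV(5) in \<open>auto simp: disjnt_iff\<close>)
    moreover have "at (0::real) within {0..1} \<noteq> bot"
      by (simp add: trivial_limit_within islimpt_Icc)
    ultimately show False by simp
  qed
qed

text \<open>A horizontal separatrix runs through finitely many points over \<open>0\<close>. Were all of them regular, two
  would coincide, and going back from them in parallel one would arrive at the singularity again.\<close>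

lemma saddle_vec_horizontal: "\<exists>m::nat. saddle_vec (of_nat m)"
proof -
  obtain s where s: "s \<in> Sg" using Sg_ne by blast
  obtain h where h: "\<And>y. y \<in> fib 0 \<Longrightarrow> h y \<in> fib 0 \<and> hstep y (h y)" using hstep_exists by metis
  define y where "y n = (h ^^ n) s" for n
  have s0: "s \<in> fib 0" using s Sg_sub Sg_p by (auto simp: fib_def)
  have yf: "y n \<in> fib 0" for n by (induction n) (use s0 h in \<open>auto simp: y_def\<close>)
  have ys: "hstep (y n) (y (Suc n))" for n using h[OF yf[of n]] by (simp add: y_def)
  have "\<exists>n>0. y n \<in> Sg"
  proof (rule ccontr)
    assume neg: "\<not> (\<exists>n>0. y n \<in> Sg)"
    have "\<not> inj y"
    proof
      assume "inj y"
      then have "infinite (range y)" using finite_imageD infinite_UNIV_nat by blast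
      moreover have "range y \<subseteq> fib 0" using yf by blast
      ultimately show False using fib_finite finite_subset by blast
    qed
    then obtain i j where "i \<noteq> j" "y i = y j" by (auto simp: inj_on_def)
    then obtain i j where "i < j" "y i = y j" by (cases i j rule: linorder_cases) auto
    then obtain d where "0 < d" "y i = y (i + d)" using less_imp_add_positive[of i j] by auto
    then have "y 0 = y d"
    proof (induction i)
      case (Suc i)
      have "y (Suc (i + d)) \<notin> Sg" using neg by blast
      moreover have "hstep (y i) (y (Suc (i + d)))" using ys[of i] Suc.prems by simp
      ultimately have "y i = y (i + d)" using hstep_unique_predecessor ys by blast
      then show ?case using Suc by blast
    qed simp
    moreover have "y 0 \<in> Sg" using s by (simp add: y_def)
    ultimately have "0 < d \<and> y d \<in> Sg" using \<open>0 < d\<close> by simp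
    then show False using neg by blast
  qed
  then obtain n0 where n0: "n0 > 0 \<and> y n0 \<in> Sg" by blast
  define m where "m = (LEAST n. n > 0 \<and> y n \<in> Sg)"
  have m: "m > 0" "y m \<in> Sg" using LeastI[of "\<lambda>n. n > 0 \<and> y n \<in> Sg", OF n0] by (auto simp: m_def)
  have m_least: "y n \<notin> Sg" if "0 < n" "n < m" for n
    using that not_less_Least[of n "\<lambda>n. n > 0 \<and> y n \<in> Sg"] unfolding m_def by blast
  have "\<exists>\<gamma>. continuous_map (top_of_set {0..real n}) S \<gamma> \<and> (\<forall>i\<le>n. \<gamma> (real i) = y i) \<and> (\<forall>t\<in>{0..real n}. p (\<gamma> t) = torus_proj (of_real t))" for n
  proof (induction n)
    case 0
    have "p s = torus_proj 0" "s \<in> topspace S" using s0 by (auto simp: fib_def)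
    then show ?case by (intro exI[of _ "\<lambda>_. s"]) (auto simp: y_def)
  next
    case (Suc n)
    then obtain \<gamma> where \<gamma>: "continuous_map (top_of_set {0..real n}) S \<gamma>" "\<forall>i\<le>n. \<gamma> (real i) = y i" "\<forall>t\<in>{0..real n}. p (\<gamma> t) = torus_proj (of_real t)" by blast
    obtain g where g: "continuous_map (top_of_set {0..1::real}) S g" "g 0 = y n" "g 1 = y (Suc n)" "\<forall>t\<in>{0..1}. p (g t) = torus_proj (of_real t)"
      using ys[of n] unfolding hstep_def by blast
    have "continuous_map (top_of_set {real n..real (Suc n)}) (top_of_set {0..1}) (\<lambda>t. t - real n)"
      by (auto simp: continuous_map_in_subtopology intro!: continuous_intros)
    from continuous_map_compose[OF this g(1)]
    have g': "continuous_map (top_of_set {real n..real (Suc n)}) S (\<lambda>t. g (t - real n))" by (simp add: comp_def)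
    define \<gamma>' where "\<gamma>' = (\<lambda>t. if t \<in> {0..real n} then \<gamma> t else g (t - real n))"
    have "continuous_map (top_of_set ({0..real n} \<union> {real n..real (Suc n)})) S \<gamma>'"
      unfolding \<gamma>'_def by (rule continuous_map_paste_closed[OF \<gamma>(1) g']) (use \<gamma>(2) g(2) in auto)
    moreover have "{0..real n} \<union> {real n..real (Suc n)} = {0..real (Suc n)}" by auto
    moreover have "\<gamma>' (real i) = y i" if "i \<le> Suc n" for i
      using that \<gamma>(2) g(3) by (cases "i = Suc n") (auto simp: \<gamma>'_def)
    moreover have "p (\<gamma>' t) = torus_proj (of_real t)" if "t \<in> {0..real (Suc n)}" for t
    proof (cases "t \<le> real n")
      case False
      then have "p (\<gamma>' t) = torus_proj (of_real (t - real n))" using that g(4) by (simp add: \<gamma>'_def)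
      also have "\<dots> = torus_proj (of_real t)" by (simp add: torus_proj_eq_iff gauss_def)
      finally show ?thesis .
    qed (use that \<gamma>(3) in \<open>simp add: \<gamma>'_def\<close>)
    ultimately show ?case by (intro exI[of _ \<gamma>']) auto
  qed
  then obtain \<gamma> where \<gamma>: "continuous_map (top_of_set {0..real m}) S \<gamma>" "\<forall>i\<le>m. \<gamma> (real i) = y i" "\<forall>t\<in>{0..real m}. p (\<gamma> t) = torus_proj (of_real t)" by blast
  have "continuous_map (top_of_set {0..1}) (top_of_set {0..real m}) (\<lambda>t. t * real m)"
    by (auto simp: continuous_map_in_subtopology mult_left_le_one_le intro!: continuous_intros)
  from continuous_map_compose[OF this \<gamma>(1)]
  have "continuous_map (top_of_set {0..1}) S (\<lambda>t. \<gamma> (t * real m))" by (simp add: comp_def)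
  moreover have "\<gamma> (0 * real m) \<in> Sg" "\<gamma> (1 * real m) \<in> Sg" using \<gamma>(2) s m by (auto simp: y_def dest: spec[of _ 0])
  moreover have pt: "p (\<gamma> (t * real m)) = torus_proj (of_real t * of_nat m)" if "t \<in> {0..1}" for t
    using \<gamma>(3) that by (simp add: mult_left_le_one_le)
  moreover have "\<gamma> (t * real m) \<notin> Sg" if t: "t \<in> {0<..<1}" for t
  proof (cases "t * real m \<in> \<int>")
    case True
    then obtain i where "t * real m = of_int i" by (elim Ints_cases)
    moreover have "0 < t * real m" "t * real m < real m" using t m by auto
    ultimately have i: "t * real m = real (nat i)" "0 < nat i" "nat i < m" by auto
    have "\<gamma> (t * real m) = y (nat i)" unfolding i(1) using \<gamma>(2) i(3) by simp
    then show ?thesis using m_least i by simp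
  next
    case False
    have "of_real t * of_nat m \<notin> gauss"
      using False gauss_of_real[of "t * real m"] by simp
    then show ?thesis using not_Sg pt t by auto
  qed
  ultimately have "saddle_vec (of_nat m)" unfolding saddle_vec_def using m(1)
    by (intro conjI exI[of _ "\<lambda>t. \<gamma> (t * real m)"]) auto
  then show ?thesis ..
qed

end

section \<open>Area distortion of holomorphic maps\<close>

text \<open>The plane is identified with \<open>real^2\<close>, where derivatives have matrices and
  determinants; Lebesgue measure is preserved.\<close>

definition vc :: "real^2 \<Rightarrow> complex" where "vc x = Complex (x $ 1) (x $ 2)"
definition cv :: "complex \<Rightarrow> real^2" where "cv z = vector [Re z, Im z]"

lemma cv_vc [simp]: "cv (vc x) = x" "vc (cv z) = z"
  by (auto simp: vc_def cv_def vec_eq_iff forall_2)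

lemma linear_vc: "linear vc" and linear_cv: "linear cv"
  by (auto intro!: linearI simp: vc_def cv_def complex_eq_iff vec_eq_iff forall_2)

lemma bounded_linear_vc: "bounded_linear vc" and bounded_linear_cv: "bounded_linear cv"
  by (simp_all add: linear_conv_bounded_linear[symmetric] linear_vc linear_cv)

lemma cv_image: "cv ` A = vc -` A"
proof -
  have "x \<in> cv ` A" if "vc x \<in> A" for x using imageI[OF that, of cv] by simp
  then show ?thesis by auto
qed

lemma open_cv_image: "open A \<Longrightarrow> open (cv ` A)"
  unfolding cv_image by (intro open_vimage linear_continuous_on bounded_linear_vc)

lemma lborel_complex: "distr lborel borel vc = lborel"
proof (rule lborel_eqI[symmetric])
  have m: "vc \<in> borel_measurable borel"
    by (intro borel_measurable_continuous_onI linear_continuous_on bounded_linear_vc)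
  fix l u :: complex assume lu: "\<And>b. b \<in> Basis \<Longrightarrow> l \<bullet> b \<le> u \<bullet> b"
  have "vc -` box l u = box (cv l) (cv u)"
    by (auto simp: vc_def cv_def mem_box_cart forall_2 in_box_complex_iff)
  then have e: "emeasure (distr lborel borel vc) (box l u) = emeasure lborel (box (cv l) (cv u))"
    using m by (subst emeasure_distr) auto
  have B: "(Basis :: (real^2) set) = {axis 1 1, axis 2 1}"
    by (auto simp: Basis_vec_def) (metis exhaust_2)
  note e
  also have "emeasure lborel (box (cv l) (cv u)) = (\<Prod>b\<in>Basis. (cv u - cv l) \<bullet> b)"
    using lu[of 1] lu[of \<i>]
    by (intro emeasure_lborel_box) (auto simp: B cv_def inner_axis Basis_complex_def)
  also have "(\<Prod>b\<in>Basis. (cv u - cv l) \<bullet> b) = (\<Prod>b\<in>Basis. (u - l) \<bullet> b)"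
    by (simp add: B cv_def inner_axis axis_eq_axis Basis_complex_def)
  finally show "emeasure (distr lborel borel vc) (box l u) = (\<Prod>b\<in>Basis. (u - l) \<bullet> b)" .
qed simp

lemma emeasure_complex:
  assumes "A \<in> sets borel"
  shows "emeasure lborel A = emeasure lborel (cv ` A)"
proof -
  have "vc \<in> borel_measurable borel"
    by (intro borel_measurable_continuous_onI linear_continuous_on bounded_linear_vc)
  then show ?thesis using emeasure_distr[of vc lborel borel A] assms lborel_complex by (simp add: cv_image)
qed

text \<open>The real Jacobian determinant of a holomorphic map f is |f'|^2. Besides bounding the
  area of a piece of surface, this gives the invariance of area under rotations, with B = 1 in both
  directions.\<close>

lemma emeasure_holomorphic_image_le:
  assumes D: "open D" and f: "f holomorphic_on D" and inj: "inj_on f D"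
    and B: "\<And>z. z \<in> D \<Longrightarrow> cmod (deriv f z) \<le> B" and B0: "0 < B"
  shows "emeasure lborel (f ` D) \<le> ennreal (B\<^sup>2) * emeasure lborel D"
proof (cases "emeasure lborel D = \<infinity>")
  case True
  then show ?thesis using B0 by (simp add: ennreal_mult_top)
next
  case False
  define F where "F = cv \<circ> f \<circ> vc"
  define E where "E = cv ` D"
  have E_vc: "E = vc -` D" unfolding E_def by (rule cv_image)
  have E: "open E" unfolding E_def by (rule open_cv_image[OF D])
  have fD: "open (f ` D)" by (rule open_mapping_thm3[OF f D inj])
  have eE: "emeasure lborel D = emeasure lborel E" unfolding E_def using D by (intro emeasure_complex) auto
  have fE: "cv ` (f ` D) = F ` E" by (force simp: F_def E_def)
  have efE: "emeasure lborel (f ` D) = emeasure lborel (F ` E)"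
    unfolding fE[symmetric] using fD by (intro emeasure_complex) auto
  define F' where "F' x h = cv (deriv f (vc x) * vc h)" for x h
  have der: "(F has_derivative F' x) (at x within E)" if x: "x \<in> E" for x
  proof -
    have "(f has_field_derivative deriv f (vc x)) (at (vc x))"
      using f D x holomorphic_derivI unfolding E_vc by blast
    then have 1: "(f has_derivative (*) (deriv f (vc x))) (at (vc x))" by (simp add: has_field_derivative_def)
    have "(vc has_derivative vc) (at x)" by (rule bounded_linear_imp_has_derivative[OF bounded_linear_vc])
    from diff_chain_at[OF this 1] have "((f \<circ> vc) has_derivative ((*) (deriv f (vc x)) \<circ> vc)) (at x)" .
    from diff_chain_at[OF this bounded_linear_imp_has_derivative[OF bounded_linear_cv]]
    have "((cv \<circ> (f \<circ> vc)) has_derivative (cv \<circ> ((*) (deriv f (vc x)) \<circ> vc))) (at x)" .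
    moreover have "F = cv \<circ> (f \<circ> vc)" "F' x = cv \<circ> ((*) (deriv f (vc x)) \<circ> vc)"
      by (auto simp: F_def F'_def fun_eq_iff)
    ultimately have "(F has_derivative F' x) (at x)" by simp
    then show ?thesis by (rule has_derivative_at_withinI)
  qed
  have det: "det (matrix (F' x)) = (cmod (deriv f (vc x)))\<^sup>2" for x
  proof -
    have "det (matrix (F' x)) = Re (deriv f (vc x)) * Re (deriv f (vc x)) + Im (deriv f (vc x)) * Im (deriv f (vc x))"
      by (simp add: det_2 matrix_def F'_def cv_def vc_def axis_def)
    then show ?thesis unfolding cmod_power2 by (simp add: power2_eq_square)
  qed
  have lm: "E \<in> lmeasurable"
    using E False eE by (intro fmeasurableI) (auto simp: less_top infinity_ennreal_def)
  have bound: "\<bar>det (matrix (F' x))\<bar> \<le> B\<^sup>2" if "x \<in> E" for x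
    unfolding det using B[of "vc x"] that by (auto simp: E_vc intro!: power_mono)
  have int: "(\<lambda>x. \<bar>det (matrix (F' x))\<bar>) integrable_on E"
  proof (rule measurable_bounded_by_integrable_imp_integrable)
    have "deriv f holomorphic_on D" using f D by (rule holomorphic_deriv)
    then have "continuous_on D (deriv f)" by (rule holomorphic_on_imp_continuous_on)
    then have "continuous_on E (\<lambda>x. deriv f (vc x))"
      by (rule continuous_on_compose2[OF _ linear_continuous_on[OF bounded_linear_vc]]) (auto simp: E_vc)
    then have "continuous_on E (\<lambda>x. (cmod (deriv f (vc x)))\<^sup>2)" by (intro continuous_intros)
    then show "(\<lambda>x. \<bar>det (matrix (F' x))\<bar>) \<in> borel_measurable (lebesgue_on E)"
      unfolding det using E by (intro continuous_imp_measurable_on_sets_lebesgue) auto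
    show "(\<lambda>x. B\<^sup>2) integrable_on E" using lm by (simp add: integrable_on_const)
    show "norm \<bar>det (matrix (F' x))\<bar> \<le> B\<^sup>2" if "x \<in> E" for x using bound[OF that] by simp
    show "E \<in> sets lebesgue" using lm by auto
  qed
  have Fm: "F ` E \<in> lmeasurable" and le: "measure lebesgue (F ` E) \<le> B\<^sup>2 * measure lebesgue E"
    using measurable_bounded_differentiable_image[OF lm der int bound]
      measure_bounded_differentiable_image[OF lm der int bound] by auto
  have "F ` E \<in> sets borel"
    unfolding fE[symmetric] by (intro borel_open open_cv_image fD)
  then have "emeasure lborel (F ` E) = emeasure lebesgue (F ` E)" by simp
  also have "\<dots> = ennreal (measure lebesgue (F ` E))" by (rule emeasure_eq_measure2[OF Fm])
  also have "\<dots> \<le> ennreal (B\<^sup>2 * measure lebesgue E)" using le by (rule ennreal_leI)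
  also have "\<dots> = ennreal (B\<^sup>2) * emeasure lebesgue E" by (simp add: ennreal_mult emeasure_eq_measure2[OF lm])
  also have "emeasure lebesgue E = emeasure lborel E" using E by simp
  finally show ?thesis unfolding eE efE .
qed

lemma emeasure_rotation:
  assumes "open D" "cmod c = 1"
  shows "emeasure lborel ((*) c ` D) = emeasure lborel D"
proof (rule antisym)
  have le: "emeasure lborel ((*) c ` D) \<le> emeasure lborel D" if "open D" "cmod c = 1" for c D
  proof -
    have c: "c \<noteq> 0" using that by auto
    have "emeasure lborel ((*) c ` D) \<le> ennreal (1\<^sup>2) * emeasure lborel D"
      using that c by (intro emeasure_holomorphic_image_le) (auto simp: inj_on_def intro!: holomorphic_intros)
    then show ?thesis by simp
  qed
  show "emeasure lborel ((*) c ` D) \<le> emeasure lborel D" by (rule le[OF assms])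
  have c: "c \<noteq> 0" using assms by auto
  have "open ((*) c ` D)"
    using assms(1) c by (intro open_mapping_thm3[of _ D]) (auto simp: inj_on_def intro!: holomorphic_intros)
  moreover have "(*) (inverse c) ` ((*) c ` D) = D"
  proof -
    have "inverse c * (c * x) = x" for x using c by (simp add: mult.assoc[symmetric])
    then show ?thesis unfolding image_image by (simp only: image_ident)
  qed
  ultimately show "emeasure lborel D \<le> emeasure lborel ((*) c ` D)"
    using le[of "(*) c ` D" "inverse c"] assms by (simp add: norm_inverse)
qed

section \<open>Charts of a translation surface\<close>

locale trans_surf =
  fixes X :: "'a surface"
  assumes ts: "translation_surface X"
begin

abbreviation "S \<equiv> top_of X"

lemma rs: "riemann_surface S (atlas X)" and cs: "compact_space S" and hf: "holomorphic_form (atlas X) (form X)"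
  and nonzero: "\<exists>(U, \<phi>)\<in>atlas X. \<exists>x\<in>U. form X (U, \<phi>) (\<phi> x) \<noteq> 0"
  and sing_zeros: "if zeros X \<noteq> {} then sing X = zeros X
      else finite (sing X) \<and> sing X \<noteq> {} \<and> sing X \<subseteq> topspace S"
  using ts unfolding translation_surface_def by blast+

lemma hausd: "Hausdorff_space S" and conn: "connected_space S"
  and atlas_cover: "(\<Union>(U, \<phi>)\<in>atlas X. U) = topspace S"
  using rs unfolding riemann_surface_def by blast+

lemma chart:
  assumes "(U, \<phi>) \<in> atlas X"
  shows "openin S U" "open (\<phi> ` U)" "homeomorphic_map (subtopology S U) (top_of_set (\<phi> ` U)) \<phi>"
    "form X (U, \<phi>) holomorphic_on \<phi> ` U"
  using assms rs hf unfolding riemann_surface_def holomorphic_form_def by fast+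

lemma chart_subset: "(U, \<phi>) \<in> atlas X \<Longrightarrow> U \<subseteq> topspace S"
  by (rule openin_subset[OF chart(1)])

lemma chart_topspace: "(U, \<phi>) \<in> atlas X \<Longrightarrow> topspace (subtopology S U) = U"
  using chart_subset by auto

lemma chart_inj: "(U, \<phi>) \<in> atlas X \<Longrightarrow> inj_on \<phi> U"
  using chart(3) chart_topspace homeomorphic_imp_injective_map by metis

lemma chart_inv [simp]: "(U, \<phi>) \<in> atlas X \<Longrightarrow> x \<in> U \<Longrightarrow> inv_into U \<phi> (\<phi> x) = x"
  by (rule inv_into_f_f[OF chart_inj])

lemma chart_exists:
  assumes "x \<in> topspace S"
  obtains U \<phi> where "(U, \<phi>) \<in> atlas X" "x \<in> U"
  using assms atlas_cover by blast

lemma chart_image_open: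
  assumes c: "(U, \<phi>) \<in> atlas X" and W: "openin S W"
  shows "open (\<phi> ` (U \<inter> W))"
proof -
  have "open_map (subtopology S U) (top_of_set (\<phi> ` U)) \<phi>"
    by (rule homeomorphic_imp_open_map[OF chart(3)[OF c]])
  moreover have "openin (subtopology S U) (U \<inter> W)" using W by (simp add: openin_subtopology_Int2)
  ultimately have "openin (top_of_set (\<phi> ` U)) (\<phi> ` (U \<inter> W))" unfolding open_map_def by blast
  then show ?thesis using openin_open_trans chart(2)[OF c] by blast
qed

lemma chart_preimage_open:
  assumes c: "(U, \<phi>) \<in> atlas X" and A: "open A"
  shows "openin S {x \<in> U. \<phi> x \<in> A}"
proof -
  have "continuous_map (subtopology S U) (top_of_set (\<phi> ` U)) \<phi>"
    by (rule homeomorphic_imp_continuous_map[OF chart(3)[OF c]])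
  then have "openin (subtopology S U) {x \<in> topspace (subtopology S U). \<phi> x \<in> \<phi> ` U \<inter> A}"
    using A by (intro openin_continuous_map_preimage) auto
  moreover have "{x \<in> topspace (subtopology S U). \<phi> x \<in> \<phi> ` U \<inter> A} = {x \<in> U. \<phi> x \<in> A}"
    using chart_topspace[OF c] by auto
  ultimately show ?thesis using openin_trans_full chart(1)[OF c] by metis
qed

lemma form_zero_chart_independent:
  assumes "(U, \<phi>) \<in> atlas X" "(V, \<psi>) \<in> atlas X" "x \<in> U" "x \<in> V" "form X (V, \<psi>) (\<psi> x) = 0"
  shows "form X (U, \<phi>) (\<phi> x) = 0"
proof -
  have "form X (U, \<phi>) (\<phi> x) = form X (V, \<psi>) (\<psi> x) * deriv (\<psi> \<circ> inv_into U \<phi>) (\<phi> x)"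
    using hf assms(1-4) unfolding holomorphic_form_def by fast
  then show ?thesis using assms(5) by simp
qed

lemma zeros_iff:
  assumes "(U, \<phi>) \<in> atlas X" "x \<in> U"
  shows "x \<in> zeros X \<longleftrightarrow> form X (U, \<phi>) (\<phi> x) = 0"
  using assms form_zero_chart_independent[OF assms(1) _ assms(2)] unfolding zeros_def by fast

lemma zeros_sub_sing: "zeros X \<subseteq> sing X"
  using sing_zeros by (cases "zeros X = {}") auto

lemma sing_sub: "sing X \<subseteq> topspace S"
proof (cases "zeros X = {}")
  case False
  then have "sing X = zeros X" using sing_zeros by simp
  moreover have "zeros X \<subseteq> topspace S" using atlas_cover unfolding zeros_def by blast
  ultimately show ?thesis by simp
qed (use sing_zeros in simp)

lemma sing_nonempty: "sing X \<noteq> {}"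
  using sing_zeros by (cases "zeros X = {}") auto

text \<open>The identity theorem on a connected surface: the interior of the zero set is also
  closed, because a chart disc that meets it consists of zeros entirely. It is not everything, since
  the form is nonzero somewhere.\<close>

lemma zeros_interior_empty:
  assumes W: "openin S W" "W \<subseteq> zeros X"
  shows "W = {}"
proof -
  define Z where "Z = \<Union>{W. openin S W \<and> W \<subseteq> zeros X}"
  have Zo: "openin S Z" unfolding Z_def by (rule openin_Union) simp
  have Zz: "Z \<subseteq> zeros X" unfolding Z_def by blast
  have "openin S (topspace S - Z)"
  proof (subst openin_subopen, intro ballI)
    fix x assume x: "x \<in> topspace S - Z"
    obtain U \<phi> where c: "(U, \<phi>) \<in> atlas X" "x \<in> U" using chart_exists x by blast
    obtain r where r: "r > 0" "ball (\<phi> x) r \<subseteq> \<phi> ` U" using chart(2)[OF c(1)] c(2) by (meson imageI openE)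
    define N where "N = {y \<in> U. \<phi> y \<in> ball (\<phi> x) r}"
    have N: "openin S N" unfolding N_def by (rule chart_preimage_open[OF c(1)]) simp
    have xN: "x \<in> N" using c(2) r by (simp add: N_def)
    have hol: "form X (U, \<phi>) holomorphic_on ball (\<phi> x) r" using chart(4)[OF c(1)] r(2) by (rule holomorphic_on_subset)
    have "N \<inter> Z = {}"
    proof (rule ccontr)
      assume ne: "N \<inter> Z \<noteq> {}"
      define A where "A = \<phi> ` (U \<inter> (N \<inter> Z))"
      have "open A" unfolding A_def using N Zo by (intro chart_image_open[OF c(1)]) auto
      moreover have "A \<noteq> {}" using ne by (auto simp: A_def N_def)
      moreover have "A \<subseteq> ball (\<phi> x) r" by (auto simp: A_def N_def)
      moreover have "form X (U, \<phi>) z = 0" if "z \<in> A" for z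
        using that Zz zeros_iff[OF c(1)] by (auto simp: A_def)
      ultimately have z: "form X (U, \<phi>) z = 0" if "z \<in> ball (\<phi> x) r" for z
        using analytic_continuation_open[of A "ball (\<phi> x) r" "form X (U, \<phi>)" "\<lambda>_. 0" z] hol that by (auto simp: connected_ball)
      have "N \<subseteq> zeros X"
        using z zeros_iff[OF c(1)] by (auto simp: N_def)
      then have "N \<subseteq> Z" using N unfolding Z_def by blast
      then show False using x xN by blast
    qed
    then show "\<exists>T. openin S T \<and> x \<in> T \<and> T \<subseteq> topspace S - Z"
      using N xN openin_subset by (intro exI[of _ N]) blast
  qed
  then have "closedin S Z" using openin_subset[OF Zo] by (simp add: closedin_def)
  then have "Z = {} \<or> Z = topspace S" using conn Zo unfolding connected_space_clopen_in by blast
  moreover have "Z \<noteq> topspace S"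
  proof
    assume Z: "Z = topspace S"
    obtain U \<phi> x where c: "(U, \<phi>) \<in> atlas X" "x \<in> U" "form X (U, \<phi>) (\<phi> x) \<noteq> 0" using nonzero by blast
    then have "x \<in> zeros X" using Z Zz chart_subset by blast
    then show False using c zeros_iff by blast
  qed
  ultimately show ?thesis using W unfolding Z_def by blast
qed

lemma local_primitive_chart:
  assumes lp: "local_primitive X U \<zeta>" and c: "(V, \<psi>) \<in> atlas X"
  defines "f \<equiv> \<zeta> \<circ> inv_into V \<psi>" and "D \<equiv> \<psi> ` (V \<inter> U)"
  shows "open D" "f holomorphic_on D" "\<And>x. x \<in> V \<inter> U \<Longrightarrow> deriv f (\<psi> x) = form X (V, \<psi>) (\<psi> x)"
    "\<And>x. x \<in> V \<Longrightarrow> f (\<psi> x) = \<zeta> x"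
    "\<And>x. x \<in> V \<inter> U \<Longrightarrow> (f has_field_derivative form X (V, \<psi>) (\<psi> x)) (at (\<psi> x))"
proof -
  show oD: "open D" unfolding D_def using lp by (intro chart_image_open[OF c]) (simp add: local_primitive_def)
  show d: "(f has_field_derivative form X (V, \<psi>) (\<psi> x)) (at (\<psi> x))" if "x \<in> V \<inter> U" for x
    using lp c that unfolding local_primitive_def f_def by fast
  then show "deriv f (\<psi> x) = form X (V, \<psi>) (\<psi> x)" if "x \<in> V \<inter> U" for x using that by (blast intro: DERIV_imp_deriv)
  have "\<exists>f'. (f has_field_derivative f') (at z)" if "z \<in> D" for z using that d unfolding D_def by blast
  then show "f holomorphic_on D" by (simp add: holomorphic_on_open[OF oD])
  show "f (\<psi> x) = \<zeta> x" if "x \<in> V" for x using that c by (simp add: f_def)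
qed

lemma local_primitive_continuous:
  assumes lp: "local_primitive X U \<zeta>" and A: "open A"
  shows "openin S {x \<in> U. \<zeta> x \<in> A}"
proof (subst openin_subopen, intro ballI)
  have U: "openin S U" using lp by (simp add: local_primitive_def)
  fix x assume x: "x \<in> {x \<in> U. \<zeta> x \<in> A}"
  then have "x \<in> topspace S" using openin_subset[OF U] by blast
  then obtain V \<psi> where c: "(V, \<psi>) \<in> atlas X" "x \<in> V" by (rule chart_exists)
  define f where "f = \<zeta> \<circ> inv_into V \<psi>"
  define D where "D = \<psi> ` (V \<inter> U)"
  note L = local_primitive_chart[OF lp c(1), folded f_def D_def]
  have o: "open (D \<inter> f -` A)"
    using L(1,2) A holomorphic_on_imp_continuous_on continuous_on_open_vimage by (metis Int_commute)
  have "openin S ({y \<in> V. \<psi> y \<in> D \<inter> f -` A} \<inter> U)" using U by (intro openin_Int chart_preimage_open[OF c(1) o])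
  moreover have "x \<in> {y \<in> V. \<psi> y \<in> D \<inter> f -` A} \<inter> U" using x c L(4) by (auto simp: D_def)
  moreover have "{y \<in> V. \<psi> y \<in> D \<inter> f -` A} \<inter> U \<subseteq> {x \<in> U. \<zeta> x \<in> A}" using L(4) by auto
  ultimately show "\<exists>T. openin S T \<and> x \<in> T \<and> T \<subseteq> {x \<in> U. \<zeta> x \<in> A}" by blast
qed

text \<open>Valid at singularities too. In a chart the primitive is constant on no nonempty open
  set, since the form would vanish there; isolation of zeros and the open mapping theorem give the
  two claims.\<close>

lemma local_primitive_isolated:
  assumes lp: "local_primitive X U \<zeta>" and x: "x \<in> U"
  shows "\<exists>N. openin S N \<and> x \<in> N \<and> N \<subseteq> U \<and> (\<forall>y\<in>N. \<zeta> y = \<zeta> x \<longrightarrow> y = x)"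
    and "\<And>W. openin S W \<Longrightarrow> x \<in> W \<Longrightarrow> \<exists>\<delta>>0. ball (\<zeta> x) \<delta> \<subseteq> \<zeta> ` (U \<inter> W)"
proof -
  have U: "openin S U" using lp by (simp add: local_primitive_def)
  have "x \<in> topspace S" using openin_subset[OF U] x by blast
  then obtain V \<psi> where c: "(V, \<psi>) \<in> atlas X" "x \<in> V" by (rule chart_exists)
  define f where "f = \<zeta> \<circ> inv_into V \<psi>"
  have nonconst: "\<not> f constant_on B" if B: "open B" "B \<noteq> {}" "B \<subseteq> \<psi> ` (V \<inter> U)" for B
  proof
    assume "f constant_on B"
    then obtain k where k: "\<And>z. z \<in> B \<Longrightarrow> f z = k" unfolding constant_on_def by blast
    define N where "N = {y \<in> V. \<psi> y \<in> B}"
    have "y \<in> zeros X" if "y \<in> N" for y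
    proof -
      have y: "y \<in> V" "\<psi> y \<in> B" using that by (auto simp: N_def)
      then obtain y' where "y' \<in> V \<inter> U" "\<psi> y = \<psi> y'" using B(3) by blast
      then have yU: "y \<in> V \<inter> U" using chart_inj[OF c(1)] y by (metis IntD1 inj_onD)
      have "(f has_field_derivative 0) (at (\<psi> y))"
        by (rule has_field_derivative_transform_within_open[OF DERIV_const B(1) y(2)]) (use k in auto)
      moreover have "(f has_field_derivative form X (V, \<psi>) (\<psi> y)) (at (\<psi> y))"
        unfolding f_def by (rule local_primitive_chart(5)[OF lp c(1) yU])
      ultimately show ?thesis using zeros_iff[OF c(1) y(1)] DERIV_unique by metis
    qed
    moreover have "openin S N" unfolding N_def by (rule chart_preimage_open[OF c(1) B(1)])
    ultimately have "N = {}" by (intro zeros_interior_empty) auto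
    then show False using B(2,3) by (auto simp: N_def)
  qed
  have op: "\<exists>r>0. ball (\<psi> x) r \<subseteq> \<psi> ` (V \<inter> (U \<inter> W))" if "openin S W" "x \<in> W" for W
    using chart_image_open[OF c(1), of "U \<inter> W"] U that x c(2) by (meson openin_Int openE imageI IntI)
  have hol: "f holomorphic_on B" if "B \<subseteq> \<psi> ` (V \<inter> U)" for B
    using local_primitive_chart(2)[OF lp c(1)] that holomorphic_on_subset unfolding f_def by blast
  have fpsi: "f (\<psi> y) = \<zeta> y" if "y \<in> V" for y using that c by (simp add: f_def)
  show "\<exists>N. openin S N \<and> x \<in> N \<and> N \<subseteq> U \<and> (\<forall>y\<in>N. \<zeta> y = \<zeta> x \<longrightarrow> y = x)"
  proof -
    obtain r where r: "r > 0" "ball (\<psi> x) r \<subseteq> \<psi> ` (V \<inter> U)" using op[OF U x] by auto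
    define g where "g z = f z - f (\<psi> x)" for z
    have gh: "g holomorphic_on ball (\<psi> x) r" unfolding g_def using hol[OF r(2)] by (intro holomorphic_intros)
    have "\<not> f constant_on ball (\<psi> x) r" using nonconst r by auto
    then obtain b where b: "b \<in> ball (\<psi> x) r" "g b \<noteq> 0" unfolding constant_on_def g_def by (metis right_minus_eq)
    have px: "\<psi> x \<in> ball (\<psi> x) r" using r by simp
    have "g (\<psi> x) = 0" by (simp add: g_def)
    from isolated_zeros[OF gh open_ball connected_ball px this b] obtain \<rho> where \<rho>: "0 < \<rho>"
      "\<And>z. z \<in> ball (\<psi> x) \<rho> - {\<psi> x} \<Longrightarrow> g z \<noteq> 0" by metis
    define N where "N = {y \<in> V. \<psi> y \<in> ball (\<psi> x) \<rho>} \<inter> U"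
    have "openin S N" unfolding N_def using U by (intro openin_Int chart_preimage_open[OF c(1)]) auto
    moreover have "x \<in> N" using c x \<rho> by (auto simp: N_def)
    moreover have "y = x" if "y \<in> N" "\<zeta> y = \<zeta> x" for y
    proof -
      have y: "y \<in> V" "\<psi> y \<in> ball (\<psi> x) \<rho>" using that by (auto simp: N_def)
      have "g (\<psi> y) = 0" using that(2) fpsi y(1) c(2) by (simp add: g_def)
      then have "\<psi> y = \<psi> x" using \<rho>(2) y(2) by blast
      then show ?thesis using chart_inj[OF c(1)] y(1) c(2) by (meson inj_onD)
    qed
    ultimately show ?thesis by (intro exI[of _ N]) (auto simp: N_def)
  qed
  show "\<exists>\<delta>>0. ball (\<zeta> x) \<delta> \<subseteq> \<zeta> ` (U \<inter> W)" if W: "openin S W" "x \<in> W" for W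
  proof -
    obtain r where r: "r > 0" "ball (\<psi> x) r \<subseteq> \<psi> ` (V \<inter> (U \<inter> W))" using op[OF W] by auto
    have sub: "ball (\<psi> x) r \<subseteq> \<psi> ` (V \<inter> U)" using r(2) by blast
    have "open (f ` ball (\<psi> x) r)"
      by (rule open_mapping_thm[OF hol[OF sub] open_ball connected_ball open_ball subset_refl])
         (use nonconst[OF open_ball _ sub] r in auto)
    moreover have "\<zeta> x \<in> f ` ball (\<psi> x) r" using fpsi[OF c(2)] r(1) by (metis centre_in_ball imageI)
    ultimately obtain \<delta> where "\<delta> > 0" "ball (\<zeta> x) \<delta> \<subseteq> f ` ball (\<psi> x) r" by (meson openE)
    moreover have "f ` ball (\<psi> x) r \<subseteq> \<zeta> ` (U \<inter> W)"
    proof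
      fix w assume "w \<in> f ` ball (\<psi> x) r"
      then obtain y where "y \<in> V \<inter> (U \<inter> W)" "w = f (\<psi> y)" using r(2) by blast
      then show "w \<in> \<zeta> ` (U \<inter> W)" using fpsi by auto
    qed
    ultimately show ?thesis by blast
  qed
qed

lemma local_primitive_injective:
  assumes lp: "local_primitive X U \<zeta>" and x: "x \<in> U" "x \<notin> zeros X"
  shows "\<exists>N. openin S N \<and> x \<in> N \<and> N \<subseteq> U \<and> inj_on \<zeta> N"
proof -
  have U: "openin S U" using lp by (simp add: local_primitive_def)
  have "x \<in> topspace S" using openin_subset[OF U] x by blast
  then obtain V \<psi> where c: "(V, \<psi>) \<in> atlas X" "x \<in> V" by (rule chart_exists)
  define f where "f = \<zeta> \<circ> inv_into V \<psi>"
  define D where "D = \<psi> ` (V \<inter> U)"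
  note L = local_primitive_chart[OF lp c(1), folded f_def D_def]
  have "deriv f (\<psi> x) \<noteq> 0" using L(3)[of x] zeros_iff[OF c] x c(2) by auto
  moreover have "\<psi> x \<in> D" using x c by (auto simp: D_def)
  ultimately obtain r where r: "r > 0" "ball (\<psi> x) r \<subseteq> D" "inj_on f (ball (\<psi> x) r)"
    using has_complex_derivative_locally_injective[OF L(2) _ L(1)] by metis
  define N where "N = {y \<in> V. \<psi> y \<in> ball (\<psi> x) r} \<inter> U"
  have "openin S N" unfolding N_def using U by (intro openin_Int chart_preimage_open[OF c(1)]) auto
  moreover have "x \<in> N" using c x r by (auto simp: N_def)
  moreover have "inj_on \<zeta> N"
  proof (rule inj_onI)
    fix y z assume yz: "y \<in> N" "z \<in> N" "\<zeta> y = \<zeta> z"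
    then have "f (\<psi> y) = f (\<psi> z)" using L(4) by (auto simp: N_def)
    then have "\<psi> y = \<psi> z" using r(3) yz by (auto simp: N_def inj_on_def)
    then show "y = z" using chart_inj[OF c(1)] yz by (auto simp: N_def inj_on_def)
  qed
  ultimately show ?thesis by (intro exI[of _ N]) (auto simp: N_def)
qed

end

lemma gauss_small: "z \<in> gauss \<Longrightarrow> cmod z < 1 \<Longrightarrow> z = 0"
proof -
  assume z: "z \<in> gauss" "cmod z < 1"
  obtain m n where mn: "z = Complex (of_int m) (of_int n)" using z(1) by (auto simp: gauss_iff)
  have "\<bar>Re z\<bar> < 1" "\<bar>Im z\<bar> < 1" using z(2) abs_Re_le_cmod[of z] abs_Im_le_cmod[of z] by linarith+
  then have "m = 0" "n = 0" using mn by auto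
  then show ?thesis using mn by (simp add: complex_eq_iff)
qed

section \<open>Saddle connections of a square-tiled surface\<close>

context trans_surf
begin

lemma path_preimage_open:
  assumes "pathin S \<gamma>" "openin S V"
  shows "open {u \<in> {0<..<1}. \<gamma> u \<in> V}"
proof -
  have "openin (top_of_set {0..1}) {u \<in> {0..1}. \<gamma> u \<in> V}"
    using assms unfolding pathin_def continuous_map_def by auto
  then obtain T where T: "open T" "{u \<in> {0..1}. \<gamma> u \<in> V} = {0..1} \<inter> T" by (auto simp: openin_open)
  then have "{u \<in> {0<..<1}. \<gamma> u \<in> V} = {0<..<1} \<inter> T" by force
  then show ?thesis using T(1) by (simp add: open_Int)
qed

lemma velocity_unique:
  assumes "\<gamma> t \<in> topspace S" "has_velocity X \<gamma> t a" "has_velocity X \<gamma> t b"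
  shows "a = b"
proof -
  obtain U \<phi> where c: "(U, \<phi>) \<in> atlas X" "\<gamma> t \<in> U" using chart_exists[OF assms(1)] by blast
  obtain d where d: "((\<phi> \<circ> \<gamma>) has_vector_derivative d) (at t)" "form X (U, \<phi>) (\<phi> (\<gamma> t)) * d = a"
    using assms(2) c unfolding has_velocity_def by blast
  obtain d' where d': "((\<phi> \<circ> \<gamma>) has_vector_derivative d') (at t)" "form X (U, \<phi>) (\<phi> (\<gamma> t)) * d' = b"
    using assms(3) c unfolding has_velocity_def by blast
  show ?thesis using vector_derivative_unique_at[OF d(1) d'(1)] d(2) d'(2) by simp
qed

lemma period_eq:
  assumes "pathin S \<gamma>" "\<And>t. t \<in> {0<..<1} \<Longrightarrow> has_velocity X \<gamma> t a"
  shows "period X \<gamma> = a"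
proof -
  have "\<gamma> t \<in> topspace S" if "t \<in> {0..1}" for t using assms(1) that by (auto simp: pathin_def continuous_map_def)
  then have the: "(THE a. has_velocity X \<gamma> t a) = a" if "t \<in> {0<..<1}" for t
    using assms(2)[OF that] velocity_unique[of \<gamma> t] that by (intro the_equality) auto
  \<comment> \<open>At 0 and 1, where no velocity is assumed, \<open>THE\<close> may return
    anything; the two points form a null set.\<close>
  have "integral {0..1} (\<lambda>t. THE a. has_velocity X \<gamma> t a) = integral {0..1} (\<lambda>t::real. a)"
    by (rule integral_spike[of "{0, 1}"]) (use the in \<open>auto simp: less_le\<close>)
  then show ?thesis by (simp add: period_def)
qed

lemma Hol_iff:
  "v \<in> Hol X \<longleftrightarrow> v \<noteq> 0 \<and> (\<exists>\<gamma>. pathin S \<gamma> \<and> \<gamma> 0 \<in> sing X \<and> \<gamma> 1 \<in> sing X \<and> (\<forall>t\<in>{0<..<1}. \<gamma> t \<notin> sing X) \<and>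
    (\<forall>t\<in>{0<..<1}. has_velocity X \<gamma> t v))"
proof
  assume "v \<in> Hol X"
  then obtain \<gamma> where \<gamma>: "saddle_connection X \<gamma>" "v = period X \<gamma>" unfolding Hol_def by blast
  then obtain a where a: "a \<noteq> 0" "\<forall>t\<in>{0<..<1}. has_velocity X \<gamma> t a" unfolding saddle_connection_def by blast
  have "v = a" using \<gamma> a period_eq[of \<gamma> a] unfolding saddle_connection_def by blast
  then show "v \<noteq> 0 \<and> (\<exists>\<gamma>. pathin S \<gamma> \<and> \<gamma> 0 \<in> sing X \<and> \<gamma> 1 \<in> sing X \<and> (\<forall>t\<in>{0<..<1}. \<gamma> t \<notin> sing X) \<and>
    (\<forall>t\<in>{0<..<1}. has_velocity X \<gamma> t v))" using \<gamma> a unfolding saddle_connection_def by blast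
next
  assume r: "v \<noteq> 0 \<and> (\<exists>\<gamma>. pathin S \<gamma> \<and> \<gamma> 0 \<in> sing X \<and> \<gamma> 1 \<in> sing X \<and> (\<forall>t\<in>{0<..<1}. \<gamma> t \<notin> sing X) \<and>
    (\<forall>t\<in>{0<..<1}. has_velocity X \<gamma> t v))"
  then obtain \<gamma> where \<gamma>: "pathin S \<gamma>" "\<gamma> 0 \<in> sing X" "\<gamma> 1 \<in> sing X" "\<forall>t\<in>{0<..<1}. \<gamma> t \<notin> sing X"
    "\<forall>t\<in>{0<..<1}. has_velocity X \<gamma> t v" by blast
  have "period X \<gamma> = v" using \<gamma> by (intro period_eq) auto
  moreover have "saddle_connection X \<gamma>" using \<gamma> r unfolding saddle_connection_def by blast
  ultimately show "v \<in> Hol X" unfolding Hol_def by blast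
qed

lemma primitive_velocity:
  assumes lp: "local_primitive X U \<zeta>" and \<gamma>: "pathin S \<gamma>" and t: "t \<in> {0<..<1}" "\<gamma> t \<in> U"
    and v: "has_velocity X \<gamma> t a"
  shows "((\<zeta> \<circ> \<gamma>) has_vector_derivative a) (at t)"
proof -
  have "openin S U" using lp by (simp add: local_primitive_def)
  then have "\<gamma> t \<in> topspace S" using openin_subset t(2) by blast
  then obtain V \<psi> where c: "(V, \<psi>) \<in> atlas X" "\<gamma> t \<in> V" by (rule chart_exists)
  obtain d where d: "((\<psi> \<circ> \<gamma>) has_vector_derivative d) (at t)" "form X (V, \<psi>) (\<psi> (\<gamma> t)) * d = a"
    using v c unfolding has_velocity_def by blast
  have "((\<zeta> \<circ> inv_into V \<psi>) has_field_derivative form X (V, \<psi>) (\<psi> (\<gamma> t))) (at ((\<psi> \<circ> \<gamma>) t))"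
    using local_primitive_chart(5)[OF lp c(1), of "\<gamma> t"] c(2) t(2) by simp
  from field_vector_diff_chain_at[OF d(1) this]
  have "((\<zeta> \<circ> inv_into V \<psi> \<circ> (\<psi> \<circ> \<gamma>)) has_vector_derivative a) (at t)" unfolding mult.commute[of d] d(2) .
  moreover have "open {u \<in> {0<..<1}. \<gamma> u \<in> V}" by (rule path_preimage_open[OF \<gamma> chart(1)[OF c(1)]])
  ultimately show ?thesis
    by (rule has_vector_derivative_transform_within_open[where S = "{u \<in> {0<..<1}. \<gamma> u \<in> V}"]) (use c t in auto)
qed

end

locale square_tiling = trans_surf X for X :: "'a surface" +
  fixes p :: "'a \<Rightarrow> complex \<times> complex"
  assumes cov': "covering_off_origin S p"
    and prim: "x \<in> topspace S \<Longrightarrow> \<exists>U \<zeta>. x \<in> U \<and> local_primitive X U \<zeta> \<and> (\<forall>y\<in>U. p y = torus_proj (\<zeta> y))"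
    and sing_p: "x \<in> sing X \<Longrightarrow> p x = torus_proj 0"
begin

text \<open>Values of \<zeta> at distance less than 1 cannot differ by a nonzero lattice vector, so
  near x equality under p is equality under \<zeta>. This includes the branch points.\<close>

lemma p_isolated:
  assumes "x \<in> topspace S"
  shows "\<exists>N. openin S N \<and> x \<in> N \<and> (\<forall>y\<in>N. p y = p x \<longrightarrow> y = x)"
proof -
  obtain U \<zeta> where U: "x \<in> U" "local_primitive X U \<zeta>" "\<forall>y\<in>U. p y = torus_proj (\<zeta> y)" using prim[OF assms] by blast
  obtain N where N: "openin S N" "x \<in> N" "N \<subseteq> U" "\<forall>y\<in>N. \<zeta> y = \<zeta> x \<longrightarrow> y = x"
    using local_primitive_isolated(1)[OF U(2,1)] by blast
  define N' where "N' = N \<inter> {y \<in> U. \<zeta> y \<in> ball (\<zeta> x) 1}"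
  have "openin S N'" unfolding N'_def using N(1) by (intro openin_Int local_primitive_continuous[OF U(2)]) auto
  moreover have "x \<in> N'" using N U by (simp add: N'_def)
  moreover have "y = x" if "y \<in> N'" "p y = p x" for y
  proof -
    have "\<zeta> y - \<zeta> x \<in> gauss" using that U by (simp add: N'_def torus_proj_eq_iff)
    moreover have "cmod (\<zeta> y - \<zeta> x) < 1" using that by (simp add: N'_def dist_norm norm_minus_commute)
    ultimately have "\<zeta> y = \<zeta> x" using gauss_small[of "\<zeta> y - \<zeta> x"] by simp
    then show ?thesis using N(4) that by (simp add: N'_def)
  qed
  ultimately show ?thesis by (intro exI[of _ N'] conjI ballI impI)
qed

sublocale torus_cover S p "sing X"
proof
  show "Hausdorff_space S" by (rule hausd)
  show "compact_space S" by (rule cs)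
  show "covering_off_origin S p" by (rule cov')
  show "sing X \<subseteq> topspace S" by (rule sing_sub)
  show "sing X \<noteq> {}" by (rule sing_nonempty)
  show "p x = torus_proj 0" if "x \<in> sing X" for x using sing_p[OF that] .
  have "continuous_map S euclidean p"
    using cov' unfolding covering_off_origin_def torus_def by (simp add: continuous_map_in_subtopology)
  then have cl: "closedin S {x \<in> topspace S. p x \<in> {torus_proj 0}}"
    by (rule closedin_continuous_map_preimage) simp
  have "finite {x \<in> topspace S. p x \<in> {torus_proj 0}}"
  proof (rule finite_of_isolated[OF cs cl])
    fix x assume x: "x \<in> {x \<in> topspace S. p x \<in> {torus_proj 0}}"
    then have xt: "x \<in> topspace S" and x0: "p x = torus_proj 0" by auto
    obtain N where N: "openin S N \<and> x \<in> N \<and> (\<forall>y\<in>N. p y = p x \<longrightarrow> y = x)" using p_isolated[OF xt] by (elim exE)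
    then show "\<exists>U. openin S U \<and> x \<in> U \<and> U \<inter> {x \<in> topspace S. p x \<in> {torus_proj 0}} \<subseteq> {x}"
      using x0 by (intro exI[of _ N]) auto
  qed
  then show "finite {x \<in> topspace S. p x = torus_proj 0}" by simp
next
  fix x assume x: "x \<in> topspace S" "x \<notin> sing X"
  obtain U \<zeta> where U: "x \<in> U" "local_primitive X U \<zeta>" "\<forall>y\<in>U. p y = torus_proj (\<zeta> y)" using prim[OF x(1)] by blast
  obtain N where N: "openin S N" "x \<in> N" "N \<subseteq> U" "inj_on \<zeta> N"
    using local_primitive_injective[OF U(2,1)] x(2) zeros_sub_sing by blast
  define N' where "N' = N \<inter> {y \<in> U. \<zeta> y \<in> ball (\<zeta> x) (1/2)}"
  have "openin S N'" unfolding N'_def using N(1) by (intro openin_Int local_primitive_continuous[OF U(2)]) auto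
  moreover have "x \<in> N'" using N U by (simp add: N'_def)
  moreover have "inj_on p N'"
  proof (rule inj_onI)
    fix y z assume yz: "y \<in> N'" "z \<in> N'" "p y = p z"
    then have "\<zeta> y - \<zeta> z \<in> gauss" using U by (simp add: N'_def torus_proj_eq_iff)
    moreover have "dist (\<zeta> y) (\<zeta> z) < 1"
      using yz dist_triangle3[of "\<zeta> y" "\<zeta> z" "\<zeta> x"] by (simp add: N'_def)
    then have "cmod (\<zeta> y - \<zeta> z) < 1" by (simp add: dist_norm)
    ultimately have "\<zeta> y = \<zeta> z" using gauss_small[of "\<zeta> y - \<zeta> z"] by simp
    then show "y = z" using N(4) yz by (auto simp: N'_def inj_on_def)
  qed
  ultimately show "\<exists>U. openin S U \<and> x \<in> U \<and> inj_on p U" by blast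
next
  fix U0 x assume U0: "openin S U0" "x \<in> U0" "p x = torus_proj 0"
  then have "x \<in> topspace S" using openin_subset by blast
  then obtain U \<zeta> where U: "x \<in> U" "local_primitive X U \<zeta>" "\<forall>y\<in>U. p y = torus_proj (\<zeta> y)" using prim by blast
  obtain \<delta> where \<delta>: "\<delta> > 0" "ball (\<zeta> x) \<delta> \<subseteq> \<zeta> ` (U \<inter> U0)"
    using local_primitive_isolated(2)[OF U(2,1) U0(1,2)] by blast
  have zx: "\<zeta> x \<in> gauss" using U U0(3) torus_proj_eq_0_iff[of "\<zeta> x"] by simp
  have "\<exists>y\<in>U0. p y = torus_proj (of_real \<epsilon>)" if "\<epsilon> \<in> {0<..<\<delta>}" for \<epsilon>
  proof -
    have "\<zeta> x + of_real \<epsilon> \<in> ball (\<zeta> x) \<delta>" using that by (simp add: dist_norm)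
    then obtain y where y: "y \<in> U \<inter> U0" "\<zeta> y = \<zeta> x + of_real \<epsilon>" using \<delta>(2) by (metis imageE subsetD)
    have "p y = torus_proj (of_real \<epsilon> + \<zeta> x)" using U(3) y by (simp add: add.commute)
    then have "p y = torus_proj (of_real \<epsilon>)" using torus_proj_add_gauss[OF zx] by simp
    then show ?thesis using y by blast
  qed
  then show "\<exists>\<delta>>0. \<forall>\<epsilon>\<in>{0<..<\<delta>}. \<exists>y\<in>U0. p y = torus_proj (of_real \<epsilon>)" using \<delta>(1) by blast
qed

text \<open>\<open>w\<close> is the quotient of \<open>p (\<gamma> t)\<close> by the image of t a in
  the group of pairs of unit complex numbers. In the interior a local primitive along \<gamma> grows
  with velocity a, so \<open>w\<close> is locally constant there; by continuity it keeps its initial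
  value (1, 1).\<close>

lemma Hol_imp_saddle_vec:
  assumes "a \<in> Hol X"
  shows "saddle_vec a"
proof -
  obtain \<gamma> where a: "a \<noteq> 0" and \<gamma>: "pathin S \<gamma>" "\<gamma> 0 \<in> sing X" "\<gamma> 1 \<in> sing X" "\<forall>t\<in>{0<..<1}. \<gamma> t \<notin> sing X"
    "\<forall>t\<in>{0<..<1}. has_velocity X \<gamma> t a" using assms unfolding Hol_iff by blast
  have cm: "continuous_map (top_of_set {0..1}) S \<gamma>" using \<gamma>(1) by (simp add: pathin_def)
  have gt: "\<gamma> t \<in> topspace S" if "t \<in> {0..1}" for t using cm that by (auto simp: continuous_map_def)
  have cp: "continuous_on {0..1} (\<lambda>t. p (\<gamma> t))"
    using continuous_map_compose[OF cm p_continuous] by (simp add: comp_def)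
  define w where "w t = (fst (p (\<gamma> t)) / cis (2 * pi * (t * Re a)), snd (p (\<gamma> t)) / cis (2 * pi * (t * Im a)))" for t
  have cw: "continuous_on {0..1} w"
    unfolding w_def by (intro continuous_intros cp) auto
  have w0: "w 0 = (1, 1)" using sing_p[OF \<gamma>(2)] by (simp add: w_def torus_proj_def)
  have "w t = (1, 1)" if t: "t \<in> {0..1}" for t
  proof (rule has_derivative_zero_unique_strong_interval[of "{0, 1}" 0 1 w "(1,1)"])
    show "finite {0, 1::real}" "continuous_on {0..1} w" "w 0 = (1, 1)" "t \<in> {0..1}" using cw w0 t by auto
    fix t :: real assume t: "t \<in> {0..1} - {0, 1}"
    then have t': "t \<in> {0<..<1}" by auto
    obtain U \<zeta> where U: "\<gamma> t \<in> U" "local_primitive X U \<zeta>" "\<forall>y\<in>U. p y = torus_proj (\<zeta> y)"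
      using prim[OF gt[of t]] t by auto
    have "openin S U" using U(2) by (simp add: local_primitive_def)
    then have "open {u \<in> {0<..<1}. \<gamma> u \<in> U}" by (rule path_preimage_open[OF \<gamma>(1)])
    moreover have "t \<in> {u \<in> {0<..<1}. \<gamma> u \<in> U}" using t' U by simp
    ultimately obtain r where r: "r > 0" "ball t r \<subseteq> {u \<in> {0<..<1}. \<gamma> u \<in> U}" by (meson openE)
    have d0: "((\<lambda>u. (\<zeta> \<circ> \<gamma>) u - of_real u * a) has_vector_derivative 0) (at u within ball t r)" if "u \<in> ball t r" for u
    proof -
      have u: "u \<in> {0<..<1}" "\<gamma> u \<in> U" using r that by auto
      have "((\<zeta> \<circ> \<gamma>) has_vector_derivative a) (at u)"
        by (rule primitive_velocity[OF U(2) \<gamma>(1) u]) (use \<gamma>(5) u in blast)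
      moreover have "((\<lambda>u. of_real u * a) has_vector_derivative 1 * a) (at u)"
        by (auto intro!: derivative_eq_intros)
      ultimately have "((\<lambda>u. (\<zeta> \<circ> \<gamma>) u - of_real u * a) has_vector_derivative (a - 1 * a)) (at u)"
        by (rule has_vector_derivative_diff)
      then have "((\<lambda>u. (\<zeta> \<circ> \<gamma>) u - of_real u * a) has_vector_derivative 0) (at u)" by (simp only: mult_1 diff_self)
      then show ?thesis by (rule has_vector_derivative_at_within)
    qed
    obtain k where k: "\<And>u. u \<in> ball t r \<Longrightarrow> (\<zeta> \<circ> \<gamma>) u - of_real u * a = k"
    proof (rule has_vector_derivative_zero_constant[OF convex_ball d0])
      fix k assume "\<And>u. u \<in> ball t r \<Longrightarrow> (\<zeta> \<circ> \<gamma>) u - of_real u * a = k"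
      then show thesis by (rule that)
    qed
    have "w u = torus_proj k" if u: "u \<in> ball t r" for u
    proof -
      have "\<zeta> (\<gamma> u) = k + of_real u * a" using k[OF u] by (simp add: diff_eq_eq)
      moreover have "\<gamma> u \<in> U" using r(2) u by blast
      ultimately have "p (\<gamma> u) = torus_proj (k + of_real u * a)" using U(3) by simp
      then show ?thesis by (simp add: w_def torus_proj_def cis_divide algebra_simps)
    qed
    then have "(w has_derivative (\<lambda>h. 0)) (at t)"
      by (intro has_derivative_transform_within_open[OF has_derivative_const, of "ball t r"]) (use r in auto)
    then show "(w has_derivative (\<lambda>h. 0)) (at t within {0..1})" by (rule has_derivative_at_withinI)
  qed
  then have "p (\<gamma> t) = torus_proj (of_real t * a)" if "t \<in> {0..1}" for t
    using that by (simp add: w_def torus_proj_def prod_eq_iff)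
  then show ?thesis unfolding saddle_vec_def using a \<gamma> cm by blast
qed

text \<open>The path is only known to be continuous; its differentiability comes from the covering.
  Near a regular point \<zeta> along \<gamma> must be affine, because its deviation from t v is
  lattice valued up to a constant and varies little. Composing with a local holomorphic inverse
  gives the velocity in the chart.\<close>

lemma saddle_vec_imp_Hol:
  assumes "saddle_vec v"
  shows "v \<in> Hol X"
proof -
  obtain \<gamma> where v: "v \<noteq> 0" and cm: "continuous_map (top_of_set {0..1}) S \<gamma>" and \<gamma>: "\<gamma> 0 \<in> sing X" "\<gamma> 1 \<in> sing X"
    "\<forall>t\<in>{0<..<1}. \<gamma> t \<notin> sing X" "\<forall>t\<in>{0..1}. p (\<gamma> t) = torus_proj (of_real t * v)" using assms unfolding saddle_vec_def by blast
  have pa: "pathin S \<gamma>" using cm by (simp add: pathin_def)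
  have gt: "\<gamma> t \<in> topspace S" if "t \<in> {0..1}" for t using cm that by (auto simp: continuous_map_def)
  have "has_velocity X \<gamma> t v" if t: "t \<in> {0<..<1}" for t
    unfolding has_velocity_def
  proof (clarify)
    fix V \<psi> assume c: "(V, \<psi>) \<in> atlas X" "\<gamma> t \<in> V"
    obtain U \<zeta> where U: "\<gamma> t \<in> U" "local_primitive X U \<zeta>" "\<forall>y\<in>U. p y = torus_proj (\<zeta> y)"
      using prim[OF gt[of t]] t by auto
    define f where "f = \<zeta> \<circ> inv_into V \<psi>"
    define D where "D = \<psi> ` (V \<inter> U)"
    note L = local_primitive_chart[OF U(2) c(1), folded f_def D_def]
    define h where "h = form X (V, \<psi>) (\<psi> (\<gamma> t))"
    have h: "h \<noteq> 0" using zeros_iff[OF c] zeros_sub_sing \<gamma>(3) t unfolding h_def by blast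
    have dh: "deriv f (\<psi> (\<gamma> t)) = h" unfolding h_def by (rule L(3)) (use c U in blast)
    have tD: "\<psi> (\<gamma> t) \<in> D" using c U by (auto simp: D_def)
    obtain r where r: "r > 0" "ball (\<psi> (\<gamma> t)) r \<subseteq> D" "inj_on f (ball (\<psi> (\<gamma> t)) r)"
      using has_complex_derivative_locally_injective[OF L(2) tD L(1)] dh h by metis
    define B where "B = ball (\<psi> (\<gamma> t)) r"
    have fB: "f holomorphic_on B" using L(2) r(2) holomorphic_on_subset unfolding B_def by blast
    obtain g where g: "g holomorphic_on (f ` B)" "\<And>z. z \<in> B \<Longrightarrow> deriv f z * deriv g (f z) = 1" "\<And>z. z \<in> B \<Longrightarrow> g (f z) = z"
      using holomorphic_has_inverse[OF fB] r(3) unfolding B_def by (metis open_ball)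
    have oB: "open (f ` B)" by (rule open_mapping_thm3[OF fB]) (use r(3) in \<open>auto simp: B_def\<close>)
    have tB: "\<psi> (\<gamma> t) \<in> B" using r by (simp add: B_def)
    define k where "k = \<zeta> (\<gamma> t) - of_real t * v"
    \<comment> \<open>The radii 1/2 and 1 / (2 |v|) bound the two contributions to the change of
      \<zeta> - u v by 1/2 each, the first one strictly, so \<open>gauss_small\<close>
      applies.\<close>
    define T where "T = {u \<in> {0<..<1}. \<gamma> u \<in> {y \<in> V. \<psi> y \<in> B}} \<inter> {u \<in> {0<..<1}. \<gamma> u \<in> {y \<in> U. \<zeta> y \<in> ball (\<zeta> (\<gamma> t)) (1/2)}}
       \<inter> ball t (1 / (2 * cmod v))"
    have T: "open T"
      unfolding T_def by (intro open_Int path_preimage_open[OF pa] chart_preimage_open[OF c(1)] local_primitive_continuous[OF U(2)]) (auto simp: B_def)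
    have tT: "t \<in> T" using t c U tB v by (simp add: T_def)
    have lin: "\<zeta> (\<gamma> u) = of_real u * v + k" if u: "u \<in> T" for u
    proof -
      have "torus_proj (\<zeta> (\<gamma> u)) = torus_proj (of_real u * v)" "torus_proj (\<zeta> (\<gamma> t)) = torus_proj (of_real t * v)"
        using U(1,3) \<gamma>(4) u t by (auto simp: T_def)
      then have "(\<zeta> (\<gamma> u) - of_real u * v) - (\<zeta> (\<gamma> t) - of_real t * v) \<in> gauss"
        unfolding torus_proj_eq_iff by (rule gauss_diff)
      moreover have "cmod ((\<zeta> (\<gamma> u) - of_real u * v) - (\<zeta> (\<gamma> t) - of_real t * v)) < 1"
      proof -
        have "(\<zeta> (\<gamma> u) - of_real u * v) - (\<zeta> (\<gamma> t) - of_real t * v) = (\<zeta> (\<gamma> u) - \<zeta> (\<gamma> t)) - of_real (u - t) * v"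
          by (simp add: algebra_simps)
        also have "cmod \<dots> \<le> cmod (\<zeta> (\<gamma> u) - \<zeta> (\<gamma> t)) + \<bar>u - t\<bar> * cmod v"
          by (rule order_trans[OF norm_triangle_ineq4]) (simp add: norm_mult del: of_real_diff)
        also have "\<dots> < 1/2 + 1/2"
        proof (intro add_less_le_mono)
          show "cmod (\<zeta> (\<gamma> u) - \<zeta> (\<gamma> t)) < 1/2" using u by (simp add: T_def dist_norm norm_minus_commute)
          have "\<bar>u - t\<bar> < 1 / (2 * cmod v)" using u by (simp add: T_def dist_real_def abs_minus_commute)
          then show "\<bar>u - t\<bar> * cmod v \<le> 1/2" using v by (simp add: field_simps)
        qed
        finally show ?thesis by simp
      qed
      ultimately have "(\<zeta> (\<gamma> u) - of_real u * v) - (\<zeta> (\<gamma> t) - of_real t * v) = 0" by (rule gauss_small)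
      then show ?thesis by (simp add: k_def algebra_simps)
    qed
    have eq: "g (of_real u * v + k) = (\<psi> \<circ> \<gamma>) u" if u: "u \<in> T" for u
    proof -
      have "\<gamma> u \<in> V" "\<psi> (\<gamma> u) \<in> B" using u by (auto simp: T_def)
      then show ?thesis using g(3)[of "\<psi> (\<gamma> u)"] L(4)[of "\<gamma> u"] lin[OF u] by simp
    qed
    have ft: "f (\<psi> (\<gamma> t)) = of_real t * v + k" using L(4)[OF c(2)] lin[OF tT] by simp
    then have "of_real t * v + k \<in> f ` B" using tB by (metis imageI)
    then have "(g has_field_derivative deriv g (of_real t * v + k)) (at (of_real t * v + k))"
      using g(1) oB holomorphic_derivI by blast
    moreover have "deriv g (of_real t * v + k) = 1 / h" using g(2)[OF tB] dh h unfolding ft by (simp add: field_simps)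
    ultimately have gd: "(g has_field_derivative 1 / h) (at (of_real t * v + k))" by simp
    have "((\<lambda>u. of_real u * v + k) has_vector_derivative 1 * v + 0) (at t)"
      by (auto intro!: derivative_eq_intros)
    then have "((\<lambda>u. of_real u * v + k) has_vector_derivative v) (at t)" by simp
    from field_vector_diff_chain_at[OF this, of g "1 / h"] gd
    have "((g \<circ> (\<lambda>u. of_real u * v + k)) has_vector_derivative v * (1 / h)) (at t)" by simp
    then have "((\<psi> \<circ> \<gamma>) has_vector_derivative v * (1 / h)) (at t)"
      by (rule has_vector_derivative_transform_within_open[OF _ T tT]) (use eq in simp)
    then show "\<exists>d. ((\<psi> \<circ> \<gamma>) has_vector_derivative d) (at t) \<and> form X (V, \<psi>) (\<psi> (\<gamma> t)) * d = v"
      using h by (intro exI[of _ "v * (1 / h)"]) (simp add: h_def)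
  qed
  then show ?thesis unfolding Hol_iff using v pa \<gamma> by blast
qed

lemma Hol_eq: "Hol X = {v. saddle_vec v}"
  using Hol_imp_saddle_vec saddle_vec_imp_Hol by blast

end

section \<open>Rotations and area\<close>

definition rot :: "complex \<Rightarrow> 'a surface \<Rightarrow> 'a surface" where
  "rot c X = X\<lparr>form := \<lambda>k z. c * form X k z\<rparr>"

lemma rot_simps [simp]:
  "top_of (rot c X) = top_of X" "atlas (rot c X) = atlas X" "sing (rot c X) = sing X"
  "form (rot c X) k z = c * form X k z"
  by (simp_all add: rot_def)

lemma rot_rot: "c * d = 1 \<Longrightarrow> rot c (rot d X) = X"
  by (simp add: rot_def mult.assoc[symmetric])

lemma rot_local_primitive: "local_primitive X U \<zeta> \<Longrightarrow> local_primitive (rot c X) U (\<lambda>x. c * \<zeta> x)"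
  unfolding local_primitive_def rot_simps comp_def by (fast intro: DERIV_cmult)

lemma rot_translation_charts:
  "c \<noteq> 0 \<Longrightarrow> (U, \<zeta>) \<in> translation_charts X \<Longrightarrow> (U, \<lambda>x. c * \<zeta> x) \<in> translation_charts (rot c X)"
  by (auto simp: translation_charts_def rot_local_primitive inj_on_def)

context trans_surf
begin

lemma rot_translation_surface:
  assumes "c \<noteq> 0" shows "translation_surface (rot c X)"
proof -
  have z: "zeros (rot c X) = zeros X" using assms by (simp add: zeros_def)
  have "holomorphic_form (atlas X) (form (rot c X))"
    using hf unfolding holomorphic_form_def rot_simps by (fastforce intro: holomorphic_on_mult simp: mult.assoc)
  moreover have "\<exists>(U, \<phi>)\<in>atlas X. \<exists>x\<in>U. form (rot c X) (U, \<phi>) (\<phi> x) \<noteq> 0"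
    using nonzero assms by simp
  ultimately show ?thesis using rs cs sing_zeros unfolding translation_surface_def z rot_simps by blast
qed

lemma rot_Hol:
  assumes c: "c \<noteq> 0" shows "Hol (rot c X) = (*) c ` Hol X"
proof -
  interpret Y: trans_surf "rot c X" using rot_translation_surface[OF c] by unfold_locales
  have hv: "has_velocity (rot c X) \<gamma> t (c * a) \<longleftrightarrow> has_velocity X \<gamma> t a" for \<gamma> t a
    unfolding has_velocity_def rot_simps using c by (simp add: mult.assoc)
  have "c * a \<in> Hol (rot c X) \<longleftrightarrow> a \<in> Hol X" for a
    unfolding Y.Hol_iff Hol_iff rot_simps hv using c by simp
  moreover have "v = c * (v / c)" for v using c by simp
  ultimately show ?thesis by (metis (no_types, lifting) imageE image_eqI subsetI subset_antisym)
qed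

lemma translation_chart_image_open:
  assumes "(U, \<zeta>) \<in> translation_charts X" and W: "openin S W"
  shows "open (\<zeta> ` (U \<inter> W))"
proof -
  have lp: "local_primitive X U \<zeta>" and inj: "inj_on \<zeta> U" using assms by (auto simp: translation_charts_def)
  have U: "openin S U" using lp by (simp add: local_primitive_def)
  have "open (\<zeta> ` (V \<inter> (U \<inter> W)))" if c: "(V, \<psi>) \<in> atlas X" for V \<psi>
  proof -
    define f where "f = \<zeta> \<circ> inv_into V \<psi>"
    note L = local_primitive_chart[OF lp c, folded f_def]
    have o: "open (\<psi> ` (V \<inter> (U \<inter> W)))" using U W by (intro chart_image_open[OF c]) auto
    have "f holomorphic_on \<psi> ` (V \<inter> (U \<inter> W))" by (rule holomorphic_on_subset[OF L(2)]) auto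
    moreover have "inj_on f (\<psi> ` (V \<inter> (U \<inter> W)))"
      using inj L(4) by (auto simp: inj_on_def)
    ultimately have "open (f ` (\<psi> ` (V \<inter> (U \<inter> W))))" using o by (intro open_mapping_thm3)
    moreover have "f ` (\<psi> ` (V \<inter> (U \<inter> W))) = \<zeta> ` (V \<inter> (U \<inter> W))"
      unfolding image_image by (rule image_cong) (use L(4) in auto)
    ultimately show ?thesis by simp
  qed
  then have "open (\<Union>(V, \<psi>)\<in>atlas X. \<zeta> ` (V \<inter> (U \<inter> W)))" by (intro open_UN) auto
  moreover have "(\<Union>(V, \<psi>)\<in>atlas X. \<zeta> ` (V \<inter> (U \<inter> W))) = \<zeta> ` (U \<inter> W)"
  proof
    show "\<zeta> ` (U \<inter> W) \<subseteq> (\<Union>(V, \<psi>)\<in>atlas X. \<zeta> ` (V \<inter> (U \<inter> W)))"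
    proof
      fix z assume "z \<in> \<zeta> ` (U \<inter> W)"
      then obtain x where x: "x \<in> U \<inter> W" "z = \<zeta> x" by blast
      have "x \<in> topspace S" using x(1) openin_subset[OF U] by blast
      then obtain V \<psi> where "(V, \<psi>) \<in> atlas X" "x \<in> V" by (rule chart_exists)
      then show "z \<in> (\<Union>(V, \<psi>)\<in>atlas X. \<zeta> ` (V \<inter> (U \<inter> W)))" using x by (intro UN_I[of "(V, \<psi>)"]) auto
    qed
  qed auto
  ultimately show ?thesis by simp
qed

section \<open>Positivity and finiteness of the area\<close>

definition families :: "'a chart set set" where
  "families = {F. finite F \<and> F \<subseteq> translation_charts X \<and> pairwise (\<lambda>c d. disjnt (fst c) (fst d)) F}"

text \<open>The area before \<open>enn2real\<close>, which would turn an infinite value into 0;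
  positivity of the real area therefore requires finiteness here.\<close>

definition area_ennreal :: ennreal where
  "area_ennreal = (SUP F \<in> families. \<Sum>(U, \<zeta>)\<in>F. emeasure lborel (\<zeta> ` U))"

lemma area_eq: "area X = enn2real area_ennreal"
  by (simp add: area_def area_ennreal_def families_def)

lemma area_pos: "0 < area_ennreal"
  if prim: "\<And>x. x \<in> topspace S \<Longrightarrow> \<exists>U \<zeta>. x \<in> U \<and> local_primitive X U \<zeta>"
proof -
  obtain V \<psi> x where c: "(V, \<psi>) \<in> atlas X" "x \<in> V" "form X (V, \<psi>) (\<psi> x) \<noteq> 0" using nonzero by blast
  have x: "x \<in> topspace S" "x \<notin> zeros X" using c chart_subset zeros_iff by blast+
  obtain U \<zeta> where U: "x \<in> U" "local_primitive X U \<zeta>" using prim[OF x(1)] by blast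
  obtain N where N: "openin S N" "x \<in> N" "N \<subseteq> U" "inj_on \<zeta> N" using local_primitive_injective[OF U(2,1) x(2)] by blast
  have "local_primitive X N \<zeta>" using U(2) N unfolding local_primitive_def by fast
  then have t: "(N, \<zeta>) \<in> translation_charts X" using N by (simp add: translation_charts_def)
  have "open (\<zeta> ` N)" using translation_chart_image_open[OF t N(1)] by simp
  moreover have "\<zeta> ` N \<noteq> {}" using N by blast
  ultimately have "\<not> negligible (\<zeta> ` N)" by (rule open_not_negligible)
  then have "emeasure lborel (\<zeta> ` N) \<noteq> 0"
    using \<open>open (\<zeta> ` N)\<close> by (auto simp: negligible_iff_null_sets null_sets_def)
  then have "0 < (\<Sum>(U, \<zeta>)\<in>{(N, \<zeta>)}. emeasure lborel (\<zeta> ` U))" by (simp add: zero_less_iff_neq_zero)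
  also have "\<dots> \<le> area_ennreal"
    unfolding area_ennreal_def by (rule SUP_upper) (use t in \<open>simp add: families_def\<close>)
  finally show ?thesis .
qed

text \<open>In one chart disc the derivative of a translation chart is the coefficient of the form,
  bounded by some B. The pieces of a disjoint family inside the disc have disjoint coordinate
  images, so together they contribute at most B^2 times the area of the disc.\<close>

lemma area_piece:
  assumes "x \<in> topspace S"
  shows "\<exists>W K. openin S W \<and> x \<in> W \<and> K < (\<infinity>::ennreal) \<and>
    (\<forall>F\<in>families. (\<Sum>(U, \<zeta>)\<in>F. emeasure lborel (\<zeta> ` (U \<inter> W))) \<le> K)"
proof -
  obtain V \<psi> where c: "(V, \<psi>) \<in> atlas X" "x \<in> V" using chart_exists[OF assms] by blast
  obtain r where r: "r > 0" "cball (\<psi> x) r \<subseteq> \<psi> ` V" using chart(2)[OF c(1)] c(2) by (meson imageI open_contains_cball)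
  have "continuous_on (cball (\<psi> x) r) (form X (V, \<psi>))"
    using chart(4)[OF c(1)] r(2) holomorphic_on_imp_continuous_on holomorphic_on_subset by blast
  then have "bounded (form X (V, \<psi>) ` cball (\<psi> x) r)" by (intro compact_imp_bounded compact_continuous_image) auto
  then obtain B where B: "B > 0" "\<And>z. z \<in> cball (\<psi> x) r \<Longrightarrow> cmod (form X (V, \<psi>) z) \<le> B"
    unfolding bounded_pos by auto
  define W where "W = {y \<in> V. \<psi> y \<in> ball (\<psi> x) r}"
  have W: "openin S W" unfolding W_def by (rule chart_preimage_open[OF c(1)]) simp
  define K where "K = ennreal (B\<^sup>2) * emeasure lborel (ball (\<psi> x) r)"
  have "emeasure lborel (ball (\<psi> x) r) < \<infinity>" using emeasure_lborel_ball_finite by (simp add: less_top)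
  then have K: "K < \<infinity>" unfolding K_def by (simp add: ennreal_mult_less_top)
  have "(\<Sum>(U, \<zeta>)\<in>F. emeasure lborel (\<zeta> ` (U \<inter> W))) \<le> K" if F: "F \<in> families" for F
  proof -
    have fin: "finite F" and sub: "F \<subseteq> translation_charts X" and disj: "pairwise (\<lambda>c d. disjnt (fst c) (fst d)) F"
      using F by (auto simp: families_def)
    define P where "P k = \<psi> ` (V \<inter> (fst k \<inter> W))" for k :: "'a chart"
    have oU: "openin S (fst k)" if "k \<in> F" for k
      using that sub by (cases k) (auto simp: translation_charts_def local_primitive_def)
    have P: "open (P k)" if "k \<in> F" for k unfolding P_def using W oU[OF that] by (intro chart_image_open[OF c(1)]) auto
    have le: "emeasure lborel (snd k ` (fst k \<inter> W)) \<le> ennreal (B\<^sup>2) * emeasure lborel (P k)" if k: "k \<in> F" for k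
    proof -
      obtain U \<zeta> where k': "k = (U, \<zeta>)" by force
      have lp: "local_primitive X U \<zeta>" and inj: "inj_on \<zeta> U" using k sub k' by (auto simp: translation_charts_def)
      define f where "f = \<zeta> \<circ> inv_into V \<psi>"
      note L = local_primitive_chart[OF lp c(1), folded f_def]
      have "emeasure lborel (f ` P k) \<le> ennreal (B\<^sup>2) * emeasure lborel (P k)"
      proof (rule emeasure_holomorphic_image_le)
        show "open (P k)" by (rule P[OF k])
        show "f holomorphic_on P k" by (rule holomorphic_on_subset[OF L(2)]) (auto simp: P_def k')
        show "inj_on f (P k)" using inj L(4) by (auto simp: P_def k' inj_on_def)
        fix z assume "z \<in> P k"
        then obtain y where y: "y \<in> V" "y \<in> U" "y \<in> W" "z = \<psi> y" by (auto simp: P_def k')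
        then have "deriv f z = form X (V, \<psi>) z" using L(3) by auto
        moreover have "z \<in> cball (\<psi> x) r" using y by (simp add: W_def)
        ultimately show "cmod (deriv f z) \<le> B" using B(2) by simp
      qed (rule B(1))
      moreover have "f ` P k = \<zeta> ` (U \<inter> W)"
      proof -
        have "f ` P k = (\<lambda>y. f (\<psi> y)) ` (V \<inter> (U \<inter> W))" by (simp add: P_def k' image_image)
        also have "\<dots> = \<zeta> ` (V \<inter> (U \<inter> W))" by (rule image_cong) (use L(4) in auto)
        also have "V \<inter> (U \<inter> W) = U \<inter> W" by (auto simp: W_def)
        finally show ?thesis .
      qed
      ultimately show ?thesis by (simp add: k')
    qed
    have "(\<Sum>(U, \<zeta>)\<in>F. emeasure lborel (\<zeta> ` (U \<inter> W))) = (\<Sum>k\<in>F. emeasure lborel (snd k ` (fst k \<inter> W)))"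
      by (simp add: case_prod_beta)
    also have "\<dots> \<le> (\<Sum>k\<in>F. ennreal (B\<^sup>2) * emeasure lborel (P k))" using le by (rule sum_mono)
    also have "\<dots> = ennreal (B\<^sup>2) * (\<Sum>k\<in>F. emeasure lborel (P k))" by (simp add: sum_distrib_left)
    also have "(\<Sum>k\<in>F. emeasure lborel (P k)) = emeasure lborel (\<Union>k\<in>F. P k)"
    proof (rule sum_emeasure)
      show "P ` F \<subseteq> sets lborel" using P by auto
      show "disjoint_family_on P F"
        unfolding disjoint_family_on_def
      proof (intro ballI impI)
        fix k l assume kl: "k \<in> F" "l \<in> F" "k \<noteq> l"
        then have "disjnt (fst k) (fst l)" using disj by (auto simp: pairwise_def)
        then show "P k \<inter> P l = {}" using chart_inj[OF c(1)] by (auto simp: P_def disjnt_iff inj_on_def)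
      qed
    qed (rule fin)
    also have "\<dots> \<le> emeasure lborel (ball (\<psi> x) r)" by (rule emeasure_mono) (auto simp: P_def W_def)
    finally show ?thesis unfolding K_def by (simp add: mult_left_mono)
  qed
  then show ?thesis using W K c r by (intro exI[of _ W] exI[of _ K]) (auto simp: W_def)
qed

lemma area_finite: "area_ennreal < \<infinity>"
proof -
  define \<U> where "\<U> = {W. openin S W \<and> (\<exists>K<(\<infinity>::ennreal). \<forall>F\<in>families. (\<Sum>(U, \<zeta>)\<in>F. emeasure lborel (\<zeta> ` (U \<inter> W))) \<le> K)}"
  have op: "openin S W" if "W \<in> \<U>" for W using that by (simp add: \<U>_def)
  have cover: "topspace S \<subseteq> \<Union>\<U>" using area_piece unfolding \<U>_def by fast
  have "compactin S (topspace S)" using cs by (simp add: compact_space_def)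
  then have "\<exists>\<F>. finite \<F> \<and> \<F> \<subseteq> \<U> \<and> topspace S \<subseteq> \<Union>\<F>" using op cover by (rule compactinD)
  then obtain \<F> where \<F>: "finite \<F>" "\<F> \<subseteq> \<U>" "topspace S \<subseteq> \<Union>\<F>" by (elim exE conjE)
  have "\<forall>W\<in>\<F>. \<exists>K<(\<infinity>::ennreal). \<forall>F\<in>families. (\<Sum>(U, \<zeta>)\<in>F. emeasure lborel (\<zeta> ` (U \<inter> W))) \<le> K"
    using \<F>(2) unfolding \<U>_def by blast
  then obtain K where K: "\<And>W. W \<in> \<F> \<Longrightarrow> K W < (\<infinity>::ennreal)"
    "\<And>W F. W \<in> \<F> \<Longrightarrow> F \<in> families \<Longrightarrow> (\<Sum>(U, \<zeta>)\<in>F. emeasure lborel (\<zeta> ` (U \<inter> W))) \<le> K W" by metis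
  have "(\<Sum>(U, \<zeta>)\<in>F. emeasure lborel (\<zeta> ` U)) \<le> (\<Sum>W\<in>\<F>. K W)" if F: "F \<in> families" for F
  proof -
    have le: "emeasure lborel (\<zeta> ` U) \<le> (\<Sum>W\<in>\<F>. emeasure lborel (\<zeta> ` (U \<inter> W)))" if "(U, \<zeta>) \<in> F" for U \<zeta>
    proof -
      have t: "(U, \<zeta>) \<in> translation_charts X" using that F by (auto simp: families_def)
      then have "openin S U" by (simp add: translation_charts_def local_primitive_def)
      then have "U \<subseteq> \<Union>\<F>" using openin_subset[of S U] \<F>(3) by (meson order_trans)
      then have sub: "\<zeta> ` U \<subseteq> (\<Union>W\<in>\<F>. \<zeta> ` (U \<inter> W))" by blast
      have b: "\<zeta> ` (U \<inter> W) \<in> sets lborel" if W: "W \<in> \<F>" for W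
      proof -
        have "openin S W" using op W \<F>(2) by blast
        then have "open (\<zeta> ` (U \<inter> W))" by (rule translation_chart_image_open[OF t])
        then show ?thesis by simp
      qed
      have "emeasure lborel (\<zeta> ` U) \<le> emeasure lborel (\<Union>W\<in>\<F>. \<zeta> ` (U \<inter> W))"
        using \<F>(1) sub b by (intro emeasure_mono sets.finite_UN)
      also have "\<dots> \<le> (\<Sum>W\<in>\<F>. emeasure lborel (\<zeta> ` (U \<inter> W)))"
        using \<F>(1) b by (intro emeasure_subadditive_finite) auto
      finally show ?thesis .
    qed
    have "(\<Sum>(U, \<zeta>)\<in>F. emeasure lborel (\<zeta> ` U)) \<le> (\<Sum>(U, \<zeta>)\<in>F. \<Sum>W\<in>\<F>. emeasure lborel (\<zeta> ` (U \<inter> W)))"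
      using le by (intro sum_mono) auto
    also have "\<dots> = (\<Sum>W\<in>\<F>. \<Sum>(U, \<zeta>)\<in>F. emeasure lborel (\<zeta> ` (U \<inter> W)))"
      unfolding case_prod_beta by (rule sum.swap)
    also have "\<dots> \<le> (\<Sum>W\<in>\<F>. K W)" using K(2)[OF _ F] by (rule sum_mono)
    finally show ?thesis .
  qed
  then have "area_ennreal \<le> (\<Sum>W\<in>\<F>. K W)" unfolding area_ennreal_def by (rule SUP_least)
  also have "\<dots> < \<infinity>" using \<F>(1) K(1) by (simp add: less_top)
  finally show ?thesis .
qed

lemma rot_area_le:
  assumes c: "cmod c = 1"
  shows "area_ennreal \<le> trans_surf.area_ennreal (rot c X)"
proof -
  have c0: "c \<noteq> 0" using c by auto
  interpret Y: trans_surf "rot c X" using rot_translation_surface[OF c0] by unfold_locales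
  have "(\<Sum>(U, \<zeta>)\<in>F. emeasure lborel (\<zeta> ` U)) \<le> Y.area_ennreal" if F: "F \<in> families" for F
  proof -
    define T where "T = (\<lambda>k::'a chart. (fst k, \<lambda>x. c * snd k x))"
    have "inj T"
    proof (rule injI)
      fix k l assume "T k = T l"
      then have "fst k = fst l" "\<And>x. c * snd k x = c * snd l x" by (auto simp: T_def fun_eq_iff)
      then show "k = l" using c0 by (auto simp: prod_eq_iff fun_eq_iff)
    qed
    have sub: "F \<subseteq> translation_charts X" using F by (simp add: families_def)
    have "T k \<in> translation_charts (rot c X)" if "k \<in> F" for k
      using rot_translation_charts[OF c0, of "fst k" "snd k"] sub that by (auto simp: T_def)
    moreover have "pairwise (\<lambda>c d. disjnt (fst c) (fst d)) (T ` F)"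
      using F by (auto simp: families_def pairwise_def T_def)
    ultimately have TF: "T ` F \<in> Y.families" using F by (auto simp: families_def Y.families_def)
    have "emeasure lborel (snd (T k) ` fst (T k)) = emeasure lborel (snd k ` fst k)" if k: "k \<in> F" for k
    proof -
      have t: "(fst k, snd k) \<in> translation_charts X" using sub k by auto
      have "openin S (fst k)" using t unfolding translation_charts_def local_primitive_def by fast
      from translation_chart_image_open[OF t this] have "open (snd k ` fst k)" by simp
      then have "emeasure lborel ((*) c ` (snd k ` fst k)) = emeasure lborel (snd k ` fst k)" using c by (rule emeasure_rotation)
      then show ?thesis by (simp add: T_def image_image)
    qed
    then have "(\<Sum>k\<in>F. emeasure lborel (snd k ` fst k)) = (\<Sum>k\<in>T ` F. emeasure lborel (snd k ` fst k))"
      using sum.reindex[OF inj_on_subset[OF \<open>inj T\<close> subset_UNIV], of "\<lambda>k. emeasure lborel (snd k ` fst k)" F] by (simp add: comp_def)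
    also have "\<dots> \<le> Y.area_ennreal"
      using SUP_upper[OF TF, of "\<lambda>F. \<Sum>(U, \<zeta>)\<in>F. emeasure lborel (\<zeta> ` U)"] by (simp add: Y.area_ennreal_def case_prod_beta)
    finally show ?thesis by (simp add: case_prod_beta)
  qed
  then show ?thesis unfolding area_ennreal_def by (rule SUP_least)
qed

lemma rot_area:
  assumes c: "cmod c = 1"
  shows "area (rot c X) = area X"
proof -
  have c0: "c \<noteq> 0" using c by auto
  interpret Y: trans_surf "rot c X" using rot_translation_surface[OF c0] by unfold_locales
  have "rot (inverse c) (rot c X) = X" using c0 by (intro rot_rot) simp
  moreover have "cmod (inverse c) = 1" using c by (simp add: norm_inverse)
  ultimately have "Y.area_ennreal \<le> area_ennreal" using Y.rot_area_le[of "inverse c"] by simp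
  then have "Y.area_ennreal = area_ennreal" using rot_area_le[OF c] by simp
  then show ?thesis by (simp add: area_eq Y.area_eq)
qed

definition rot_mat :: "complex \<Rightarrow> real^2^2" where
  "rot_mat c = vector [vector [Re c, - Im c], vector [Im c, Re c]]"

lemma rot_image:
  assumes c: "cmod c = 1"
  shows "is_image_under (rot_mat c) X (rot c X)"
proof -
  have c0: "c \<noteq> 0" using c by auto
  have act: "mat_act (rot_mat c) z = c * z" for z
    by (simp add: mat_act_def rot_mat_def complex_eq_iff)
  have "(U, mat_act (rot_mat c) \<circ> \<zeta> \<circ> inv_into (topspace S) id) \<in> translation_charts (rot c X)"
    if t: "(U, \<zeta>) \<in> translation_charts X" for U \<zeta>
  proof -
    \<comment> \<open>The homeomorphism is the identity, but its \<open>inv_into\<close> is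
      controlled on the carrier only; hence the detour through a function that agrees with c \<zeta>
      there.\<close>
    define \<xi> where "\<xi> = mat_act (rot_mat c) \<circ> \<zeta> \<circ> inv_into (topspace S) id"
    have U: "openin S U" using t by (simp add: translation_charts_def local_primitive_def)
    have \<xi>: "\<xi> x = c * \<zeta> x" if "x \<in> topspace S" for x
      using inv_into_f_f[of id "topspace S" x] that by (simp add: \<xi>_def act)
    have t': "(U, \<lambda>x. c * \<zeta> x) \<in> translation_charts (rot c X)" by (rule rot_translation_charts[OF c0 t])
    have "((\<xi> \<circ> inv_into V \<psi>) has_field_derivative form (rot c X) (V, \<psi>) (\<psi> x)) (at (\<psi> x))"
      if V: "(V, \<psi>) \<in> atlas X" "x \<in> U \<inter> V" for V \<psi> x
    proof (rule has_field_derivative_transform_within_open[of "(\<lambda>x. c * \<zeta> x) \<circ> inv_into V \<psi>" _ _ "\<psi> ` V"])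
      show "(((\<lambda>x. c * \<zeta> x) \<circ> inv_into V \<psi>) has_field_derivative form (rot c X) (V, \<psi>) (\<psi> x)) (at (\<psi> x))"
        using t' V unfolding translation_charts_def local_primitive_def by fastforce
      show "open (\<psi> ` V)" by (rule chart(2)[OF V(1)])
      show "\<psi> x \<in> \<psi> ` V" using V by blast
      show "((\<lambda>x. c * \<zeta> x) \<circ> inv_into V \<psi>) z = (\<xi> \<circ> inv_into V \<psi>) z" if "z \<in> \<psi> ` V" for z
        using \<xi> chart_subset[OF V(1)] inv_into_into[OF that] by auto
    qed
    then have "local_primitive (rot c X) U \<xi>" using U unfolding local_primitive_def rot_simps by blast
    moreover have "inj_on \<xi> U"
    proof -
      have "inj_on (\<lambda>x. c * \<zeta> x) U" using t' by (simp add: translation_charts_def)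
      moreover have "\<xi> x = c * \<zeta> x" if "x \<in> U" for x using \<xi> openin_subset[OF U] that by blast
      ultimately show ?thesis by (simp cong: inj_on_cong)
    qed
    ultimately show ?thesis by (simp add: translation_charts_def \<xi>_def)
  qed
  then show ?thesis unfolding is_image_under_def
    by (intro exI[of _ id]) auto
qed

lemma rot_mem:
  assumes I: "SL2_invariant I" "X \<in> I" and c: "cmod c = 1"
  shows "rot c X \<in> I"
proof -
  have "det (rot_mat c) = (cmod c)\<^sup>2"
    unfolding cmod_power2 by (simp add: det_2 rot_mat_def power2_eq_square)
  then have "det (rot_mat c) = 1" using c by simp
  moreover have "translation_surface (rot c X)" using c by (intro rot_translation_surface) auto
  ultimately show ?thesis using I rot_image[OF c] unfolding SL2_invariant_def by blast
qed

end

section \<open>The Lagrange spectrum\<close>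

text \<open>With \<open>s = sqrt (1 + \<alpha>\<^sup>2)\<close>, the numbers \<open>(x - \<alpha> y) / s\<close> and \<open>(\<alpha> x + y) / s\<close> are the coordinates of
  \<open>(x, y)\<close> after the rotation that makes the direction \<open>(\<alpha>, 1)\<close> vertical.\<close>

locale rotated_lattice =
  fixes H :: "(int \<times> int) set" and \<alpha> L :: real
  assumes uminus: "(x, y) \<in> H \<Longrightarrow> (- x, - y) \<in> H"
    and lower: "0 < \<epsilon> \<Longrightarrow> \<exists>Y. \<forall>(x, y)\<in>H. Y \<le> y \<longrightarrow> L - \<epsilon> \<le> of_int y * \<bar>of_int x - \<alpha> * of_int y\<bar>"
    and upper: "0 < \<epsilon> \<Longrightarrow> \<exists>(x, y)\<in>H. Y \<le> y \<and> of_int y * \<bar>of_int x - \<alpha> * of_int y\<bar> \<le> L + \<epsilon>"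
    and L: "0 < L"
begin

definition s :: real where "s = sqrt (1 + \<alpha>\<^sup>2)"

text \<open>With \<delta> = x - \<alpha> y the rotated height \<alpha> x + y equals (1 + \<alpha>^2)
  (y + \<beta> \<delta>). So it is asymptotic to a constant times y whenever \<delta> stays
  small.\<close>

definition \<beta> :: real where "\<beta> = \<alpha> / (1 + \<alpha>\<^sup>2)"

definition xc :: "int \<times> int \<Rightarrow> real" where "xc v = (of_int (fst v) - \<alpha> * of_int (snd v)) / s"
definition yc :: "int \<times> int \<Rightarrow> real" where "yc v = (\<alpha> * of_int (fst v) + of_int (snd v)) / s"

lemma s: "1 \<le> s" "s * s = 1 + \<alpha>\<^sup>2"
  by (simp_all add: s_def)

lemma pos: "0 < 1 + \<alpha>\<^sup>2"
  by (simp add: add_pos_nonneg)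

lemma yc_eq: "yc (x, y) = s * (of_int y + \<beta> * (of_int x - \<alpha> * of_int y))"
proof -
  have "s * s * (of_int y + \<beta> * (of_int x - \<alpha> * of_int y)) = \<alpha> * of_int x + of_int y"
    unfolding s \<beta>_def using pos by (simp add: field_simps power2_eq_square)
  then show ?thesis using s(1) by (simp add: yc_def field_simps)
qed

lemma area_eq: "\<bar>xc (x, y)\<bar> * \<bar>yc (x, y)\<bar> =
  \<bar>of_int x - \<alpha> * of_int y\<bar> * \<bar>of_int y + \<beta> * (of_int x - \<alpha> * of_int y)\<bar>"
  using s(1) unfolding yc_eq by (simp add: xc_def abs_mult)

text \<open>A vector with small area and large rotated height has small \<delta>. Then the area
  differs from y |\<delta>| by at most |\<beta>| \<delta>^2, and the bound \<open>lower\<close>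
  carries over. Negative heights are reduced to positive ones by symmetry.\<close>

lemma area_lower:
  assumes \<epsilon>: "0 < \<epsilon>"
  shows "\<exists>b. \<forall>v\<in>H. b \<le> \<bar>yc v\<bar> \<longrightarrow> L - \<epsilon> \<le> \<bar>xc v\<bar> * \<bar>yc v\<bar>"
proof -
  obtain Y where Y: "\<And>x y. (x, y) \<in> H \<Longrightarrow> Y \<le> y \<Longrightarrow> L - \<epsilon> / 2 \<le> of_int y * \<bar>of_int x - \<alpha> * of_int y\<bar>"
    using lower[of "\<epsilon> / 2"] \<epsilon> by fastforce
  define \<eta> where "\<eta> = min 1 (\<epsilon> / (2 * (1 + \<bar>\<beta>\<bar>)))"
  have \<eta>: "0 < \<eta>" "\<eta> \<le> 1" "\<bar>\<beta>\<bar> * \<eta> \<le> \<epsilon> / 2"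
  proof -
    show "0 < \<eta>" "\<eta> \<le> 1" using \<epsilon> by (auto simp: \<eta>_def)
    have "(1 + \<bar>\<beta>\<bar>) * \<eta> \<le> (1 + \<bar>\<beta>\<bar>) * (\<epsilon> / (2 * (1 + \<bar>\<beta>\<bar>)))" by (intro mult_left_mono) (auto simp: \<eta>_def)
    also have "\<dots> = \<epsilon> / 2" by (simp add: add_pos_nonneg field_simps)
    finally show "\<bar>\<beta>\<bar> * \<eta> \<le> \<epsilon> / 2" using \<open>0 < \<eta>\<close> by (simp add: distrib_right)
  qed
  define M where "M = \<bar>of_int Y\<bar> + \<bar>\<beta>\<bar> + 1"
  \<comment> \<open>The first entry forces |\<delta>| <= \<eta> for a vector violating the bound,
    the second forces y to be nonnegative and at least Y.\<close>
  define b where "b = max (s * L / \<eta>) (s * M)"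
  have M: "0 < M" by (simp add: M_def add_nonneg_pos)
  have b: "0 < b" using M s(1) by (simp add: b_def less_max_iff_disj)
  have main: "L - \<epsilon> \<le> \<bar>xc (x, y)\<bar> * \<bar>yc (x, y)\<bar>" if v: "(x, y) \<in> H" "b \<le> \<bar>yc (x, y)\<bar>" "0 \<le> yc (x, y)" for x y
  proof (rule ccontr)
    assume "\<not> L - \<epsilon> \<le> \<bar>xc (x, y)\<bar> * \<bar>yc (x, y)\<bar>"
    then have lt: "\<bar>xc (x, y)\<bar> * \<bar>yc (x, y)\<bar> < L - \<epsilon>" by simp
    define \<delta> where "\<delta> = of_int x - \<alpha> * of_int y"
    have "\<bar>xc (x, y)\<bar> * b \<le> \<bar>xc (x, y)\<bar> * \<bar>yc (x, y)\<bar>" using v(2) by (intro mult_left_mono) auto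
    then have "\<bar>xc (x, y)\<bar> * b \<le> L" using lt \<epsilon> by linarith
    then have "\<bar>\<delta>\<bar> * b \<le> s * L" using s(1) by (simp add: xc_def \<delta>_def field_simps)
    moreover have "s * L \<le> \<eta> * b" using \<eta>(1) by (simp add: b_def field_simps max_def)
    ultimately have "\<bar>\<delta>\<bar> * b \<le> \<eta> * b" by linarith
    then have \<delta>: "\<bar>\<delta>\<bar> \<le> \<eta>" using b by simp
    have \<beta>\<delta>: "\<bar>\<beta> * \<delta>\<bar> \<le> \<bar>\<beta>\<bar>" using \<delta> \<eta>(2) by (simp add: abs_mult mult_left_le)
    have "s * M \<le> s * (of_int y + \<beta> * \<delta>)" using v(2,3) unfolding yc_eq \<delta>_def[symmetric] b_def by simp
    then have "M \<le> of_int y + \<beta> * \<delta>" using s(1) by simp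
    then have y: "of_int Y \<le> (of_int y :: real)" "0 \<le> (of_int y :: real)" using \<beta>\<delta> unfolding M_def by linarith+
    then have "L - \<epsilon> / 2 \<le> of_int y * \<bar>\<delta>\<bar>" using Y[OF v(1)] by (simp add: \<delta>_def)
    also have "of_int y * \<bar>\<delta>\<bar> = \<bar>\<delta>\<bar> * \<bar>of_int y + \<beta> * \<delta> - \<beta> * \<delta>\<bar>" using y by simp
    also have "\<dots> \<le> \<bar>\<delta>\<bar> * (\<bar>of_int y + \<beta> * \<delta>\<bar> + \<bar>\<beta> * \<delta>\<bar>)" by (intro mult_left_mono abs_triangle_ineq4) auto
    also have "\<dots> = \<bar>\<delta>\<bar> * \<bar>of_int y + \<beta> * \<delta>\<bar> + \<bar>\<delta>\<bar> * (\<bar>\<beta>\<bar> * \<bar>\<delta>\<bar>)" by (simp add: distrib_left abs_mult)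
    also have "\<bar>\<delta>\<bar> * (\<bar>\<beta>\<bar> * \<bar>\<delta>\<bar>) \<le> 1 * (\<bar>\<beta>\<bar> * \<eta>)" using \<delta> \<eta> by (intro mult_mono mult_left_mono) auto
    also have "\<bar>\<delta>\<bar> * \<bar>of_int y + \<beta> * \<delta>\<bar> < L - \<epsilon>" using lt unfolding area_eq \<delta>_def .
    finally show False using \<eta>(3) by linarith
  qed
  have "L - \<epsilon> \<le> \<bar>xc v\<bar> * \<bar>yc v\<bar>" if v: "v \<in> H" "b \<le> \<bar>yc v\<bar>" for v
  proof -
    obtain x y where xy: "v = (x, y)" by force
    show ?thesis
    proof (cases "0 \<le> yc v")
      case True
      then show ?thesis using main v unfolding xy by blast
    next
      case False
      have e: "xc (- x, - y) = - xc (x, y)" "yc (- x, - y) = - yc (x, y)"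
        by (simp_all add: xc_def yc_def minus_divide_left)
      have "L - \<epsilon> \<le> \<bar>xc (- x, - y)\<bar> * \<bar>yc (- x, - y)\<bar>"
        by (rule main) (use uminus v False in \<open>simp_all add: xy e\<close>)
      then show ?thesis by (simp add: e xy)
    qed
  qed
  then show ?thesis by blast
qed

lemma area_upper:
  assumes \<epsilon>: "0 < \<epsilon>"
  shows "\<exists>v\<in>H. b \<le> \<bar>yc v\<bar> \<and> \<bar>xc v\<bar> * \<bar>yc v\<bar> \<le> L + \<epsilon>"
proof -
  define C where "C = L + \<epsilon> / 2"
  have C: "0 < C" using L \<epsilon> by (simp add: C_def)
  \<comment> \<open>Since y |\<delta>| <= C, the condition y >= C gives |\<delta>| <= 1. The third
    entry makes the correction by \<beta> at most \<epsilon> / 2, and the last one lifts the rotated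
    height above b.\<close>
  define R where "R = max 1 (max (C) (max (\<bar>\<beta>\<bar> * C * 2 / \<epsilon>) (\<bar>b\<bar> + \<bar>\<beta>\<bar>)))"
  obtain x y where v: "(x, y) \<in> H" "\<lceil>R\<rceil> \<le> y" "of_int y * \<bar>of_int x - \<alpha> * of_int y\<bar> \<le> C"
    using upper[of "\<epsilon> / 2" "\<lceil>R\<rceil>"] \<epsilon> unfolding C_def by fastforce
  define \<delta> where "\<delta> = of_int x - \<alpha> * of_int y"
  have yR: "R \<le> of_int y" using v(2) by (simp add: ceiling_le_iff)
  have y: "1 \<le> (of_int y :: real)" "C \<le> of_int y" "\<bar>\<beta>\<bar> * C * 2 / \<epsilon> \<le> of_int y" "\<bar>b\<bar> + \<bar>\<beta>\<bar> \<le> of_int y"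
    using yR unfolding R_def by linarith+
  have yd: "of_int y * \<bar>\<delta>\<bar> \<le> C" using v(3) by (simp add: \<delta>_def)
  have "of_int y * \<bar>\<delta>\<bar> \<le> of_int y * 1" using yd y by linarith
  then have \<delta>1: "\<bar>\<delta>\<bar> \<le> 1" using y(1) by simp
  have "\<bar>\<beta>\<bar> * \<bar>\<delta>\<bar> \<le> \<epsilon> / 2"
  proof -
    have "\<bar>\<beta>\<bar> * \<bar>\<delta>\<bar> * of_int y \<le> \<bar>\<beta>\<bar> * C" using mult_left_mono[OF yd, of "\<bar>\<beta>\<bar>"] by (simp add: mult_ac)
    also have "\<dots> \<le> \<epsilon> / 2 * of_int y" using y(3) \<epsilon> by (simp add: field_simps)
    finally show ?thesis using y(1) by simp
  qed
  moreover have "\<bar>\<delta>\<bar> * (\<bar>\<beta>\<bar> * \<bar>\<delta>\<bar>) \<le> 1 * (\<bar>\<beta>\<bar> * \<bar>\<delta>\<bar>)" using \<delta>1 by (intro mult_right_mono) auto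
  ultimately have small: "\<bar>\<delta>\<bar> * (\<bar>\<beta>\<bar> * \<bar>\<delta>\<bar>) \<le> \<epsilon> / 2" by linarith
  have "\<bar>\<delta>\<bar> * \<bar>of_int y + \<beta> * \<delta>\<bar> \<le> \<bar>\<delta>\<bar> * (\<bar>of_int y\<bar> + \<bar>\<beta> * \<delta>\<bar>)" by (intro mult_left_mono abs_triangle_ineq) auto
  also have "\<dots> = of_int y * \<bar>\<delta>\<bar> + \<bar>\<delta>\<bar> * (\<bar>\<beta>\<bar> * \<bar>\<delta>\<bar>)" using y(1) by (simp add: distrib_left abs_mult)
  also have "\<dots> \<le> L + \<epsilon>" using yd small by (simp add: C_def)
  finally have "\<bar>xc (x, y)\<bar> * \<bar>yc (x, y)\<bar> \<le> L + \<epsilon>" unfolding area_eq \<delta>_def .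
  moreover have "b \<le> \<bar>yc (x, y)\<bar>"
  proof -
    have "\<bar>\<beta> * \<delta>\<bar> \<le> \<bar>\<beta>\<bar>" using \<delta>1 by (simp add: abs_mult mult_left_le)
    then have "\<bar>b\<bar> \<le> of_int y + \<beta> * \<delta>" using y(4) by linarith
    moreover have "1 * (of_int y + \<beta> * \<delta>) \<le> s * (of_int y + \<beta> * \<delta>)" using calculation s(1) by (intro mult_right_mono) auto
    ultimately have "b \<le> s * (of_int y + \<beta> * \<delta>)" by simp
    then show ?thesis unfolding yc_eq \<delta>_def by (rule order_trans) (rule abs_ge_self)
  qed
  ultimately show ?thesis using v(1) by blast
qed

end

section \<open>The ray in the spectrum of a locus containing the square-tiled surface\<close>

context square_tiling
begin

definition Hint :: "(int \<times> int) set" where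
  "Hint = {v. saddle_vec (Complex (of_int (fst v)) (of_int (snd v)))}"

lemma twist_invariant_Hint: "twist_invariant Hint (fact sheets)"
proof
  show "0 < (fact sheets :: nat)" by simp
  show "(- x, - y) \<in> Hint" if "(x, y) \<in> Hint" for x y
  proof -
    have "- Complex (of_int x) (of_int y) = Complex (of_int (- x)) (of_int (- y))" by (simp add: complex_eq_iff)
    then show ?thesis using saddle_vec_minus[of "Complex (of_int x) (of_int y)"] that by (simp add: Hint_def)
  qed
  show "(0, 0) \<notin> Hint" by (auto simp: Hint_def saddle_vec_def Complex_eq_0)
  fix a b x y l :: int assume "(x, y) \<in> Hint"
  then have v: "saddle_vec (Complex (of_int x) (of_int y))" by (simp add: Hint_def)
  define e where "e = Complex (of_int a) (of_int b)"
  have "saddle_vec (Complex (of_int x) (of_int y) +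
    of_real (of_int (l * fact sheets) * wedge e (Complex (of_int x) (of_int y))) * e)"
    by (rule saddle_vec_twist[OF v]) (simp add: e_def gauss_def)
  moreover have "Complex (of_int x) (of_int y) +
    of_real (of_int (l * fact sheets) * wedge e (Complex (of_int x) (of_int y))) * e =
    Complex (of_int (x + l * int (fact sheets) * (a * y - b * x) * a)) (of_int (y + l * int (fact sheets) * (a * y - b * x) * b))"
    by (simp add: e_def wedge_def complex_eq_iff algebra_simps)
  ultimately show "(x + l * int (fact sheets) * (a * y - b * x) * a, y + l * int (fact sheets) * (a * y - b * x) * b) \<in> Hint"
    by (simp add: Hint_def)
qed

lemma Hol_eq_Hint: "Hol X = (\<lambda>v. Complex (of_int (fst v)) (of_int (snd v))) ` Hint"
proof -
  have "v \<in> (\<lambda>v. Complex (of_int (fst v)) (of_int (snd v))) ` Hint" if sv: "saddle_vec v" for v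
  proof -
    obtain m n where "v = Complex (of_int m) (of_int n)" using saddle_vec_gauss[OF sv] by (auto simp: gauss_iff)
    then show ?thesis using sv by (intro image_eqI[of _ _ "(m, n)"]) (auto simp: Hint_def)
  qed
  then show ?thesis unfolding Hol_eq by (auto simp: Hint_def)
qed

lemma lagrange_a_rot:
  assumes irr: "\<alpha> \<notin> \<rat>" and rl: "rotated_lattice Hint \<alpha> L" and area: "0 < area X"
  shows "\<exists>c. cmod c = 1 \<and> lagrange_a (rot c X) = ereal (L / area X)"
proof -
  interpret R: rotated_lattice Hint \<alpha> L by (rule rl)
  \<comment> \<open>Multiplication by c sends \<alpha> + \<i> to s \<i>, which makes the direction
    (\<alpha>, 1) vertical.\<close>
  define c where "c = Complex 1 \<alpha> / of_real R.s"
  have s0: "0 < R.s" using R.s(1) by simp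
  have "cmod (Complex 1 \<alpha>) = R.s" by (simp add: cmod_def R.s_def)
  then have c1: "cmod c = 1" using s0 by (simp add: c_def norm_divide)
  then have c0: "c \<noteq> 0" by auto
  define w where "w v = c * Complex (of_int (fst v)) (of_int (snd v))" for v :: "int \<times> int"
  have Re_w: "Re (w v) = R.xc v" and Im_w: "Im (w v) = R.yc v" for v
    by (simp_all add: w_def c_def R.xc_def R.yc_def Re_divide_of_real Im_divide_of_real diff_divide_distrib add_divide_distrib)
  have Hol: "Hol (rot c X) = w ` Hint"
    unfolding rot_Hol[OF c0] Hol_eq_Hint image_image w_def ..
  \<comment> \<open>Irrationality of \<alpha> excludes vertical saddle connections, so
    \<open>lagrange_a\<close> is given by its lower limit.\<close>
  have nz: "Re u \<noteq> 0" if "u \<in> Hol (rot c X)" for u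
  proof
    assume "Re u = 0"
    obtain x y where xy: "(x, y) \<in> Hint" "u = w (x, y)" using \<open>u \<in> Hol (rot c X)\<close> unfolding Hol by auto
    have e: "of_int x = \<alpha> * of_int y" using \<open>Re u = 0\<close> s0 by (simp add: xy(2) Re_w R.xc_def)
    show False
    proof (cases "y = 0")
      case True
      then have "x = 0" using e by simp
      then show False using xy(1) True by (auto simp: Hint_def saddle_vec_def Complex_eq_0)
    next
      case False
      then have "\<alpha> = of_int x / of_int y" using e by (simp add: field_simps)
      then show False using irr by (simp add: Rats_divide)
    qed
  qed
  define F where "F = inf (filtercomap (\<lambda>v. \<bar>Im v\<bar>) at_top) (principal (Hol (rot c X)))"
  have ev: "eventually P F \<longleftrightarrow> (\<exists>b. \<forall>v\<in>Hint. b \<le> \<bar>R.yc v\<bar> \<longrightarrow> P (w v))" for P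
    unfolding F_def eventually_inf_principal eventually_filtercomap_at_top_linorder Hol Im_w[symmetric] by blast
  have val: "hol_area (w v) = \<bar>R.xc v\<bar> * \<bar>R.yc v\<bar>" for v by (simp add: hol_area_def Re_w Im_w)
  define A where "A = area X"
  have "Liminf F (\<lambda>v. ereal (hol_area v / A)) = ereal (L / A)"
  proof (rule antisym)
    show "ereal (L / A) \<le> Liminf F (\<lambda>v. ereal (hol_area v / A))"
      unfolding le_Liminf_iff
    proof (intro allI impI)
      fix y assume "y < ereal (L / A)"
      then have "y \<le> ereal (L / A - 1) \<or> (\<exists>z. y = ereal z \<and> z < L / A)" by (cases y) auto
      then obtain z where z: "y \<le> ereal z" "z < L / A" using that[of "L / A - 1"] that by auto
      define \<epsilon> where "\<epsilon> = (L - z * A) / 2"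
      have \<epsilon>: "0 < \<epsilon>" using z(2) area by (simp add: \<epsilon>_def A_def field_simps)
      obtain b where b: "\<forall>v\<in>Hint. b \<le> \<bar>R.yc v\<bar> \<longrightarrow> L - \<epsilon> \<le> \<bar>R.xc v\<bar> * \<bar>R.yc v\<bar>" using R.area_lower[OF \<epsilon>] by blast
      have "y < ereal (hol_area (w v) / A)" if "v \<in> Hint" "b \<le> \<bar>R.yc v\<bar>" for v
      proof -
        have "z * A < L - \<epsilon>" using \<epsilon> by (simp add: \<epsilon>_def field_simps)
        also have "\<dots> \<le> hol_area (w v)" using b that unfolding val by blast
        finally have "z < hol_area (w v) / A" using area by (simp add: A_def pos_less_divide_eq)
        then show ?thesis using z(1) by (metis ereal_less_eq(3) le_less_trans less_ereal.simps(1))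
      qed
      then show "eventually (\<lambda>v. y < ereal (hol_area v / A)) F" unfolding ev by blast
    qed
    show "Liminf F (\<lambda>v. ereal (hol_area v / A)) \<le> ereal (L / A)"
    proof (rule ccontr)
      assume "\<not> ?thesis"
      then obtain z where z: "ereal (L / A) < ereal z" "ereal z < Liminf F (\<lambda>v. ereal (hol_area v / A))"
        using ereal_dense2 by (metis not_le)
      have "eventually (\<lambda>v. ereal z < ereal (hol_area v / A)) F"
        using less_LiminfD[OF z(2)] .
      then obtain b where b: "\<forall>v\<in>Hint. b \<le> \<bar>R.yc v\<bar> \<longrightarrow> ereal z < ereal (hol_area (w v) / A)" unfolding ev by blast
      define \<epsilon> where "\<epsilon> = z * A - L"
      have \<epsilon>: "0 < \<epsilon>" using z(1) area by (simp add: \<epsilon>_def A_def field_simps)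
      obtain v where v: "v \<in> Hint" "b \<le> \<bar>R.yc v\<bar>" "\<bar>R.xc v\<bar> * \<bar>R.yc v\<bar> \<le> L + \<epsilon>" using R.area_upper[OF \<epsilon>] by blast
      have "z < hol_area (w v) / A" using b v by simp
      then have "z * A < hol_area (w v)" using area by (simp add: A_def pos_less_divide_eq)
      then show False using v(3) unfolding val \<epsilon>_def by linarith
    qed
  qed
  moreover have "area (rot c X) = A" using rot_area[OF c1] by (simp add: A_def)
  ultimately have "lagrange_a (rot c X) = ereal (L / A)"
    unfolding lagrange_a_def F_def using nz by auto
  then show ?thesis using c1 by (auto simp: A_def)
qed

lemma hall_ray:
  assumes I: "SL2_invariant I" "X \<in> I"
  shows "\<exists>r::real. r > 0 \<and> {ereal r..<\<infinity>} \<subseteq> lagrange_spectrum I"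
proof -
  interpret T: twist_invariant Hint "fact sheets" by (rule twist_invariant_Hint)
  have prim': "\<exists>U \<zeta>. x \<in> U \<and> local_primitive X U \<zeta>" if "x \<in> topspace S" for x using prim[OF that] by blast
  have A: "0 < area X"
    unfolding area_eq using area_pos[OF prim'] area_finite by (simp add: enn2real_positive_iff)
  obtain n :: nat where "saddle_vec (of_nat n)" using saddle_vec_horizontal by blast
  moreover have "of_nat n = Complex (of_int (int n)) (of_int 0)" by (simp add: complex_eq_iff)
  ultimately have "(int n, 0) \<in> Hint" by (simp add: Hint_def)
  from T.hall_approximation[OF this] obtain m0 r0 :: real where m0: "0 < m0" and r0: "0 < r0" and
    hall: "\<And>t. r0 \<le> t \<Longrightarrow> \<exists>\<alpha>::real. \<alpha> \<notin> \<rat> \<and>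
      (\<forall>\<epsilon>>0. \<exists>Y. \<forall>(x, y)\<in>Hint. Y \<le> y \<longrightarrow> m0\<^sup>2 / t - \<epsilon> \<le> of_int y * \<bar>of_int x - \<alpha> * of_int y\<bar>) \<and>
      (\<forall>\<epsilon>>0. \<forall>Y. \<exists>(x, y)\<in>Hint. Y \<le> y \<and> of_int y * \<bar>of_int x - \<alpha> * of_int y\<bar> \<le> m0\<^sup>2 / t + \<epsilon>)"
    by blast
  define r where "r = r0 * area X / m0\<^sup>2"
  have r: "0 < r" using r0 m0 A by (simp add: r_def)
  have "ereal u \<in> lagrange_spectrum I" if u: "r \<le> u" for u
  proof -
    \<comment> \<open>With this t the lower limit m0^2 / t, divided by the area, is 1 / u.\<close>
    define t where "t = u * m0\<^sup>2 / area X"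
    have u0: "0 < u" using u r by simp
    have t: "r0 \<le> t" using u A m0 by (simp add: t_def r_def field_simps)
    define L where "L = m0\<^sup>2 / t"
    have L: "0 < L" "L / area X = 1 / u" using m0 A u0 by (simp_all add: L_def t_def)
    obtain \<alpha> :: real where \<alpha>: "\<alpha> \<notin> \<rat>"
      "\<forall>\<epsilon>>0. \<exists>Y. \<forall>(x, y)\<in>Hint. Y \<le> y \<longrightarrow> L - \<epsilon> \<le> of_int y * \<bar>of_int x - \<alpha> * of_int y\<bar>"
      "\<forall>\<epsilon>>0. \<forall>Y. \<exists>(x, y)\<in>Hint. Y \<le> y \<and> of_int y * \<bar>of_int x - \<alpha> * of_int y\<bar> \<le> L + \<epsilon>"
      using hall[OF t] unfolding L_def by blast
    have "rotated_lattice Hint \<alpha> L"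
      by unfold_locales (use \<alpha> L T.uminus_H in auto)
    from lagrange_a_rot[OF \<alpha>(1) this A] obtain c where c: "cmod c = 1" "lagrange_a (rot c X) = ereal (L / area X)" by blast
    have "1 / lagrange_a (rot c X) = ereal u"
      unfolding c(2) L(2) using u0 by (simp add: one_ereal_def)
    moreover have "rot c X \<in> I" by (rule rot_mem[OF I c(1)])
    ultimately show ?thesis unfolding lagrange_spectrum_def by (intro CollectI exI[of _ "rot c X"]) simp
  qed
  moreover have "\<exists>u. x = ereal u \<and> r \<le> u" if "x \<in> {ereal r..<\<infinity>}" for x
    using that by (cases x) auto
  ultimately have "{ereal r..<\<infinity>} \<subseteq> lagrange_spectrum I" by blast
  then show ?thesis using r by blast
qed

end

theorem corollary1p7:
  fixes \<kappa> :: "nat multiset" and I :: "'a surface set"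
  assumes "invariant_locus \<kappa> I"
    and "\<exists>X\<in>I. square_tiled X"
  shows "\<exists>r::real. r > 0 \<and> {ereal r..<\<infinity>} \<subseteq> lagrange_spectrum I"
proof -
  obtain X where X: "X \<in> I" "square_tiled X" using assms(2) by blast
  then obtain p where p: "translation_surface X" "covering_off_origin (top_of X) p"
    "\<forall>x\<in>topspace (top_of X). \<exists>U \<zeta>. x \<in> U \<and> local_primitive X U \<zeta> \<and> (\<forall>y\<in>U. p y = torus_proj (\<zeta> y))"
    "\<forall>x\<in>sing X. p x = torus_proj 0"
    unfolding square_tiled_def by blast
  interpret trans_surf X using p(1) by unfold_locales
  interpret square_tiling X p
    by unfold_locales (use p in auto)
  show ?thesis using hall_ray assms(1) X(1) unfolding invariant_locus_def by blast
qed

end
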